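(* Let $X$ be a path connected, locally path connected, paracompact Hausdorff space with basepoint $x_0$. Then the sequence of groups $$1 \to \pi^{Sp}(X,x_0) \to \pi_1(X,x_0) \xrightarrow{\ \Psi_X\ } \check{\pi}_1(X,x_0),$$ where the second map is the inclusion, is exact; that is, $\ker\Psi_X=\pi^{Sp}(X,x_0)$. Moreover, the sequence is natural: if $f:X\to Y$ is a continuous map with $f(x_0)=y_0$ between two such based spaces $(X,x_0)$ and $(Y,y_0)$, then $f_\ast(\pi^{Sp}(X,x_0))\subseteq \pi^{Sp}(Y,y_0)$ and $\check{f}_\ast\circ\Psi_X=\Psi_Y\circ f_\ast$, where $f_\ast:\pi_1(X,x_0)\to\pi_1(Y,y_0)$ and $\check{f}_\ast:\check{\pi}_1(X,x_0)\to\check{\pi}_1(Y,y_0)$ are the induced homomorphisms.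
   Context: Paths are continuous maps from $[0,1]$, $\overline{\alpha}$ is the reverse of the path $\alpha$, $[\alpha]$ is the homotopy class rel. endpoints, and $[\alpha][\beta]=[\alpha\ast\beta]$ denotes concatenation. Spanier groups. For an open cover $\mathscr{U}$ of $X$, $\pi^{Sp}(\mathscr{U},x_0)$ is the subgroup of $\pi_1(X,x_0)$ generated by all elements $[\alpha][\gamma][\overline{\alpha}]$ where $\alpha$ is a path with $\alpha(0)=x_0$ and $\gamma$ is a loop based at $\alpha(1)$ with image in some $U\in\mathscr{U}$. The Spanier group is $\pi^{Sp}(X,x_0)=\bigcap_{\mathscr{U}}\pi^{Sp}(\mathscr{U},x_0)$, over all open covers $\mathscr{U}$ of $X$. First shape group. Consider pairs $(\mathscr{U},U_0)$ with $\mathscr{U}$ an open cover of $X$ and $x_0\in U_0\in\mathscr{U}$. $(\mathscr{V},V_0)$ refines $(\mathscr{U},U_0)$ if $\mathscr{V}$ refines $\mathscr{U}$ and $V_0\subseteq U_0$. The nerve $N(\mathscr{U})$ is the abstract simplicial complex with vertex set $\mathscr{U}$, in which $A_0,\dots,A_n$ span a simplex iff $\bigcap_i A_i\neq\emptyset$; $|N(\mathscr{U})|$ is its geometric realization, based at the vertex $U_0$. Let $\Lambda$ be the set of pairs $(\mathscr{U},U_0)$ admitting a partition of unity $\{\phi_U\}_{U\in\mathscr{U}}$ subordinated to $\mathscr{U}$ with $\phi_{U_0}(x_0)=1$, directed by refinement. If $(\mathscr{V},V_0)$ refines $(\mathscr{U},U_0)$, any vertex assignment $V\mapsto U$ with $V\subseteq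 U$ and $V_0\mapsto U_0$ defines a simplicial map $N(\mathscr{V})\to N(\mathscr{U})$ whose realization is unique up to based homotopy; the induced homomorphism is $p_{\mathscr{U}\mathscr{V}\ast}:\pi_1(|N(\mathscr{V})|,V_0)\to\pi_1(|N(\mathscr{U})|,U_0)$. Set $\check{\pi}_1(X,x_0)=\varprojlim(\pi_1(|N(\mathscr{U})|,U_0),p_{\mathscr{U}\mathscr{V}\ast},\Lambda)$. A canonical map for $(\mathscr{U},U_0)$ is a continuous map $p_{\mathscr{U}}:X\to|N(\mathscr{U})|$ with $p_{\mathscr{U}}(x_0)=U_0$ and $p_{\mathscr{U}}^{-1}(St(U,N(\mathscr{U})))\subseteq U$ for all $U\in\mathscr{U}$, where $St(U,N(\mathscr{U}))$ is the open star of the vertex $U$. For $(\mathscr{U},U_0)\in\Lambda$ canonical maps exist and are unique up to based homotopy, and they are compatible with the maps $p_{\mathscr{U}\mathscr{V}\ast}$ on $\pi_1$. Define $\Psi_X:\pi_1(X,x_0)\to\check{\pi}_1(X,x_0)$ by $\Psi_X([\alpha])=([p_{\mathscr{U}}\circ\alpha])_{(\mathscr{U},U_0)\in\Lambda}$. Induced map. For $f:(X,x_0)\to(Y,y_0)$ and an index $(\mathscr{W},W_0)$ for $Y$, let $f^{-1}\mathscr{W}=\{f^{-1}(W)\mid W\in\mathscr{W}\}$ (discarding the empty set). The $(\mathscr{W},W_0)$-component of $\check{f}_\ast$ is the projection of $\check{\pi}_1(X,x_0)$ to $\pi_1(|N(f^{-1}\mathscr{W})|,f^{-1}(W_0))$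 followed by the homomorphism induced by a simplicial map $N(f^{-1}\mathscr{W})\to N(\mathscr{W})$ sending each vertex $V$ to some $W\in\mathscr{W}$ with $f^{-1}(W)=V$, and $f^{-1}(W_0)$ to $W_0$. *)

theory Defs
  imports
    "HOL-Analysis.Analysis"
    "HOL-Algebra.Product_Groups"
    "HOL-Algebra.Generated_Groups"
begin

section \<open>Paths and the fundamental group of an abstract topological space\<close>

text \<open>The library's \<open>joinpaths\<close>, \<open>reversepath\<close> and \<open>homotopic_paths\<close> require the points to belong
  to a topological type class. Here the space is an arbitrary value of type \<open>'a topology\<close> (the
  weak topology on a nerve is not a type class topology), so the same notions are restated on
  top of \<^const>\<open>pathin\<close> and \<^const>\<open>homotopic_with\<close>.\<close>

definition path_concat :: "(real \<Rightarrow> 'a) \<Rightarrow> (real \<Rightarrow> 'a) \<Rightarrow> real \<Rightarrow> 'a" where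
  "path_concat p q = (\<lambda>t. if t \<le> 1/2 then p (2 * t) else q (2 * t - 1))"

definition path_reverse :: "(real \<Rightarrow> 'a) \<Rightarrow> real \<Rightarrow> 'a" where
  "path_reverse p = (\<lambda>t. p (1 - t))"

definition homotopic_rel_ends :: "'a topology \<Rightarrow> (real \<Rightarrow> 'a) \<Rightarrow> (real \<Rightarrow> 'a) \<Rightarrow> bool" where
  "homotopic_rel_ends X p q \<longleftrightarrow>
     homotopic_with (\<lambda>r. r 0 = p 0 \<and> r 1 = p 1) (top_of_set {0..1::real}) X p q"

definition path_class :: "'a topology \<Rightarrow> (real \<Rightarrow> 'a) \<Rightarrow> (real \<Rightarrow> 'a) set" where
  "path_class X p = {q. homotopic_rel_ends X p q}"

definition loops_at :: "'a topology \<Rightarrow> 'a \<Rightarrow> (real \<Rightarrow> 'a) set" where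
  "loops_at X x0 = {p. pathin X p \<and> p 0 = x0 \<and> p 1 = x0}"

text \<open>The product of two classes is the class of the concatenation of any representatives,
  written as the union over all choices of representatives; likewise for \<open>pi1_map\<close>.\<close>

definition fundamental_group :: "'a topology \<Rightarrow> 'a \<Rightarrow> (real \<Rightarrow> 'a) set monoid" where
  "fundamental_group X x0 =
     \<lparr>carrier = path_class X ` loops_at X x0,
      monoid.mult = (\<lambda>A B. \<Union>p\<in>A. \<Union>q\<in>B. path_class X (path_concat p q)),
      one = path_class X (\<lambda>_. x0)\<rparr>"

definition pi1_map :: "'b topology \<Rightarrow> ('a \<Rightarrow> 'b) \<Rightarrow> (real \<Rightarrow> 'a) set \<Rightarrow> (real \<Rightarrow> 'b) set" where
  "pi1_map Y f A = (\<Union>p\<in>A. path_class Y (f \<circ> p))"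


section \<open>Open covers, paracompactness, Spanier groups\<close>

definition open_cover :: "'a topology \<Rightarrow> 'a set set \<Rightarrow> bool" where
  "open_cover X \<U> \<longleftrightarrow> (\<forall>U\<in>\<U>. openin X U) \<and> \<Union>\<U> = topspace X"

definition cover_refines :: "'a set set \<Rightarrow> 'a set set \<Rightarrow> bool" where
  "cover_refines \<V> \<U> \<longleftrightarrow> (\<forall>V\<in>\<V>. \<exists>U\<in>\<U>. V \<subseteq> U)"

definition paracompact_space :: "'a topology \<Rightarrow> bool" where
  "paracompact_space X \<longleftrightarrow>
     (\<forall>\<U>. open_cover X \<U> \<longrightarrow>
        (\<exists>\<V>. open_cover X \<V> \<and> cover_refines \<V> \<U> \<and> locally_finite_in X \<V>))"

definition spanier_generators :: "'a topology \<Rightarrow> 'a \<Rightarrow> 'a set set \<Rightarrow> (real \<Rightarrow> 'a) set set" where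
  "spanier_generators X x0 \<U> =
     {path_class X (path_concat (path_concat \<alpha> \<gamma>) (path_reverse \<alpha>)) |\<alpha> \<gamma>.
        pathin X \<alpha> \<and> \<alpha> 0 = x0 \<and> \<gamma> \<in> loops_at X (\<alpha> 1) \<and> (\<exists>U\<in>\<U>. \<gamma> ` {0..1} \<subseteq> U)}"

definition spanier_cover_group :: "'a topology \<Rightarrow> 'a \<Rightarrow> 'a set set \<Rightarrow> (real \<Rightarrow> 'a) set set" where
  "spanier_cover_group X x0 \<U> =
     generate (fundamental_group X x0) (spanier_generators X x0 \<U>)"

definition spanier_group :: "'a topology \<Rightarrow> 'a \<Rightarrow> (real \<Rightarrow> 'a) set set" where
  "spanier_group X x0 = (\<Inter>\<U>\<in>{\<U>. open_cover X \<U>}. spanier_cover_group X x0 \<U>)"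


section \<open>Geometric realization of a simplicial complex\<close>

text \<open>An abstract simplicial complex is given by its set \<open>K\<close> of (finite, nonempty) simplices.
  Points of the realization are barycentric coordinate functions, and the realization carries
  the weak topology determined by its closed simplices; on a closed simplex, the product
  topology is the Euclidean one because only finitely many coordinates vary.\<close>

definition closed_simplex :: "'v set \<Rightarrow> ('v \<Rightarrow> real) set" where
  "closed_simplex \<sigma> = {t. (\<forall>v. 0 \<le> t v) \<and> {v. t v \<noteq> 0} \<subseteq> \<sigma> \<and> sum t \<sigma> = 1}"

definition realization_set :: "'v set set \<Rightarrow> ('v \<Rightarrow> real) set" where
  "realization_set K = (\<Union>\<sigma>\<in>K. closed_simplex \<sigma>)"

definition realization :: "'v set set \<Rightarrow> ('v \<Rightarrow> real) topology" where
  "realization K = topology (\<lambda>W. W \<subseteq> realization_set K \<and>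
     (\<forall>\<sigma>\<in>K. openin (subtopology (powertop_real UNIV) (closed_simplex \<sigma>)) (W \<inter> closed_simplex \<sigma>)))"

lemma openin_realization:
  "openin (realization K) W \<longleftrightarrow> W \<subseteq> realization_set K \<and>
     (\<forall>\<sigma>\<in>K. openin (subtopology (powertop_real UNIV) (closed_simplex \<sigma>)) (W \<inter> closed_simplex \<sigma>))"
proof -
  define L where "L = (\<lambda>W. W \<subseteq> realization_set K \<and>
     (\<forall>\<sigma>\<in>K. openin (subtopology (powertop_real UNIV) (closed_simplex \<sigma>)) (W \<inter> closed_simplex \<sigma>)))"
  have "istopology L"
    unfolding istopology_def
  proof (intro conjI allI impI)
    fix S T assume S: "L S" and T: "L T"
    have "S \<inter> T \<inter> C = (S \<inter> C) \<inter> (T \<inter> C)" for C by blast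
    with S T show "L (S \<inter> T)"
      unfolding L_def by (metis le_infI1 openin_Int)
  next
    fix \<W> assume \<W>: "\<forall>W\<in>\<W>. L W"
    have eq: "\<Union>\<W> \<inter> C = \<Union>((\<lambda>W. W \<inter> C) ` \<W>)" for C by blast
    have "openin (subtopology (powertop_real UNIV) (closed_simplex \<sigma>))
        (\<Union>\<W> \<inter> closed_simplex \<sigma>)" if "\<sigma> \<in> K" for \<sigma>
      unfolding eq using \<W> that unfolding L_def by (intro openin_Union) blast
    moreover have "\<Union>\<W> \<subseteq> realization_set K"
      using \<W> unfolding L_def by blast
    ultimately show "L (\<Union>\<W>)"
      unfolding L_def by blast
  qed
  then show ?thesis
    unfolding realization_def L_def by (simp add: topology_inverse')
qed

definition vertex_point :: "'v \<Rightarrow> 'v \<Rightarrow> real" where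
  "vertex_point v = (\<lambda>u. if u = v then 1 else 0)"

definition open_star :: "'v set set \<Rightarrow> 'v \<Rightarrow> ('v \<Rightarrow> real) set" where
  "open_star K v = {t \<in> realization_set K. t v > 0}"

definition simplicial_realization :: "('v \<Rightarrow> 'w) \<Rightarrow> ('v \<Rightarrow> real) \<Rightarrow> 'w \<Rightarrow> real" where
  "simplicial_realization r t = (\<lambda>w. \<Sum>v | t v \<noteq> 0 \<and> r v = w. t v)"


section \<open>Nerves, the first shape group and the canonical homomorphism\<close>

definition nerve :: "'a set set \<Rightarrow> 'a set set set" where
  "nerve \<U> = {\<sigma>. finite \<sigma> \<and> \<sigma> \<noteq> {} \<and> \<sigma> \<subseteq> \<U> \<and> \<Inter>\<sigma> \<noteq> {}}"

text \<open>Local finiteness is required of the family indexed by \<open>\<U>\<close>, not merely of its set of supports.\<close>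

definition partition_of_unity_on :: "'a topology \<Rightarrow> 'a set set \<Rightarrow> ('a set \<Rightarrow> 'a \<Rightarrow> real) \<Rightarrow> bool" where
  "partition_of_unity_on X \<U> \<phi> \<longleftrightarrow>
     (\<forall>U\<in>\<U>. continuous_map X euclideanreal (\<phi> U) \<and> (\<forall>x\<in>topspace X. 0 \<le> \<phi> U x)
             \<and> X closure_of {x \<in> topspace X. \<phi> U x \<noteq> 0} \<subseteq> U) \<and>
     (\<forall>x\<in>topspace X. \<exists>W. openin X W \<and> x \<in> W \<and> finite {U \<in> \<U>. \<exists>y\<in>W. \<phi> U y \<noteq> 0}) \<and>
     (\<forall>x\<in>topspace X. (\<Sum>U | U \<in> \<U> \<and> \<phi> U x \<noteq> 0. \<phi> U x) = 1)"

type_synonym 'a pointed_cover = "'a set set \<times> 'a set"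

definition shape_index :: "'a topology \<Rightarrow> 'a \<Rightarrow> 'a pointed_cover set" where
  "shape_index X x0 =
     {(\<U>, U0). open_cover X \<U> \<and> U0 \<in> \<U> \<and> x0 \<in> U0 \<and>
        (\<exists>\<phi>. partition_of_unity_on X \<U> \<phi> \<and> \<phi> U0 x0 = 1)}"

definition pointed_refines :: "'a pointed_cover \<Rightarrow> 'a pointed_cover \<Rightarrow> bool" where
  "pointed_refines v u \<longleftrightarrow> cover_refines (fst v) (fst u) \<and> snd v \<subseteq> snd u"

definition nerve_pi1 :: "'a pointed_cover \<Rightarrow> (real \<Rightarrow> 'a set \<Rightarrow> real) set monoid" where
  "nerve_pi1 u = fundamental_group (realization (nerve (fst u))) (vertex_point (snd u))"

text \<open>Vertex assignments and canonical maps are chosen by \<open>SOME\<close>: the choice is immaterial, since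
  any two admissible ones induce the same map on fundamental groups.\<close>

definition refinement_assignment ::
    "'a pointed_cover \<Rightarrow> 'a pointed_cover \<Rightarrow> ('a set \<Rightarrow> 'a set) \<Rightarrow> bool" where
  "refinement_assignment v u r \<longleftrightarrow>
     (\<forall>V\<in>fst v. r V \<in> fst u \<and> V \<subseteq> r V) \<and> r (snd v) = snd u"

definition bonding_map ::
    "'a pointed_cover \<Rightarrow> 'a pointed_cover \<Rightarrow>
      (real \<Rightarrow> 'a set \<Rightarrow> real) set \<Rightarrow> (real \<Rightarrow> 'a set \<Rightarrow> real) set" where
  "bonding_map u v =
     pi1_map (realization (nerve (fst u)))
       (simplicial_realization (SOME r. refinement_assignment v u r))"

definition shape_group ::
    "'a topology \<Rightarrow> 'a \<Rightarrow> ('a pointed_cover \<Rightarrow> (real \<Rightarrow> 'a set \<Rightarrow> real) set) monoid" where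
  "shape_group X x0 =
     (product_group (shape_index X x0) nerve_pi1)
       \<lparr>carrier := {s \<in> (\<Pi>\<^sub>E u\<in>shape_index X x0. carrier (nerve_pi1 u)).
          \<forall>u\<in>shape_index X x0. \<forall>v\<in>shape_index X x0.
            pointed_refines v u \<longrightarrow> bonding_map u v (s v) = s u}\<rparr>"

definition canonical_map ::
    "'a topology \<Rightarrow> 'a \<Rightarrow> 'a pointed_cover \<Rightarrow> ('a \<Rightarrow> 'a set \<Rightarrow> real) \<Rightarrow> bool" where
  "canonical_map X x0 u p \<longleftrightarrow>
     continuous_map X (realization (nerve (fst u))) p \<and> p x0 = vertex_point (snd u) \<and>
     (\<forall>U\<in>fst u. {x \<in> topspace X. p x \<in> open_star (nerve (fst u)) U} \<subseteq> U)"

definition shape_hom ::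
    "'a topology \<Rightarrow> 'a \<Rightarrow> (real \<Rightarrow> 'a) set \<Rightarrow>
      'a pointed_cover \<Rightarrow> (real \<Rightarrow> 'a set \<Rightarrow> real) set" where
  "shape_hom X x0 A =
     (\<lambda>u\<in>shape_index X x0.
        pi1_map (realization (nerve (fst u))) (SOME p. canonical_map X x0 u p) A)"


section \<open>The map induced on first shape groups\<close>

definition pullback_cover :: "'a topology \<Rightarrow> ('a \<Rightarrow> 'b) \<Rightarrow> 'b pointed_cover \<Rightarrow> 'a pointed_cover" where
  "pullback_cover X f w =
     ((\<lambda>W. {x \<in> topspace X. f x \<in> W}) ` fst w - {{}}, {x \<in> topspace X. f x \<in> snd w})"

definition pullback_assignment ::
    "'a topology \<Rightarrow> ('a \<Rightarrow> 'b) \<Rightarrow> 'b pointed_cover \<Rightarrow> ('a set \<Rightarrow> 'b set) \<Rightarrow> bool" where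
  "pullback_assignment X f w r \<longleftrightarrow>
     (\<forall>V\<in>fst (pullback_cover X f w). r V \<in> fst w \<and> {x \<in> topspace X. f x \<in> r V} = V) \<and>
     r (snd (pullback_cover X f w)) = snd w"

definition shape_map ::
    "'a topology \<Rightarrow> 'b topology \<Rightarrow> 'b \<Rightarrow> ('a \<Rightarrow> 'b) \<Rightarrow>
      ('a pointed_cover \<Rightarrow> (real \<Rightarrow> 'a set \<Rightarrow> real) set) \<Rightarrow>
      'b pointed_cover \<Rightarrow> (real \<Rightarrow> 'b set \<Rightarrow> real) set" where
  "shape_map X Y y0 f s =
     (\<lambda>w\<in>shape_index Y y0.
        pi1_map (realization (nerve (fst w)))
          (simplicial_realization (SOME r. pullback_assignment X f w r))
          (s (pullback_cover X f w)))"

end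

theory Submission
  imports Defs
begin

text \<open>A canonical map sends a point \<open>x\<close> into the simplex of cover members containing \<open>x\<close>. Two paths in
  a nerve that lie over one path of the base in this sense are therefore joined by a straight-line
  homotopy, continuous in the weak topology because each of them meets only finitely many simplices;
  all compatibility and naturality statements are instances of this. A loop inside an open star is
  null-homotopic, and since continuous maps respect Spanier groups, the Spanier group lies in the kernel.

  Conversely, given an open cover \<open>\<U>\<close>, paracompactness yields a star refinement of \<open>\<U>\<close> by path connected
  open sets and a pointed cover \<open>\<V>\<close> refining it with a partition of unity. If the image of a loop in the
  nerve of \<open>\<V>\<close> is null-homotopic, the homotopy is cut into a grid whose cells lie in open stars; lifting
  the vertices and edges of the grid back to the space turns the homotopy into a product of conjugates
  of loops each lying in a member of \<open>\<U>\<close>.\<close>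

section \<open>Homotopy of paths and the fundamental group\<close>

text \<open>Two constraints shape the argument. In the weak topology coordinatewise continuity of a
  map into a realization does not suffice; it does once the supports stay, at least locally, in a
  finite vertex set. Compactness supplies this for paths, local finiteness for canonical maps.
  Moreover, a homotopy in the nerve leaves the image of the canonical map, so it cannot be lifted
  pointwise: only grid points are lifted, each to a common point of the cover members in its
  support, and path connectedness of the refining sets supplies the edges. An edge is shared by two
  cells but can be placed in the set of only one of them. The boundary of a cell thus spreads over
  neighbouring sets, which is why a star refinement is used. Bookkeeping of conjugates is avoided by
  passing to the quotient by the normal Spanier group of the cover, where every cell becomes a
  commuting square. For the other inclusion the canonical map pushes the Spanier group into that of
  the nerve, which is trivial already for the cover by open stars.\<close>

lemma prod_unit_square:
  "prod_topology (top_of_set {0..1::real}) (top_of_set {0..1::real}) = top_of_set ({0..1} \<times> {0..1})"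
  by (simp add: subtopology_Times[symmetric] euclidean_product_topology)

text \<open>Fixes the convention for all squares below: the first coordinate is the deformation
  parameter, the second the time along the path.\<close>

lemma homotopic_rel_ends_iff:
  "homotopic_rel_ends X p q \<longleftrightarrow>
    (\<exists>h. continuous_map (top_of_set ({0..1} \<times> {0..1})) X h \<and>
      (\<forall>t\<in>{0..1}. h (0, t) = p t \<and> h (1, t) = q t \<and> h (t, 0) = p 0 \<and> h (t, 1) = p 1))"
  unfolding homotopic_rel_ends_def
  by (subst homotopic_with) (auto simp: prod_unit_square)

lemma homotopic_rel_endsD:
  assumes "homotopic_rel_ends X p q"
  shows "pathin X p" "pathin X q" "q 0 = p 0" "q 1 = p 1"
  using homotopic_with_imp_continuous_maps[OF assms[unfolded homotopic_rel_ends_def]]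
    homotopic_with_imp_property[OF assms[unfolded homotopic_rel_ends_def]]
  by (auto simp: pathin_def)

lemma homotopic_rel_ends_refl: "pathin X p \<Longrightarrow> homotopic_rel_ends X p p"
  by (simp add: homotopic_rel_ends_def pathin_def)

lemma homotopic_rel_ends_sym:
  assumes "homotopic_rel_ends X p q" shows "homotopic_rel_ends X q p"
  using assms homotopic_rel_endsD(3,4)[OF assms]
  unfolding homotopic_rel_ends_def by (simp add: homotopic_with_sym)

lemma homotopic_rel_ends_trans [trans]:
  assumes "homotopic_rel_ends X p q" "homotopic_rel_ends X q r"
  shows "homotopic_rel_ends X p r"
proof -
  have "homotopic_with (\<lambda>r. r 0 = p 0 \<and> r 1 = p 1) (top_of_set {0..1}) X q r"
    using assms(2) homotopic_rel_endsD(3,4)[OF assms(1)] by (simp add: homotopic_rel_ends_def)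
  with assms(1) show ?thesis
    unfolding homotopic_rel_ends_def by (rule homotopic_with_trans)
qed

lemma pathin_in_topspace: "pathin X p \<Longrightarrow> t \<in> {0..1} \<Longrightarrow> p t \<in> topspace X"
  unfolding pathin_def continuous_map_def by auto

lemma pathin_reparam:
  assumes "pathin X p" "continuous_on {0..1} f" "f ` {0..1} \<subseteq> {0..1}"
  shows "pathin X (\<lambda>t. p (f t))"
  using continuous_map_compose[of "top_of_set {0..1}" "top_of_set {0..1}" f X p] assms
  by (auto simp: pathin_def o_def image_subset_iff_funcset)

text \<open>All the groupoid laws are instances of this lemma: both sides are reparametrizations of one path.\<close>

lemma homotopic_rel_ends_reparam:
  assumes p: "pathin X p"
    and f: "continuous_on {0..1} f" "f ` {0..1} \<subseteq> {0..1}"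
    and g: "continuous_on {0..1} g" "g ` {0..1} \<subseteq> {0..1}"
    and ends: "f 0 = g 0" "f 1 = g 1"
  shows "homotopic_rel_ends X (\<lambda>t. p (f t)) (\<lambda>t. p (g t))"
proof -
  define k where "k = (\<lambda>z. (1 - fst z) * f (snd z) + fst z * g (snd z))"
  have "continuous_on ({0..1} \<times> {0..1}) (\<lambda>z. f (snd z))" "continuous_on ({0..1} \<times> {0..1}) (\<lambda>z. g (snd z))"
    by (auto intro!: continuous_on_compose2[OF f(1)] continuous_on_compose2[OF g(1)] continuous_intros)
  then have "continuous_on ({0..1} \<times> {0..1}) k"
    unfolding k_def by (intro continuous_intros)
  moreover have "k z \<in> {0..1}" if "z \<in> {0..1} \<times> {0..1}" for z
  proof -
    have "f (snd z) \<in> {0..1}" "g (snd z) \<in> {0..1}" using f g that by auto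
    then show ?thesis
      unfolding k_def using convexD_alt[of "{0..1::real}" "f (snd z)" "g (snd z)" "fst z"] that
      by (auto simp: mem_Times_iff)
  qed
  ultimately have "continuous_map (top_of_set ({0..1} \<times> {0..1})) (top_of_set {0..1}) k"
    by auto
  then have "continuous_map (top_of_set ({0..1} \<times> {0..1})) X (p \<circ> k)"
    using p unfolding pathin_def by (rule continuous_map_compose)
  then show ?thesis
    unfolding homotopic_rel_ends_iff
    by (intro exI[of _ "p \<circ> k"] conjI) (auto simp: k_def ends algebra_simps)
qed

lemma path_concat_ends [simp]: "path_concat p q 0 = p 0" "path_concat p q 1 = q 1"
  by (auto simp: path_concat_def)

lemma path_reverse_ends [simp]: "path_reverse p 0 = p 1" "path_reverse p 1 = p 0"
  by (auto simp: path_reverse_def)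

lemma pathin_reverse: "pathin X p \<Longrightarrow> pathin X (path_reverse p)"
  unfolding path_reverse_def by (rule pathin_reparam) (auto intro!: continuous_intros)

lemma path_reverse_image: "path_reverse p ` {0..1} = p ` {0..1}"
  unfolding path_reverse_def
proof (intro equalityI subsetI; elim imageE)
  fix x t assume "x = p t" "t \<in> {0..1::real}"
  then show "x \<in> (\<lambda>t. p (1 - t)) ` {0..1}" by (intro image_eqI[of _ _ "1 - t"]) auto
qed auto

lemma path_concat_image: "path_concat p q ` {0..1} \<subseteq> p ` {0..1} \<union> q ` {0..1}"
  by (auto simp: path_concat_def)

lemma continuous_on_if_half:
  fixes f g :: "real \<Rightarrow> 'b::topological_space"
  assumes "continuous_on {0..1/2} f" "continuous_on {1/2..1} g" "f (1/2) = g (1/2)"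
  shows "continuous_on {0..1} (\<lambda>t. if t \<le> 1/2 then f t else g t)"
proof -
  have half: "t = 1/2" if "t \<le> 1/2" "1/2 \<le> t" for t :: real using that by simp
  have "continuous_on ({0..1/2} \<union> {1/2..1}) (\<lambda>t. if t \<le> 1/2 then f t else g t)"
  proof (intro continuous_on_cases)
    show "\<forall>t. t \<in> {0..1 / 2} \<and> \<not> t \<le> 1 / 2 \<or> t \<in> {1 / 2..1} \<and> t \<le> 1 / 2 \<longrightarrow> f t = g t"
      using half assms(3) by (metis atLeastAtMost_iff)
  qed (use assms in auto)
  then show ?thesis by (simp add: split_01)
qed

lemma homotopic_rel_ends_concat:
  assumes p: "homotopic_rel_ends X p p'" and q: "homotopic_rel_ends X q q'" and pq: "p 1 = q 0"
  shows "homotopic_rel_ends X (path_concat p q) (path_concat p' q')"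
proof -
  let ?Q = "{0..1::real} \<times> {0..1::real}"
  from p obtain h where h: "continuous_map (top_of_set ?Q) X h"
    "\<And>t. t \<in> {0..1} \<Longrightarrow> h (0, t) = p t \<and> h (1, t) = p' t \<and> h (t, 0) = p 0 \<and> h (t, 1) = p 1"
    unfolding homotopic_rel_ends_iff by blast
  from q obtain k where k: "continuous_map (top_of_set ?Q) X k"
    "\<And>t. t \<in> {0..1} \<Longrightarrow> k (0, t) = q t \<and> k (1, t) = q' t \<and> k (t, 0) = q 0 \<and> k (t, 1) = q 1"
    unfolding homotopic_rel_ends_iff by blast
  define m where "m = (\<lambda>z. if snd z \<le> 1/2 then h (fst z, 2 * snd z) else k (fst z, 2 * snd z - 1))"
  have "continuous_map (top_of_set ?Q) X m"
    unfolding m_def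
  proof (rule continuous_map_cases_le)
    show "continuous_map (top_of_set ?Q) euclideanreal snd"
      by (auto intro!: continuous_intros)
    have "continuous_map (top_of_set (?Q \<inter> {z. snd z \<le> 1/2})) (top_of_set ?Q) (\<lambda>z. (fst z, 2 * snd z))"
      by (auto intro!: continuous_intros)
    from continuous_map_compose[OF this h(1)]
    show "continuous_map (subtopology (top_of_set ?Q) {z \<in> topspace (top_of_set ?Q). snd z \<le> 1/2}) X
        (\<lambda>z. h (fst z, 2 * snd z))"
      by (simp add: subtopology_subtopology o_def Collect_conj_eq Int_assoc[symmetric])
    have "continuous_map (top_of_set (?Q \<inter> {z. 1/2 \<le> snd z})) (top_of_set ?Q) (\<lambda>z. (fst z, 2 * snd z - 1))"
      by (auto intro!: continuous_intros)
    from continuous_map_compose[OF this k(1)]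
    show "continuous_map (subtopology (top_of_set ?Q) {z \<in> topspace (top_of_set ?Q). 1/2 \<le> snd z}) X
        (\<lambda>z. k (fst z, 2 * snd z - 1))"
      by (simp add: subtopology_subtopology o_def Collect_conj_eq Int_assoc[symmetric])
    fix z assume z: "z \<in> topspace (top_of_set ?Q)" "snd z = 1/2"
    have "h (fst z, 1) = p 1" "k (fst z, 0) = q 0" using h(2) k(2) z by (auto simp: mem_Times_iff)
    then show "h (fst z, 2 * snd z) = k (fst z, 2 * snd z - 1)" using z(2) pq by (simp only: z(2)) simp
  qed auto
  moreover have "m (0, t) = path_concat p q t \<and> m (1, t) = path_concat p' q' t \<and>
      m (t, 0) = path_concat p q 0 \<and> m (t, 1) = path_concat p q 1" if t: "t \<in> {0..1}" for t
  proof -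
    have "h (0, 2 * t) = p (2 * t) \<and> h (1, 2 * t) = p' (2 * t)" if "t \<le> 1/2"
      using h(2)[of "2 * t"] t that by auto
    moreover have "k (0, 2 * t - 1) = q (2 * t - 1) \<and> k (1, 2 * t - 1) = q' (2 * t - 1)" if "\<not> t \<le> 1/2"
      using k(2)[of "2 * t - 1"] t that by auto
    moreover have "h (t, 0) = p 0" "k (t, 1) = q 1" using h(2) k(2) t by auto
    ultimately show ?thesis by (auto simp: m_def path_concat_def)
  qed
  ultimately show ?thesis
    unfolding homotopic_rel_ends_iff by blast
qed

lemma pathin_concat:
  assumes "pathin X p" "pathin X q" "p 1 = q 0"
  shows "pathin X (path_concat p q)"
  using homotopic_rel_ends_concat[OF homotopic_rel_ends_refl homotopic_rel_ends_refl, OF assms]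
  by (rule homotopic_rel_endsD)

lemma homotopic_rel_ends_compose:
  assumes "homotopic_rel_ends X p q" "continuous_map X Y f"
  shows "homotopic_rel_ends Y (f \<circ> p) (f \<circ> q)"
proof -
  have "homotopic_with (\<lambda>r. r 0 = p 0 \<and> r 1 = p 1) (top_of_set {0..1::real}) X p q"
    using assms(1) by (simp add: homotopic_rel_ends_def)
  from homotopic_with_compose_continuous_map_left[OF this assms(2)]
  show ?thesis unfolding homotopic_rel_ends_def by (simp add: o_def)
qed

lemma compose_path_concat: "f \<circ> path_concat p q = path_concat (f \<circ> p) (f \<circ> q)"
  by (auto simp: path_concat_def)

lemma compose_path_reverse: "f \<circ> path_reverse p = path_reverse (f \<circ> p)"
  by (auto simp: path_reverse_def)

lemma homotopic_rel_ends_const_left: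
  assumes p: "pathin X p"
  shows "homotopic_rel_ends X (path_concat (\<lambda>_. p 0) p) p"
proof -
  have "homotopic_rel_ends X (\<lambda>t. p (if t \<le> 1/2 then 0 else 2 * t - 1)) (\<lambda>t. p t)"
    by (rule homotopic_rel_ends_reparam[OF p])
       (intro continuous_on_if_half continuous_intros, auto)
  moreover have "path_concat (\<lambda>_. p 0) p = (\<lambda>t. p (if t \<le> 1/2 then 0 else 2 * t - 1))"
    by (auto simp: path_concat_def)
  ultimately show ?thesis by simp
qed

lemma homotopic_rel_ends_const_right:
  assumes p: "pathin X p"
  shows "homotopic_rel_ends X (path_concat p (\<lambda>_. p 1)) p"
proof -
  have "homotopic_rel_ends X (\<lambda>t. p (if t \<le> 1/2 then 2 * t else 1)) (\<lambda>t. p t)"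
    by (rule homotopic_rel_ends_reparam[OF p])
       (intro continuous_on_if_half continuous_intros, auto)
  moreover have "path_concat p (\<lambda>_. p 1) = (\<lambda>t. p (if t \<le> 1/2 then 2 * t else 1))"
    by (auto simp: path_concat_def)
  ultimately show ?thesis by simp
qed

lemma homotopic_rel_ends_inverse_right:
  assumes p: "pathin X p"
  shows "homotopic_rel_ends X (path_concat p (path_reverse p)) (\<lambda>_. p 0)"
proof -
  have "homotopic_rel_ends X (\<lambda>t. p (if t \<le> 1/2 then 2 * t else 2 - 2 * t)) (\<lambda>t. p 0)"
    by (rule homotopic_rel_ends_reparam[OF p, of _ "\<lambda>_. 0"])
       (intro continuous_on_if_half continuous_intros, auto)
  moreover have "path_concat p (path_reverse p) = (\<lambda>t. p (if t \<le> 1/2 then 2 * t else 2 - 2 * t))"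
    by (auto simp: path_concat_def path_reverse_def algebra_simps)
  ultimately show ?thesis by simp
qed

lemma path_reverse_reverse [simp]: "path_reverse (path_reverse p) = p"
  by (auto simp: path_reverse_def)

lemma homotopic_rel_ends_inverse_left:
  assumes p: "pathin X p"
  shows "homotopic_rel_ends X (path_concat (path_reverse p) p) (\<lambda>_. p 1)"
  using homotopic_rel_ends_inverse_right[OF pathin_reverse[OF p]] by simp

lemma homotopic_rel_ends_assoc:
  assumes "pathin X p" "pathin X q" "pathin X r" "p 1 = q 0" "q 1 = r 0"
  shows "homotopic_rel_ends X (path_concat (path_concat p q) r) (path_concat p (path_concat q r))"
proof -
  let ?w = "path_concat (path_concat p q) r"
  \<comment> \<open>Slopes 1/2, 1 and 2 on [0,1/2], [1/2,3/4] and [3/4,1] carry the breakpoints of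
    \<open>path_concat p (path_concat q r)\<close> to those of \<open>?w\<close>. The last two
    affine pieces cross at 3/4, so their maximum expresses both.\<close>
  let ?g = "\<lambda>t::real. if t \<le> 1/2 then t / 2 else max (t - 1/4) (2 * t - 1)"
  have w: "pathin X ?w" using assms by (simp add: pathin_concat)
  have g: "continuous_on {0..1} ?g"
    by (rule continuous_on_if_half) (auto intro!: continuous_intros)
  have "homotopic_rel_ends X (\<lambda>t. ?w t) (\<lambda>t. ?w (?g t))"
    by (rule homotopic_rel_ends_reparam[OF w _ _ g]) (auto simp: max_def)
  moreover have "(\<lambda>t. ?w (?g t)) = path_concat p (path_concat q r)"
  proof
    fix t :: real
    consider "t \<le> 1/2" | "1/2 < t" "t \<le> 3/4" | "3/4 < t" by linarith
    then show "?w (?g t) = path_concat p (path_concat q r) t"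
    proof cases
      case 2
      then have "?g t = t - 1/4" by (simp add: max_def)
      moreover have "2 * (2 * (t - 1/4)) - 1 = 2 * (2 * t - 1)" by simp
      ultimately show ?thesis using 2 by (simp add: path_concat_def)
    next
      case 3
      then have "?g t = 2 * t - 1" by (simp add: max_def)
      then show ?thesis using 3 by (simp add: path_concat_def)
    qed (simp add: path_concat_def)
  qed
  ultimately show ?thesis by simp
qed

section \<open>Homotopy classes and the group structure\<close>

lemma path_class_eq_iff:
  assumes "pathin X p"
  shows "path_class X p = path_class X q \<longleftrightarrow> homotopic_rel_ends X p q"
proof
  assume "path_class X p = path_class X q"
  then have "p \<in> path_class X q" using homotopic_rel_ends_refl[OF assms] by (auto simp: path_class_def)
  then show "homotopic_rel_ends X p q" by (simp add: path_class_def homotopic_rel_ends_sym)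
qed (auto simp: path_class_def intro: homotopic_rel_ends_trans homotopic_rel_ends_sym)

lemma path_class_eqI: "homotopic_rel_ends X p q \<Longrightarrow> path_class X p = path_class X q"
  using path_class_eq_iff homotopic_rel_endsD(1) by blast

text \<open>The union defining \<open>pi1_map\<close> runs over representatives of one class, so by
  homotopy invariance all its terms coincide. \<open>fundamental_group_mult\<close> below rests on
  the same observation.\<close>

lemma pi1_map_path_class:
  assumes "pathin X p" "continuous_map X Y f"
  shows "pi1_map Y f (path_class X p) = path_class Y (f \<circ> p)"
proof -
  have "path_class Y (f \<circ> q) = path_class Y (f \<circ> p)" if "q \<in> path_class X p" for q
    using that unfolding path_class_def[of X p]
    by (intro path_class_eqI[symmetric] homotopic_rel_ends_compose[OF _ assms(2)]) simp
  moreover have "p \<in> path_class X p"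
    using assms by (simp add: path_class_def homotopic_rel_ends_refl)
  ultimately show ?thesis unfolding pi1_map_def by blast
qed

lemma fundamental_group_mult:
  assumes "pathin X p" "pathin X q" "p 1 = q 0"
  shows "path_class X p \<otimes>\<^bsub>fundamental_group X x0\<^esub> path_class X q = path_class X (path_concat p q)"
proof -
  have "path_class X (path_concat p' q') = path_class X (path_concat p q)"
    if "p' \<in> path_class X p" "q' \<in> path_class X q" for p' q'
    using that assms(3) unfolding path_class_def[of X p] path_class_def[of X q]
    by (intro path_class_eqI[symmetric] homotopic_rel_ends_concat) auto
  moreover have "p \<in> path_class X p" "q \<in> path_class X q"
    using assms by (simp_all add: path_class_def homotopic_rel_ends_refl)
  ultimately have "(\<Union>p'\<in>path_class X p. \<Union>q'\<in>path_class X q. path_class X (path_concat p' q')) =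
      path_class X (path_concat p q)" by blast
  then show ?thesis by (simp add: fundamental_group_def)
qed

lemma fundamental_group_one: "\<one>\<^bsub>fundamental_group X x0\<^esub> = path_class X (\<lambda>_. x0)"
  by (simp add: fundamental_group_def)

lemma carrier_fundamental_group: "carrier (fundamental_group X x0) = path_class X ` loops_at X x0"
  by (simp add: fundamental_group_def)

lemma path_class_in_carrier:
  "pathin X p \<Longrightarrow> p 0 = x0 \<Longrightarrow> p 1 = x0 \<Longrightarrow> path_class X p \<in> carrier (fundamental_group X x0)"
  by (auto simp: carrier_fundamental_group loops_at_def)

lemma fundamental_group_carrierE:
  assumes "a \<in> carrier (fundamental_group X x0)"
  obtains p where "pathin X p" "p 0 = x0" "p 1 = x0" "a = path_class X p"
  using assms by (auto simp: carrier_fundamental_group loops_at_def)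

lemma group_fundamental_group:
  assumes "x0 \<in> topspace X"
  shows "group (fundamental_group X x0)"
proof (rule groupI)
  fix a assume "a \<in> carrier (fundamental_group X x0)"
  then obtain p where p: "pathin X p" "p 0 = x0" "p 1 = x0" "a = path_class X p"
    by (rule fundamental_group_carrierE)
  show "\<one>\<^bsub>fundamental_group X x0\<^esub> \<otimes>\<^bsub>fundamental_group X x0\<^esub> a = a"
    using p assms homotopic_rel_ends_const_left[OF p(1)]
    by (simp add: fundamental_group_one fundamental_group_mult path_class_eqI)
  have "path_class X (path_reverse p) \<otimes>\<^bsub>fundamental_group X x0\<^esub> a = \<one>\<^bsub>fundamental_group X x0\<^esub>"
    using p homotopic_rel_ends_inverse_left[OF p(1)]
    by (simp add: fundamental_group_one fundamental_group_mult path_class_eqI pathin_reverse)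
  moreover have "path_class X (path_reverse p) \<in> carrier (fundamental_group X x0)"
    using p by (intro path_class_in_carrier) (auto simp: pathin_reverse)
  ultimately show "\<exists>b\<in>carrier (fundamental_group X x0).
      b \<otimes>\<^bsub>fundamental_group X x0\<^esub> a = \<one>\<^bsub>fundamental_group X x0\<^esub>" by blast
  fix b assume "b \<in> carrier (fundamental_group X x0)"
  then obtain q where q: "pathin X q" "q 0 = x0" "q 1 = x0" "b = path_class X q"
    by (rule fundamental_group_carrierE)
  show "a \<otimes>\<^bsub>fundamental_group X x0\<^esub> b \<in> carrier (fundamental_group X x0)"
    using p q by (auto simp: fundamental_group_mult pathin_concat intro: path_class_in_carrier)
  fix c assume "c \<in> carrier (fundamental_group X x0)"
  then obtain r where r: "pathin X r" "r 0 = x0" "r 1 = x0" "c = path_class X r"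
    by (rule fundamental_group_carrierE)
  show "a \<otimes>\<^bsub>fundamental_group X x0\<^esub> b \<otimes>\<^bsub>fundamental_group X x0\<^esub> c =
      a \<otimes>\<^bsub>fundamental_group X x0\<^esub> (b \<otimes>\<^bsub>fundamental_group X x0\<^esub> c)"
    using p q r homotopic_rel_ends_assoc[of X p q r]
    by (simp add: fundamental_group_mult pathin_concat path_class_eqI)
next
  show "\<one>\<^bsub>fundamental_group X x0\<^esub> \<in> carrier (fundamental_group X x0)"
    using assms by (auto simp: fundamental_group_one intro: path_class_in_carrier)
qed

lemma inv_path_class:
  assumes "pathin X p" "p 0 = x0" "p 1 = x0"
  shows "inv\<^bsub>fundamental_group X x0\<^esub> (path_class X p) = path_class X (path_reverse p)"
proof (rule group.inv_equality)
  have x0: "x0 \<in> topspace X" using pathin_in_topspace[OF assms(1), of 0] assms by auto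
  show "Group.group (fundamental_group X x0)" by (rule group_fundamental_group[OF x0])
  show "path_class X (path_reverse p) \<otimes>\<^bsub>fundamental_group X x0\<^esub> path_class X p = \<one>\<^bsub>fundamental_group X x0\<^esub>"
    using assms homotopic_rel_ends_inverse_left[OF assms(1)]
    by (simp add: fundamental_group_one fundamental_group_mult path_class_eqI pathin_reverse)
qed (use assms in \<open>auto intro!: path_class_in_carrier pathin_reverse\<close>)

lemma pi1_map_hom:
  assumes "continuous_map X Y f"
  shows "pi1_map Y f \<in> hom (fundamental_group X x0) (fundamental_group Y (f x0))"
proof (rule homI)
  fix a assume "a \<in> carrier (fundamental_group X x0)"
  then obtain p where p: "pathin X p" "p 0 = x0" "p 1 = x0" "a = path_class X p"
    by (rule fundamental_group_carrierE)
  then show "pi1_map Y f a \<in> carrier (fundamental_group Y (f x0))"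
    using assms by (auto simp: pi1_map_path_class pathin_compose intro!: path_class_in_carrier)
  fix b assume "b \<in> carrier (fundamental_group X x0)"
  then obtain q where q: "pathin X q" "q 0 = x0" "q 1 = x0" "b = path_class X q"
    by (rule fundamental_group_carrierE)
  show "pi1_map Y f (a \<otimes>\<^bsub>fundamental_group X x0\<^esub> b) =
      pi1_map Y f a \<otimes>\<^bsub>fundamental_group Y (f x0)\<^esub> pi1_map Y f b"
    using p q assms by (simp add: fundamental_group_mult pi1_map_path_class pathin_concat
        pathin_compose compose_path_concat)
qed

section \<open>Realizations of simplicial complexes\<close>

definition simplicial_complex :: "'v set set \<Rightarrow> bool" where
  "simplicial_complex K \<longleftrightarrow> (\<forall>\<sigma>\<in>K. finite \<sigma> \<and> \<sigma> \<noteq> {} \<and> (\<forall>\<tau>\<subseteq>\<sigma>. \<tau> \<noteq> {} \<longrightarrow> \<tau> \<in> K))"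

abbreviation vertex_support :: "('v \<Rightarrow> real) \<Rightarrow> 'v set" where
  "vertex_support t \<equiv> {v. t v \<noteq> 0}"

lemma simplicial_complex_face:
  assumes "simplicial_complex K" "\<sigma> \<in> K" "\<tau> \<subseteq> \<sigma>" "v \<in> \<tau>"
  shows "\<tau> \<in> K"
  using assms unfolding simplicial_complex_def by blast

text \<open>Only the support matters: the coordinate sums over \<sigma> and over \<tau> both reduce
  to the sum over the support, whatever the relation between \<sigma> and \<tau>.\<close>

lemma closed_simplex_mono:
  assumes "t \<in> closed_simplex \<sigma>" "vertex_support t \<subseteq> \<tau>" "finite \<sigma>" "finite \<tau>"
  shows "t \<in> closed_simplex \<tau>"
proof -
  have "vertex_support t \<subseteq> \<sigma>" using assms(1) by (simp add: closed_simplex_def)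
  then have "sum t \<tau> = sum t (vertex_support t)" "sum t \<sigma> = sum t (vertex_support t)"
    using assms(2-4) by (auto intro!: sum.mono_neutral_right)
  then have "sum t \<tau> = sum t \<sigma>" by metis
  then show ?thesis using assms unfolding closed_simplex_def by auto
qed

lemma closed_simplex_support_nonempty:
  assumes "t \<in> closed_simplex \<sigma>" shows "vertex_support t \<noteq> {}"
proof
  assume "vertex_support t = {}"
  then have "sum t \<sigma> = 0" by (intro sum.neutral) auto
  then show False using assms by (simp add: closed_simplex_def)
qed

lemma realization_set_support:
  assumes "simplicial_complex K" "t \<in> realization_set K"
  shows "vertex_support t \<in> K"
proof -
  obtain \<sigma> where \<sigma>: "\<sigma> \<in> K" "t \<in> closed_simplex \<sigma>"
    using assms(2) by (auto simp: realization_set_def)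
  then have "vertex_support t \<subseteq> \<sigma>" "vertex_support t \<noteq> {}"
    using closed_simplex_support_nonempty by (simp_all add: closed_simplex_def)
  with assms(1) \<sigma>(1) show ?thesis unfolding simplicial_complex_def by blast
qed

lemma realization_set_nonneg: "t \<in> realization_set K \<Longrightarrow> 0 \<le> t v"
  by (auto simp: realization_set_def closed_simplex_def)

lemma realization_set_sum:
  assumes "simplicial_complex K" "t \<in> realization_set K" "finite \<sigma>" "vertex_support t \<subseteq> \<sigma>"
  shows "t \<in> closed_simplex \<sigma>"
  using assms closed_simplex_mono unfolding realization_set_def simplicial_complex_def by blast

lemma vertex_support_vertex_point [simp]: "vertex_support (vertex_point v) = {v}"
  by (auto simp: vertex_point_def)

lemma vertex_point_in_realization_set:
  assumes "{v} \<in> K" shows "vertex_point v \<in> realization_set K"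
  unfolding realization_set_def using assms
  by (intro UN_I[of "{v}"]) (auto simp: closed_simplex_def vertex_point_def)

lemma topspace_realization [simp]: "topspace (realization K) = realization_set K"
proof
  show "topspace (realization K) \<subseteq> realization_set K"
    using openin_realization[of K "topspace (realization K)"] by simp
  have "realization_set K \<inter> closed_simplex \<sigma> = closed_simplex \<sigma>" if "\<sigma> \<in> K" for \<sigma>
    using that by (auto simp: realization_set_def)
  then have "openin (realization K) (realization_set K)"
    unfolding openin_realization by (auto simp: openin_subtopology_refl)
  then show "realization_set K \<subseteq> topspace (realization K)" by (rule openin_subset)
qed

lemma closed_closed_simplex: "closed (closed_simplex \<sigma>)"
proof -
  have "closed_simplex \<sigma> =
      {t. \<forall>v. 0 \<le> t v} \<inter> {t. \<forall>v. v \<in> \<sigma> \<or> t v = 0} \<inter> {t. sum t \<sigma> = 1}"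
    by (auto simp: closed_simplex_def)
  also have "closed \<dots>"
    by (intro closed_Int closed_Collect_all closed_Collect_le closed_Collect_disj closed_Collect_eq
        closed_Collect_const continuous_on_sum continuous_on_product_coordinates continuous_on_const)
  finally show ?thesis .
qed

lemma openin_realization_euclidean:
  "openin (realization K) W \<longleftrightarrow> W \<subseteq> realization_set K \<and>
     (\<forall>\<sigma>\<in>K. openin (top_of_set (closed_simplex \<sigma>)) (W \<inter> closed_simplex \<sigma>))"
  by (simp add: openin_realization euclidean_product_topology)

text \<open>The universal property of the weak topology.\<close>

lemma continuous_map_from_realization:
  assumes "\<And>\<sigma>. \<sigma> \<in> K \<Longrightarrow> continuous_map (top_of_set (closed_simplex \<sigma>)) Y f"
  shows "continuous_map (realization K) Y f"
  unfolding continuous_map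
proof (intro conjI allI impI)
  show "f ` topspace (realization K) \<subseteq> topspace Y"
    using assms by (force simp: realization_set_def continuous_map_def)
  fix U assume U: "openin Y U"
  have "{t \<in> realization_set K. f t \<in> U} \<inter> closed_simplex \<sigma> = {t \<in> closed_simplex \<sigma>. f t \<in> U}"
    if "\<sigma> \<in> K" for \<sigma>
    using that by (auto simp: realization_set_def)
  then show "openin (realization K) {t \<in> topspace (realization K). f t \<in> U}"
    using assms U unfolding openin_realization_euclidean continuous_map by auto
qed

lemma continuous_map_coordinate: "continuous_map (realization K) euclideanreal (\<lambda>t. t v)"
  by (rule continuous_map_from_realization)
    (auto intro: continuous_on_subset[OF continuous_on_product_coordinates])

lemma openin_open_star: "openin (realization K) (open_star K v)"
  using openin_continuous_map_preimage[OF continuous_map_coordinate, of "{0<..}" K v]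
  by (simp add: open_star_def)

lemma open_star_iff_support:
  "t \<in> realization_set K \<Longrightarrow> t \<in> open_star K v \<longleftrightarrow> v \<in> vertex_support t"
  using realization_set_nonneg[of t K v] by (auto simp: open_star_def)

text \<open>Only finitely many simplices have their vertices in \<open>A\<close>. The part of their
  union outside a weakly open set is a finite union of sets closed in the product topology, hence
  closed, and coordinatewise continuity controls its preimage.\<close>

lemma continuous_map_into_finite_subcomplex:
  assumes K: "simplicial_complex K"
    and co: "\<And>v. continuous_map Z euclideanreal (\<lambda>z. F z v)"
    and F: "\<And>z. z \<in> topspace Z \<Longrightarrow> F z \<in> realization_set K"
    and A: "finite A" "\<And>z. z \<in> topspace Z \<Longrightarrow> vertex_support (F z) \<subseteq> A"
  shows "continuous_map Z (realization K) F"
  unfolding continuous_map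
proof (intro conjI allI impI)
  show "F ` topspace Z \<subseteq> topspace (realization K)" using F by auto
  fix W assume W: "openin (realization K) W"
  \<comment> \<open>\<open>D\<close> is what \<open>W\<close> misses of the full subcomplex on
    \<open>A\<close>. All values of \<open>F\<close> lie in that subcomplex, so \<open>F z\<close>
    is in \<open>W\<close> exactly when it is not in \<open>D\<close>.\<close>
  define D where "D = (\<Union>\<sigma>\<in>K \<inter> Pow A. closed_simplex \<sigma> - W)"
  have "closed (closed_simplex \<sigma> - W)" if "\<sigma> \<in> K" for \<sigma>
  proof -
    have "openin (top_of_set (closed_simplex \<sigma>)) (W \<inter> closed_simplex \<sigma>)"
      using W that by (simp add: openin_realization_euclidean)
    then have "closedin (top_of_set (closed_simplex \<sigma>)) (closed_simplex \<sigma> - W \<inter> closed_simplex \<sigma>)"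
      by (simp add: closedin_diff)
    then show ?thesis
      using closedin_closed_trans[OF _ closed_closed_simplex] by (simp add: Diff_Int)
  qed
  then have "closed D"
    unfolding D_def using A(1) by (intro closed_UN) auto
  moreover have "continuous_map Z euclidean F"
    using co by (simp add: euclidean_product_topology[symmetric] continuous_map_componentwise_UNIV)
  ultimately have "closedin Z {z \<in> topspace Z. F z \<in> D}"
    by (intro closedin_continuous_map_preimage) auto
  moreover have "{z \<in> topspace Z. F z \<in> W} = topspace Z - {z \<in> topspace Z. F z \<in> D}"
  proof -
    have "F z \<in> W \<longleftrightarrow> F z \<notin> D" if z: "z \<in> topspace Z" for z
    proof -
      have "vertex_support (F z) \<in> K \<inter> Pow A"
        using realization_set_support[OF K F[OF z]] A(2)[OF z] by auto
      moreover have "F z \<in> closed_simplex (vertex_support (F z))"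
        by (rule realization_set_sum[OF K F[OF z]])
          (use A z in \<open>auto intro: finite_subset\<close>)
      ultimately show ?thesis by (auto simp: D_def)
    qed
    then show ?thesis by auto
  qed
  ultimately show "openin Z {z \<in> topspace Z. F z \<in> W}" by auto
qed

text \<open>The local form needed for canonical maps: infinitely many cover members may occur over
  the whole space, but only finitely many near each point.\<close>

lemma continuous_map_into_realization:
  assumes K: "simplicial_complex K"
    and co: "\<And>v. continuous_map Z euclideanreal (\<lambda>z. F z v)"
    and F: "\<And>z. z \<in> topspace Z \<Longrightarrow> F z \<in> realization_set K"
    and loc: "\<And>z. z \<in> topspace Z \<Longrightarrow>
      \<exists>N. openin Z N \<and> z \<in> N \<and> finite (\<Union>y\<in>N. vertex_support (F y))"
  shows "continuous_map Z (realization K) F"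
  unfolding continuous_map
proof (intro conjI allI impI)
  show "F ` topspace Z \<subseteq> topspace (realization K)" using F by auto
  fix W assume W: "openin (realization K) W"
  show "openin Z {z \<in> topspace Z. F z \<in> W}"
  proof (subst openin_subopen, intro ballI)
    fix z assume z: "z \<in> {z \<in> topspace Z. F z \<in> W}"
    then obtain N where N: "openin Z N" "z \<in> N" "finite (\<Union>y\<in>N. vertex_support (F y))"
      using loc by blast
    have "continuous_map (subtopology Z N) (realization K) F"
      by (rule continuous_map_into_finite_subcomplex[OF K _ _ N(3)])
         (use co F in \<open>auto intro: continuous_map_from_subtopology\<close>)
    from openin_continuous_map_preimage[OF this W]
    have "openin Z {y \<in> topspace (subtopology Z N). F y \<in> W}"
      using N(1) by (rule openin_trans_full)
    then show "\<exists>T. openin Z T \<and> z \<in> T \<and> T \<subseteq> {z \<in> topspace Z. F z \<in> W}"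
      using N z by (intro exI[of _ "{y \<in> topspace (subtopology Z N). F y \<in> W}"]) auto
  qed
qed

text \<open>A point chosen for each occurring support gives a set all of whose subsets are closed.\<close>

lemma finite_support_compactin:
  assumes K: "simplicial_complex K" and C: "compactin (realization K) C"
  shows "finite (\<Union>c\<in>C. vertex_support c)"
proof -
  have CK: "C \<subseteq> realization_set K" using compactin_subset_topspace[OF C] by simp
  define S where "S = (\<lambda>c. vertex_support c) ` C"
  define d where "d = (\<lambda>\<sigma>. SOME c. c \<in> C \<and> vertex_support c = \<sigma>)"
  have d: "d \<sigma> \<in> C \<and> vertex_support (d \<sigma>) = \<sigma>" if \<sigma>: "\<sigma> \<in> S" for \<sigma>
  proof -
    obtain c where "c \<in> C \<and> vertex_support c = \<sigma>" using \<sigma> unfolding S_def by blast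
    then show ?thesis
      unfolding d_def by (rule someI[of "\<lambda>c. c \<in> C \<and> vertex_support c = \<sigma>"])
  qed
  \<comment> \<open>A point of \<open>D\<close> in a closed simplex has a face of it as support, and
    \<open>d\<close> picks one point per support, so \<open>D\<close> meets each closed simplex in a
    finite set.\<close>
  have closed: "closedin (realization K) D" if D: "D \<subseteq> d ` S" for D
  proof -
    have "Hausdorff_space (powertop_real (UNIV :: 'a set))"
      by (simp add: Hausdorff_space_product_topology)
    then have closed: "closed F" if "finite F" for F :: "('a \<Rightarrow> real) set"
      using closedin_Hausdorff_finite[of "powertop_real UNIV" F] that
      by (simp add: euclidean_product_topology)
    have "finite (D \<inter> closed_simplex \<sigma>)" if "\<sigma> \<in> K" for \<sigma>
    proof (rule finite_subset)
      show "D \<inter> closed_simplex \<sigma> \<subseteq> d ` Pow \<sigma>"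
        using D d by (force simp: closed_simplex_def)
      show "finite (d ` Pow \<sigma>)" using K that by (auto simp: simplicial_complex_def)
    qed
    then have "openin (top_of_set (closed_simplex \<sigma>)) (closed_simplex \<sigma> - D \<inter> closed_simplex \<sigma>)"
      if "\<sigma> \<in> K" for \<sigma>
      using that by (intro openin_diff) (auto intro!: closed_subset closed)
    moreover have "(realization_set K - D) \<inter> closed_simplex \<sigma> = closed_simplex \<sigma> - D \<inter> closed_simplex \<sigma>"
      if "\<sigma> \<in> K" for \<sigma>
      using that by (auto simp: realization_set_def)
    ultimately have "openin (realization K) (realization_set K - D)"
      unfolding openin_realization_euclidean by auto
    moreover have "D \<subseteq> realization_set K" using D d CK by blast
    ultimately show ?thesis by (simp add: closedin_def)
  qed
  have "finite (d ` S)"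
  proof (rule ccontr)
    assume "infinite (d ` S)"
    moreover have "d ` S \<subseteq> C" using d by auto
    ultimately obtain x where x: "x \<in> C" "x \<in> realization K derived_set_of (d ` S)"
      using compactin_imp_Bolzano_Weierstrass[OF C] by (metis disjoint_iff)
    have "openin (realization K) (realization_set K - (d ` S - {x}))"
      using closed[of "d ` S - {x}"] by (simp add: closedin_def Diff_subset)
    moreover have "x \<in> realization_set K - (d ` S - {x})" using x(1) CK by blast
    moreover have "\<exists>y. y \<noteq> x \<and> y \<in> d ` S \<and> y \<in> T"
      if "openin (realization K) T" "x \<in> T" for T
      using x(2) that unfolding in_derived_set_of by simp
    ultimately obtain y where "y \<noteq> x" "y \<in> d ` S" "y \<in> realization_set K - (d ` S - {x})"
      by meson
    then show False by simp
  qed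
  then have "finite S"
    by (rule finite_imageD) (rule inj_on_inverseI[of _ "\<lambda>c. vertex_support c"], use d in blast)
  moreover have "finite \<sigma>" if "\<sigma> \<in> S" for \<sigma>
    using that CK realization_set_support[OF K] K by (auto simp: S_def simplicial_complex_def)
  ultimately show ?thesis unfolding S_def by blast
qed

lemma finite_support_path:
  assumes "simplicial_complex K" "pathin (realization K) q"
  shows "finite (\<Union>t\<in>{0..1}. vertex_support (q t))"
proof -
  have "compactin (realization K) (q ` {0..1})"
    by (rule image_compactin[OF _ assms(2)[unfolded pathin_def]]) (simp add: compactin_subtopology)
  from finite_support_compactin[OF assms(1) this] show ?thesis by simp
qed

lemma contiguous_paths_homotopic:
  assumes K: "simplicial_complex K"
    and q: "pathin (realization K) q" and q': "pathin (realization K) q'"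
    and sim: "\<And>t. t \<in> {0..1} \<Longrightarrow> vertex_support (q t) \<union> vertex_support (q' t) \<in> K"
    and ends: "q 0 = q' 0" "q 1 = q' 1"
  shows "homotopic_rel_ends (realization K) q q'"
proof -
  let ?Q = "{0..1::real} \<times> {0..1::real}"
  define h where "h = (\<lambda>z v. (1 - fst z) * q (snd z) v + fst z * q' (snd z) v)"
  define A where "A = (\<Union>t\<in>{0..1}. vertex_support (q t)) \<union> (\<Union>t\<in>{0..1}. vertex_support (q' t))"
  have "continuous_map (top_of_set ?Q) (realization K) h"
  proof (rule continuous_map_into_finite_subcomplex[OF K])
    show "finite A" unfolding A_def using finite_support_path[OF K] q q' by blast
    fix z assume "z \<in> topspace (top_of_set ?Q)"
    then have z: "fst z \<in> {0..1}" "snd z \<in> {0..1}" by auto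
    let ?\<sigma> = "vertex_support (q (snd z)) \<union> vertex_support (q' (snd z))"
    have s: "vertex_support (h z) \<subseteq> ?\<sigma>" by (auto simp: h_def)
    moreover have "?\<sigma> \<subseteq> A" using z(2) unfolding A_def by blast
    ultimately show "vertex_support (h z) \<subseteq> A" by (rule subset_trans)
    have fin: "finite ?\<sigma>" using sim[OF z(2)] K unfolding simplicial_complex_def by blast
    have r: "q (snd z) \<in> realization_set K" "q' (snd z) \<in> realization_set K"
      using pathin_in_topspace[OF q z(2)] pathin_in_topspace[OF q' z(2)] by auto
    have "sum (q (snd z)) ?\<sigma> = 1" "sum (q' (snd z)) ?\<sigma> = 1"
      using realization_set_sum[OF K r(1) fin] realization_set_sum[OF K r(2) fin]
      by (auto simp: closed_simplex_def)
    then have "sum (h z) ?\<sigma> = 1"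
      by (simp add: h_def sum.distrib flip: sum_distrib_left)
    moreover have "0 \<le> h z v" for v
      using z realization_set_nonneg[OF r(1), of v] realization_set_nonneg[OF r(2), of v]
      by (simp add: h_def)
    ultimately have "h z \<in> closed_simplex ?\<sigma>" using s by (simp add: closed_simplex_def)
    then show "h z \<in> realization_set K" using sim[OF z(2)] unfolding realization_set_def by blast
  next
    fix v
    have c: "continuous_on {0..1} (\<lambda>t. p t v)" if "pathin (realization K) p" for p
      using continuous_map_compose[OF that[unfolded pathin_def] continuous_map_coordinate, of v]
      by (simp add: o_def)
    have "continuous_on ?Q (\<lambda>z. q (snd z) v)" "continuous_on ?Q (\<lambda>z. q' (snd z) v)"
      by (auto intro!: continuous_on_compose2[OF c[OF q]] continuous_on_compose2[OF c[OF q']]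
          continuous_intros)
    then show "continuous_map (top_of_set ?Q) euclideanreal (\<lambda>z. h z v)"
      by (auto simp: h_def intro!: continuous_intros)
  qed
  then show ?thesis
    unfolding homotopic_rel_ends_iff
    by (intro exI[of _ h] conjI) (auto simp: h_def ends fun_eq_iff algebra_simps)
qed

text \<open>On a fixed simplex the index set of the sum no longer depends on \<open>t\<close>;
  continuity then reduces to that of finitely many coordinates.\<close>

lemma simplicial_realization_on_simplex:
  assumes "t \<in> closed_simplex \<sigma>" "finite \<sigma>"
  shows "simplicial_realization r t w = (\<Sum>v | v \<in> \<sigma> \<and> r v = w. t v)"
  unfolding simplicial_realization_def
  using assms by (intro sum.mono_neutral_left) (auto simp: closed_simplex_def)

lemma simplicial_realization_closed_simplex:
  assumes "t \<in> closed_simplex \<sigma>" "finite \<sigma>"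
  shows "simplicial_realization r t \<in> closed_simplex (r ` \<sigma>)"
proof -
  have nn: "0 \<le> t v" for v using assms by (simp add: closed_simplex_def)
  have "sum (simplicial_realization r t) (r ` \<sigma>) = sum t \<sigma>"
    unfolding simplicial_realization_on_simplex[OF assms]
    using sum.image_gen[OF assms(2), of t r] by simp
  moreover have "w \<in> r ` \<sigma>" if "simplicial_realization r t w \<noteq> 0" for w
    using that unfolding simplicial_realization_on_simplex[OF assms]
    by (metis (mono_tags, lifting) image_eqI mem_Collect_eq sum.neutral)
  ultimately show ?thesis
    using assms(1) nn by (auto simp: closed_simplex_def simplicial_realization_def sum_nonneg)
qed

lemma vertex_support_simplicial_realization:
  "vertex_support (simplicial_realization r t) \<subseteq> r ` vertex_support t"
proof
  fix w assume w: "w \<in> vertex_support (simplicial_realization r t)"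
  then have "(\<Sum>v | t v \<noteq> 0 \<and> r v = w. t v) \<noteq> 0" by (simp add: simplicial_realization_def)
  then have "{v. t v \<noteq> 0 \<and> r v = w} \<noteq> {}" by force
  then show "w \<in> r ` vertex_support t" by auto
qed

lemma continuous_map_simplicial_realization:
  assumes K: "simplicial_complex K" and L: "simplicial_complex L"
    and r: "\<And>\<sigma>. \<sigma> \<in> K \<Longrightarrow> r ` \<sigma> \<in> L"
  shows "continuous_map (realization K) (realization L) (simplicial_realization r)"
proof (rule continuous_map_from_realization)
  fix \<sigma> assume \<sigma>: "\<sigma> \<in> K"
  then have fin: "finite \<sigma>" using K by (simp add: simplicial_complex_def)
  show "continuous_map (top_of_set (closed_simplex \<sigma>)) (realization L) (simplicial_realization r)"
  proof (rule continuous_map_into_finite_subcomplex[OF L])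
    show "finite (r ` \<sigma>)" using fin by simp
    fix t assume "t \<in> topspace (top_of_set (closed_simplex \<sigma>))"
    then have "simplicial_realization r t \<in> closed_simplex (r ` \<sigma>)"
      using simplicial_realization_closed_simplex fin by auto
    then show "simplicial_realization r t \<in> realization_set L"
      "vertex_support (simplicial_realization r t) \<subseteq> r ` \<sigma>"
      using r[OF \<sigma>] by (auto simp: realization_set_def closed_simplex_def)
  next
    fix w
    have "continuous_on (closed_simplex \<sigma>) (\<lambda>t. \<Sum>v | v \<in> \<sigma> \<and> r v = w. t v)"
      by (intro continuous_on_sum continuous_on_subset[OF continuous_on_product_coordinates]) simp
    then show "continuous_map (top_of_set (closed_simplex \<sigma>)) euclideanreal
        (\<lambda>t. simplicial_realization r t w)"
      using fin by (simp add: simplicial_realization_on_simplex cong: continuous_on_cong)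
  qed
qed

lemma simplicial_realization_vertex_point [simp]:
  "simplicial_realization r (vertex_point v) = vertex_point (r v)"
proof
  fix w
  have "{u. vertex_point v u \<noteq> 0 \<and> r u = w} = (if r v = w then {v} else {})"
    by (auto simp: vertex_point_def)
  then show "simplicial_realization r (vertex_point v) w = vertex_point (r v) w"
    by (auto simp: simplicial_realization_def vertex_point_def)
qed

section \<open>Nerves of covers\<close>

lemma simplicial_complex_nerve: "simplicial_complex (nerve \<U>)"
  unfolding simplicial_complex_def
proof (intro ballI conjI allI impI)
  fix \<sigma> assume \<sigma>: "\<sigma> \<in> nerve \<U>"
  then show "finite \<sigma>" "\<sigma> \<noteq> {}" by (auto simp: nerve_def)
  fix \<tau> assume \<tau>: "\<tau> \<subseteq> \<sigma>" "\<tau> \<noteq> {}"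
  then have "\<Inter>\<sigma> \<subseteq> \<Inter>\<tau>" by (rule_tac Inter_anti_mono)
  then show "\<tau> \<in> nerve \<U>" using \<sigma> \<tau> by (auto simp: nerve_def intro: finite_subset)
qed

lemma nerveI:
  "finite \<sigma> \<Longrightarrow> \<sigma> \<noteq> {} \<Longrightarrow> \<sigma> \<subseteq> {U \<in> \<U>. x \<in> U} \<Longrightarrow> \<sigma> \<in> nerve \<U>"
  unfolding nerve_def by auto

section \<open>Paracompact Hausdorff spaces\<close>

lemma open_coverD:
  assumes "open_cover X \<U>"
  shows "U \<in> \<U> \<Longrightarrow> openin X U" "x \<in> topspace X \<Longrightarrow> \<exists>U\<in>\<U>. x \<in> U"
  using assms unfolding open_cover_def by auto

text \<open>Turns separation of \<open>B\<close> from the single points of \<open>A\<close> into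
  separation from \<open>A\<close>. Applied with \<open>B\<close> a point it gives regularity from
  Hausdorff, and with \<open>B\<close> closed it gives normality from regularity.\<close>

lemma paracompact_separation:
  assumes X: "paracompact_space X" and A: "closedin X A"
    and sep: "\<And>a. a \<in> A \<Longrightarrow> \<exists>U V. openin X U \<and> openin X V \<and> a \<in> U \<and> B \<subseteq> V \<and> disjnt U V"
    and B: "B \<subseteq> topspace X"
  shows "\<exists>U V. openin X U \<and> openin X V \<and> A \<subseteq> U \<and> B \<subseteq> V \<and> disjnt U V"
proof -
  \<comment> \<open>Every member other than the complement of \<open>A\<close> is disjoint from an
    open set around \<open>B\<close>, so its closure misses \<open>B\<close>. A set of the
    refinement that meets \<open>A\<close> must lie in such a member, and local finiteness keeps the
    union of the closures closed.\<close>
  define \<U> where "\<U> = insert (topspace X - A)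
    {U. openin X U \<and> (\<exists>V. openin X V \<and> B \<subseteq> V \<and> disjnt U V)}"
  have "open_cover X \<U>"
    unfolding open_cover_def
  proof (intro conjI ballI equalityI subsetI)
    show "openin X U" if "U \<in> \<U>" for U using that A by (auto simp: \<U>_def)
    then show "x \<in> topspace X" if "x \<in> \<Union>\<U>" for x using that openin_subset by fastforce
    show "x \<in> \<Union>\<U>" if "x \<in> topspace X" for x
      using that sep[of x] by (cases "x \<in> A") (auto simp: \<U>_def)
  qed
  then obtain \<V> where \<V>: "open_cover X \<V>" "cover_refines \<V> \<U>" "locally_finite_in X \<V>"
    using X unfolding paracompact_space_def by blast
  define \<A> where "\<A> = {V \<in> \<V>. V \<inter> A \<noteq> {}}"
  have lf: "locally_finite_in X \<A>"
    using \<V>(3) by (rule locally_finite_in_subset) (auto simp: \<A>_def)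
  have disj: "disjnt (X closure_of V) B" if V: "V \<in> \<A>" for V
  proof -
    from V obtain U where "U \<in> \<U>" "V \<subseteq> U" "V \<inter> A \<noteq> {}"
      using \<V>(2) by (auto simp: cover_refines_def \<A>_def)
    then obtain O' where O': "openin X O'" "B \<subseteq> O'" "disjnt V O'"
      by (auto simp: \<U>_def disjnt_def)
    then have "disjnt (X closure_of V) O'"
      using openin_Int_closure_of_eq_empty[of X O' V] by (auto simp: disjnt_def)
    then show ?thesis using O'(2) by (auto simp: disjnt_def)
  qed
  have "openin X (\<Union>\<A>)" using \<V>(1) by (auto simp: open_cover_def \<A>_def)
  moreover have "openin X (topspace X - \<Union>((\<lambda>V. X closure_of V) ` \<A>))"
    using closedin_Union_locally_finite_closure[OF lf] by auto
  moreover have "A \<subseteq> \<Union>\<A>"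
    using closedin_subset[OF A] \<V>(1) unfolding \<A>_def open_cover_def by blast
  moreover have "B \<subseteq> topspace X - \<Union>((\<lambda>V. X closure_of V) ` \<A>)"
    using B disj by (auto simp: disjnt_def)
  moreover have "V \<subseteq> X closure_of V" if "V \<in> \<A>" for V
    using that \<V>(1) by (intro closure_of_subset) (auto simp: open_cover_def \<A>_def)
  then have "disjnt (\<Union>\<A>) (topspace X - \<Union>((\<lambda>V. X closure_of V) ` \<A>))"
    by (auto simp: disjnt_def)
  ultimately show ?thesis by blast
qed

lemma paracompact_Hausdorff_imp_regular:
  assumes "paracompact_space X" "Hausdorff_space X"
  shows "regular_space X"
  unfolding regular_space_def
proof (intro allI impI)
  fix C a assume C: "closedin X C \<and> a \<in> topspace X - C"
  have "\<exists>U V. openin X U \<and> openin X V \<and> C \<subseteq> U \<and> {a} \<subseteq> V \<and> disjnt U V"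
  proof (rule paracompact_separation[OF assms(1)])
    fix c assume "c \<in> C"
    then have "c \<in> topspace X" "c \<noteq> a" using C closedin_subset by auto
    then show "\<exists>U V. openin X U \<and> openin X V \<and> c \<in> U \<and> {a} \<subseteq> V \<and> disjnt U V"
      using assms(2) C unfolding Hausdorff_space_def by simp
  qed (use C in auto)
  then show "\<exists>U V. openin X U \<and> openin X V \<and> a \<in> U \<and> C \<subseteq> V \<and> disjnt U V"
    using disjnt_sym by (metis insert_subset)
qed

lemma paracompact_Hausdorff_imp_normal:
  assumes "paracompact_space X" "Hausdorff_space X"
  shows "normal_space X"
  unfolding normal_space_def
proof (intro allI impI)
  fix S T assume ST: "closedin X S \<and> closedin X T \<and> disjnt S T"
  show "\<exists>U V. openin X U \<and> openin X V \<and> S \<subseteq> U \<and> T \<subseteq> V \<and> disjnt U V"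
  proof (rule paracompact_separation[OF assms(1)])
    fix a assume "a \<in> S"
    then have "a \<in> topspace X - T" using ST closedin_subset by (force simp: disjnt_iff)
    then show "\<exists>U V. openin X U \<and> openin X V \<and> a \<in> U \<and> T \<subseteq> V \<and> disjnt U V"
      using paracompact_Hausdorff_imp_regular[OF assms] ST unfolding regular_space_def by blast
  qed (use ST closedin_subset in auto)
qed

text \<open>Two rounds of refinement by sets whose closures lie in members of the preceding cover.
  The second round yields the closed sets \<open>C V\<close>, which later define barycentric
  neighbourhoods and carry the value 1 of the Urysohn functions.\<close>

lemma paracompact_shrinking:
  assumes X: "paracompact_space X" "Hausdorff_space X" and U: "open_cover X \<U>"
  obtains \<V> r C where "open_cover X \<V>" "locally_finite_in X \<V>"
    "\<And>V. V \<in> \<V> \<Longrightarrow> r V \<in> \<U> \<and> X closure_of V \<subseteq> r V"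
    "\<And>V. V \<in> \<V> \<Longrightarrow> closedin X (C V) \<and> C V \<subseteq> V"
    "\<And>x. x \<in> topspace X \<Longrightarrow> \<exists>V\<in>\<V>. x \<in> C V"
proof -
  have refine: "\<exists>\<V> r. open_cover X \<V> \<and> locally_finite_in X \<V> \<and>
      (\<forall>V\<in>\<V>. r V \<in> \<U> \<and> X closure_of V \<subseteq> r V)" if U: "open_cover X \<U>" for \<U>
  proof -
    let ?W = "{W. openin X W \<and> (\<exists>U\<in>\<U>. X closure_of W \<subseteq> U)}"
    have "open_cover X ?W"
      unfolding open_cover_def
    proof (intro conjI ballI equalityI subsetI)
      fix x assume "x \<in> topspace X"
      then obtain U where U': "U \<in> \<U>" "x \<in> U" "openin X U" using open_coverD[OF U] by blast
      have "closedin X (topspace X - U)" "x \<in> topspace X - (topspace X - U)"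
        using U' \<open>x \<in> topspace X\<close> by auto
      then obtain G H where GH: "openin X G" "openin X H" "x \<in> G" "topspace X - U \<subseteq> H" "disjnt G H"
        using paracompact_Hausdorff_imp_regular[OF X] unfolding regular_space_def by meson
      then have "disjnt H (X closure_of G)"
        \<comment> \<open>Regularity enters here: \<open>H\<close> is an open neighbourhood of the
          complement of \<open>U\<close> disjoint from \<open>G\<close>, which keeps the closure of
          \<open>G\<close> inside \<open>U\<close>.\<close>
        using openin_Int_closure_of_eq_empty[of X H G] by (auto simp: disjnt_def)
      then have "X closure_of G \<subseteq> U"
        using GH(4) closure_of_subset_topspace[of X G] by (auto simp: disjnt_iff)
      then show "x \<in> \<Union>?W" using GH U' by auto
    qed (auto dest: openin_subset)
    then obtain \<V> where \<V>: "open_cover X \<V>" "cover_refines \<V> ?W" "locally_finite_in X \<V>"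
      using X(1) unfolding paracompact_space_def by blast
    have "\<exists>U. U \<in> \<U> \<and> X closure_of V \<subseteq> U" if V: "V \<in> \<V>" for V
    proof -
      obtain W U where "V \<subseteq> W" "U \<in> \<U>" "X closure_of W \<subseteq> U"
        using \<V>(2) V unfolding cover_refines_def by blast
      then show ?thesis using closure_of_mono[of V W X] by blast
    qed
    then obtain r where "\<forall>V\<in>\<V>. r V \<in> \<U> \<and> X closure_of V \<subseteq> r V"
      using bchoice[of \<V> "\<lambda>V U. U \<in> \<U> \<and> X closure_of V \<subseteq> U"] by blast
    then show ?thesis using \<V> by blast
  qed
  obtain \<V> r where \<V>: "open_cover X \<V>" "locally_finite_in X \<V>"
    "\<forall>V\<in>\<V>. r V \<in> \<U> \<and> X closure_of V \<subseteq> r V" using refine[OF U] by blast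
  obtain \<W> s where \<W>: "open_cover X \<W>" "locally_finite_in X \<W>"
    "\<forall>W\<in>\<W>. s W \<in> \<V> \<and> X closure_of W \<subseteq> s W" using refine[OF \<V>(1)] by blast
  \<comment> \<open>All second-round sets assigned to \<open>V\<close> are collected; the family is
    locally finite, so the union of their closures is closed. It may be empty.\<close>
  define C where "C = (\<lambda>V. \<Union>W\<in>{W \<in> \<W>. s W = V}. X closure_of W)"
  have "closedin X (C V) \<and> C V \<subseteq> V" for V
    unfolding C_def using \<W>(3)
    by (auto intro!: closedin_Union_locally_finite_closure locally_finite_in_subset[OF \<W>(2)])
  moreover have "\<exists>V\<in>\<V>. x \<in> C V" if x: "x \<in> topspace X" for x
  proof -
    obtain W where "W \<in> \<W>" "x \<in> W" using open_coverD(2)[OF \<W>(1) x] by blast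
    moreover have "W \<subseteq> X closure_of W"
      using open_coverD(1)[OF \<W>(1) \<open>W \<in> \<W>\<close>] by (intro closure_of_subset openin_subset)
    ultimately show ?thesis using \<W>(3) unfolding C_def by blast
  qed
  ultimately show thesis using that \<V> by blast
qed

lemma barycentric_refinement:
  assumes X: "paracompact_space X" "Hausdorff_space X" and U: "open_cover X \<U>"
  obtains \<B> where "open_cover X \<B>"
    "\<And>x. x \<in> topspace X \<Longrightarrow> \<exists>U\<in>\<U>. \<forall>B\<in>\<B>. x \<in> B \<longrightarrow> B \<subseteq> U"
proof -
  obtain \<V> r C where \<V>: "open_cover X \<V>" "locally_finite_in X \<V>"
    "\<And>V. V \<in> \<V> \<Longrightarrow> r V \<in> \<U> \<and> X closure_of V \<subseteq> r V"
    "\<And>V. V \<in> \<V> \<Longrightarrow> closedin X (C V) \<and> C V \<subseteq> V"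
    "\<And>x. x \<in> topspace X \<Longrightarrow> \<exists>V\<in>\<V>. x \<in> C V"
    using paracompact_shrinking[OF assms] by blast
  \<comment> \<open>The second clause makes membership reversible: if \<open>x \<in> B z\<close> and
    \<open>x \<in> C V\<close>, then \<open>z \<in> C V\<close>, and the first clause gives
    \<open>B z \<subseteq> V\<close>. Hence one \<open>V\<close> with \<open>x \<in> C V\<close>
    bounds every set \<open>B z\<close> that contains \<open>x\<close>.\<close>
  define B where "B = (\<lambda>x. {y \<in> topspace X. \<forall>V\<in>\<V>. (x \<in> C V \<longrightarrow> y \<in> V) \<and> (x \<notin> C V \<longrightarrow> y \<notin> C V)})"
  have "openin X (B x)" for x
  proof (subst openin_subopen, intro ballI)
    fix y assume y: "y \<in> B x"
    then obtain N where N: "openin X N" "y \<in> N" "finite {V \<in> \<V>. V \<inter> N \<noteq> {}}"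
      using \<V>(2) unfolding locally_finite_in_def B_def by blast
    let ?F = "{V \<in> \<V>. V \<inter> N \<noteq> {}}"
    \<comment> \<open>The condition that \<open>V\<close> imposes on points of \<open>B x\<close>,
      as an open set. Near \<open>y\<close> only the finitely many \<open>V\<close> meeting
      \<open>N\<close> matter.\<close>
    define G where "G = (\<lambda>V. if x \<in> C V then V else topspace X - C V)"
    have "openin X (N \<inter> \<Inter>(insert (topspace X) (G ` ?F)))"
    proof (intro openin_Int N(1) openin_Inter)
      show "openin X S" if "S \<in> insert (topspace X) (G ` ?F)" for S
        using that \<V>(4) open_coverD(1)[OF \<V>(1)] by (auto simp: G_def)
    qed (use N(3) in auto)
    moreover have "y \<in> N \<inter> \<Inter>(insert (topspace X) (G ` ?F))"
      using y N(2) by (auto simp: B_def G_def)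
    moreover have "N \<inter> \<Inter>(insert (topspace X) (G ` ?F)) \<subseteq> B x"
    proof
      fix z assume z: "z \<in> N \<inter> \<Inter>(insert (topspace X) (G ` ?F))"
      have "(x \<in> C V \<longrightarrow> z \<in> V) \<and> (x \<notin> C V \<longrightarrow> z \<notin> C V)" if V: "V \<in> \<V>" for V
      proof (cases "V \<inter> N = {}")
        case True
        \<comment> \<open>If \<open>x\<close> were in \<open>C V\<close>, then
          \<open>y \<in> B x\<close> would lie in \<open>V\<close>, although
          \<open>y \<in> N\<close> and \<open>V\<close> misses \<open>N\<close>.\<close>
        then have "z \<notin> C V" "x \<in> C V \<Longrightarrow> False" using z y V \<V>(4)[OF V] N(2) unfolding B_def by blast+
        then show ?thesis by blast
      next
        case False
        then have "z \<in> G V" using z V by blast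
        then show ?thesis by (auto simp: G_def split: if_splits)
      qed
      then show "z \<in> B x" using z by (auto simp: B_def)
    qed
    ultimately show "\<exists>T. openin X T \<and> y \<in> T \<and> T \<subseteq> B x" by blast
  qed
  moreover have "x \<in> B x" if "x \<in> topspace X" for x
    using that \<V>(4) by (auto simp: B_def)
  ultimately have "open_cover X (B ` topspace X)"
    unfolding open_cover_def using openin_subset by blast
  moreover have "\<exists>U\<in>\<U>. \<forall>D\<in>B ` topspace X. x \<in> D \<longrightarrow> D \<subseteq> U" if x: "x \<in> topspace X" for x
  proof -
    obtain V where V: "V \<in> \<V>" "x \<in> C V" using \<V>(5)[OF x] by blast
    have "B z \<subseteq> r V" if "x \<in> B z" for z
    proof -
      have "z \<in> C V" using that V unfolding B_def by blast
      then have "B z \<subseteq> V" using V(1) unfolding B_def by blast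
      also have "V \<subseteq> X closure_of V"
        using open_coverD(1)[OF \<V>(1) V(1)] by (intro closure_of_subset openin_subset)
      finally show ?thesis using \<V>(3)[OF V(1)] by blast
    qed
    then show ?thesis using \<V>(3)[OF V(1)] by (intro bexI[of _ "r V"]) auto
  qed
  ultimately show thesis using that by blast
qed

text \<open>A barycentric refinement of a barycentric refinement is a star refinement: if
  \<open>T\<close> meets \<open>S\<close> in \<open>y\<close>, both lie in one member
  \<open>B\<close> of the intermediate cover, and every such \<open>B\<close> contains a point
  \<open>x\<close> of \<open>S\<close> fixed in advance.\<close>

lemma star_refinement:
  assumes X: "paracompact_space X" "Hausdorff_space X" and U: "open_cover X \<U>"
  obtains \<S> where "open_cover X \<S>"
    "\<And>S. S \<in> \<S> \<Longrightarrow> \<exists>U\<in>\<U>. \<forall>T\<in>\<S>. S \<inter> T \<noteq> {} \<longrightarrow> T \<subseteq> U"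
proof -
  obtain \<B> where \<B>: "open_cover X \<B>" "\<And>x. x \<in> topspace X \<Longrightarrow> \<exists>U\<in>\<U>. \<forall>B\<in>\<B>. x \<in> B \<longrightarrow> B \<subseteq> U"
    using barycentric_refinement[OF assms] by blast
  obtain \<S> where \<S>: "open_cover X \<S>" "\<And>x. x \<in> topspace X \<Longrightarrow> \<exists>B\<in>\<B>. \<forall>S\<in>\<S>. x \<in> S \<longrightarrow> S \<subseteq> B"
    using barycentric_refinement[OF X \<B>(1)] by blast
  \<comment> \<open>The empty set is discarded because \<open>U\<close> is selected by a point of
    \<open>S\<close>.\<close>
  have "\<exists>U\<in>\<U>. \<forall>T\<in>\<S> - {{}}. S \<inter> T \<noteq> {} \<longrightarrow> T \<subseteq> U" if S: "S \<in> \<S> - {{}}" for S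
  proof -
    have top: "T \<subseteq> topspace X" if "T \<in> \<S>" for T using \<S>(1) that unfolding open_cover_def by blast
    obtain x where x: "x \<in> S" "x \<in> topspace X" using S top by blast
    obtain U where U: "U \<in> \<U>" "\<forall>B\<in>\<B>. x \<in> B \<longrightarrow> B \<subseteq> U" using \<B>(2)[OF x(2)] by blast
    have "T \<subseteq> U" if T: "T \<in> \<S>" "S \<inter> T \<noteq> {}" for T
    proof -
      obtain y where y: "y \<in> S" "y \<in> T" using T(2) by blast
      then obtain B where "B \<in> \<B>" "\<forall>S\<in>\<S>. y \<in> S \<longrightarrow> S \<subseteq> B" using \<S>(2) top[OF T(1)] by blast
      then have "S \<subseteq> B" "T \<subseteq> B" using S T y by auto
      then show ?thesis using U(2) \<open>B \<in> \<B>\<close> x(1) by blast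
    qed
    then show ?thesis using U(1) by blast
  qed
  moreover have "open_cover X (\<S> - {{}})" using \<S>(1) unfolding open_cover_def by auto
  ultimately show thesis using that by blast
qed

lemma path_connected_star_refinement:
  assumes X: "paracompact_space X" "Hausdorff_space X" "locally_path_connected_space X"
    and U: "open_cover X \<U>"
  obtains \<S> where "open_cover X \<S>" "\<And>S. S \<in> \<S> \<Longrightarrow> path_connectedin X S"
    "\<And>S. S \<in> \<S> \<Longrightarrow> \<exists>U\<in>\<U>. \<forall>T\<in>\<S>. S \<inter> T \<noteq> {} \<longrightarrow> T \<subseteq> U"
proof -
  obtain \<V> where \<V>: "open_cover X \<V>"
    "\<And>S. S \<in> \<V> \<Longrightarrow> \<exists>U\<in>\<U>. \<forall>T\<in>\<V>. S \<inter> T \<noteq> {} \<longrightarrow> T \<subseteq> U"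
    using star_refinement[OF X(1,2) U] by blast
  \<comment> \<open>Replacing sets by subsets preserves the star property, as two subsets can meet
    only if the sets containing them do. Hence all path connected open sets inside members of
    \<open>\<V>\<close> may be taken at once.\<close>
  define \<S> where "\<S> = {S. openin X S \<and> path_connectedin X S \<and> (\<exists>V\<in>\<V>. S \<subseteq> V)}"
  have "open_cover X \<S>"
    unfolding open_cover_def
  proof (intro conjI ballI equalityI subsetI)
    fix x assume x: "x \<in> topspace X"
    then obtain V where V: "V \<in> \<V>" "x \<in> V" "openin X V" using open_coverD[OF \<V>(1)] by blast
    then obtain S where "openin X S" "path_connectedin X S" "x \<in> S" "S \<subseteq> V"
      using X(3) unfolding locally_path_connected_space by meson
    then show "x \<in> \<Union>\<S>" using V(1) by (auto simp: \<S>_def)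
  qed (auto simp: \<S>_def dest: openin_subset)
  moreover have "\<exists>U\<in>\<U>. \<forall>T\<in>\<S>. S \<inter> T \<noteq> {} \<longrightarrow> T \<subseteq> U" if S: "S \<in> \<S>" for S
  proof -
    obtain V where V: "V \<in> \<V>" "S \<subseteq> V" using S unfolding \<S>_def by blast
    obtain U where "U \<in> \<U>" "\<forall>T\<in>\<V>. V \<inter> T \<noteq> {} \<longrightarrow> T \<subseteq> U" using \<V>(2)[OF V(1)] by blast
    moreover have "V \<inter> T' \<noteq> {} \<and> T \<subseteq> T'" if "S \<inter> T \<noteq> {}" "T \<subseteq> T'" for T T'
      using that V(2) by auto
    moreover have "\<exists>T'\<in>\<V>. T \<subseteq> T'" if "T \<in> \<S>" for T using that unfolding \<S>_def by simp
    ultimately show ?thesis by (metis subset_trans)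
  qed
  moreover have "path_connectedin X S" if "S \<in> \<S>" for S using that unfolding \<S>_def by blast
  ultimately show thesis using that by blast
qed

section \<open>Partitions of unity and canonical maps\<close>

text \<open>The index set of the sum varies with \<open>x\<close>. On \<open>W x\<close> it may be
  enlarged to a fixed finite set by adding zero terms, and the local finite sums are pasted.\<close>

lemma continuous_map_locally_finite_sum:
  fixes g :: "'i \<Rightarrow> 'a \<Rightarrow> real"
  assumes cont: "\<And>i. i \<in> I \<Longrightarrow> continuous_map X euclideanreal (g i)"
    and lf: "\<And>x. x \<in> topspace X \<Longrightarrow> \<exists>W. openin X W \<and> x \<in> W \<and> finite {i \<in> I. \<exists>y\<in>W. g i y \<noteq> 0}"
  shows "continuous_map X euclideanreal (\<lambda>x. \<Sum>i | i \<in> I \<and> g i x \<noteq> 0. g i x)"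
proof -
  obtain W where W: "\<forall>x\<in>topspace X. openin X (W x) \<and> x \<in> W x \<and> finite {i \<in> I. \<exists>y\<in>W x. g i y \<noteq> 0}"
    using bchoice[of "topspace X" "\<lambda>x W. openin X W \<and> x \<in> W \<and> finite {i \<in> I. \<exists>y\<in>W. g i y \<noteq> 0}"] lf
    by blast
  have eq: "(\<Sum>i | i \<in> I \<and> g i y \<noteq> 0. g i y) = (\<Sum>i | i \<in> I \<and> (\<exists>y\<in>W x. g i y \<noteq> 0). g i y)"
    if "x \<in> topspace X" "y \<in> W x" for x y
    using that W by (intro sum.mono_neutral_left) auto
  show ?thesis
  proof (rule pasting_lemma[where I="topspace X" and T=W
        and f="\<lambda>x y. \<Sum>i | i \<in> I \<and> (\<exists>y\<in>W x. g i y \<noteq> 0). g i y"])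
    fix x assume x: "x \<in> topspace X"
    show "openin X (W x)" using W x by blast
    show "continuous_map (subtopology X (W x)) euclideanreal
        (\<lambda>y. \<Sum>i | i \<in> I \<and> (\<exists>y\<in>W x. g i y \<noteq> 0). g i y)"
      using W x cont by (intro continuous_map_sum continuous_map_from_subtopology) auto
    show "\<exists>j. j \<in> topspace X \<and> x \<in> W j \<and>
        (\<Sum>i | i \<in> I \<and> g i x \<noteq> 0. g i x) = (\<Sum>i | i \<in> I \<and> (\<exists>y\<in>W j. g i y \<noteq> 0). g i x)"
      using W x eq[OF x] by blast
  next
    fix i j y assume "i \<in> topspace X" "j \<in> topspace X" "y \<in> topspace X \<inter> W i \<inter> W j"
    then show "(\<Sum>k | k \<in> I \<and> (\<exists>y\<in>W i. g k y \<noteq> 0). g k y) = (\<Sum>k | k \<in> I \<and> (\<exists>y\<in>W j. g k y \<noteq> 0). g k y)"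
      using eq[of i y] eq[of j y] by simp
  qed
qed

text \<open>Functions indexed by \<open>I\<close> are collected along \<open>r\<close> so that the
  partition is indexed by the cover itself, and division by the total normalizes it. It serves for
  Urysohn functions collected along a refinement, and for pullbacks along a map, where several
  members may have the same preimage.\<close>

lemma partition_of_unity_regroup:
  fixes g :: "'i \<Rightarrow> 'a \<Rightarrow> real"
  assumes cont: "\<And>i. i \<in> I \<Longrightarrow> continuous_map X euclideanreal (g i)"
    and nn: "\<And>i x. i \<in> I \<Longrightarrow> x \<in> topspace X \<Longrightarrow> 0 \<le> g i x"
    and lf: "\<And>x. x \<in> topspace X \<Longrightarrow> \<exists>W. openin X W \<and> x \<in> W \<and> finite {i \<in> I. \<exists>y\<in>W. g i y \<noteq> 0}"
    and pos: "\<And>x. x \<in> topspace X \<Longrightarrow> \<exists>i\<in>I. g i x \<noteq> 0"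
    and r: "\<And>i. i \<in> I \<Longrightarrow> r i \<in> \<U> \<and> X closure_of {x \<in> topspace X. g i x \<noteq> 0} \<subseteq> r i"
  shows "partition_of_unity_on X \<U>
    (\<lambda>U x. (\<Sum>i | i \<in> I \<and> r i = U \<and> g i x \<noteq> 0. g i x) / (\<Sum>i | i \<in> I \<and> g i x \<noteq> 0. g i x))"
proof -
  define N where "N = (\<lambda>U x. \<Sum>i | i \<in> I \<and> r i = U \<and> g i x \<noteq> 0. g i x)"
  define G where "G = (\<lambda>x. \<Sum>i | i \<in> I \<and> g i x \<noteq> 0. g i x)"
  have fin: "finite {i \<in> I. g i x \<noteq> 0}" if x: "x \<in> topspace X" for x
  proof -
    obtain W where "x \<in> W" "finite {i \<in> I. \<exists>y\<in>W. g i y \<noteq> 0}" using lf[OF x] by blast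
    then show ?thesis by (auto elim!: rev_finite_subset)
  qed
  have Gpos: "0 < G x" if x: "x \<in> topspace X" for x
  proof -
    obtain i where i: "i \<in> I" "g i x \<noteq> 0" using pos[OF x] by blast
    have "0 < g j x" if "j \<in> {i \<in> I. g i x \<noteq> 0}" for j
      using that nn[OF _ x, of j] by fastforce
    then show ?thesis unfolding G_def using fin[OF x] i by (intro sum_pos) auto
  qed
  have Nn: "0 \<le> N U x" if "x \<in> topspace X" for U x
    unfolding N_def using nn that by (intro sum_nonneg) auto
  \<comment> \<open>Nonnegativity excludes cancellation, so the set where \<open>N U\<close> is
    nonzero is exactly the union of those of the functions assigned to \<open>U\<close>.\<close>
  have N0: "N U x \<noteq> 0 \<longleftrightarrow> (\<exists>i\<in>I. r i = U \<and> g i x \<noteq> 0)" if x: "x \<in> topspace X" for U x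
  proof -
    have "finite {i. i \<in> I \<and> r i = U \<and> g i x \<noteq> 0}"
      using fin[OF x] by (auto elim!: rev_finite_subset)
    then have "N U x = 0 \<longleftrightarrow> (\<forall>i\<in>{i. i \<in> I \<and> r i = U \<and> g i x \<noteq> 0}. g i x = 0)"
      unfolding N_def using nn x by (intro sum_nonneg_eq_0_iff) auto
    then show ?thesis by auto
  qed
  have Gc: "continuous_map X euclideanreal G"
    unfolding G_def by (intro continuous_map_locally_finite_sum cont lf)
  have Nc: "continuous_map X euclideanreal (N U)" for U
  proof -
    have "continuous_map X euclideanreal (\<lambda>x. \<Sum>i | i \<in> {i \<in> I. r i = U} \<and> g i x \<noteq> 0. g i x)"
    proof (rule continuous_map_locally_finite_sum)
      fix x assume "x \<in> topspace X"
      then obtain W where "openin X W" "x \<in> W" "finite {i \<in> I. \<exists>y\<in>W. g i y \<noteq> 0}" using lf by blast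
      then show "\<exists>W. openin X W \<and> x \<in> W \<and> finite {i \<in> {i \<in> I. r i = U}. \<exists>y\<in>W. g i y \<noteq> 0}"
        by (intro exI[of _ W]) (auto elim!: rev_finite_subset)
    qed (use cont in auto)
    then show ?thesis by (simp add: N_def conj_assoc)
  qed
  have "partition_of_unity_on X \<U> (\<lambda>U x. N U x / G x)"
    unfolding partition_of_unity_on_def
  proof (intro conjI ballI)
    fix U assume U: "U \<in> \<U>"
    show "continuous_map X euclideanreal (\<lambda>x. N U x / G x)"
      using Gpos by (intro continuous_map_real_divide Nc Gc) force
    show "0 \<le> N U x / G x" if "x \<in> topspace X" for x
      using Nn[OF that, of U] Gpos[OF that] by simp
    \<comment> \<open>For a locally finite family the closure of the union is the union of the
      closures; this puts the closed support of the regrouped function inside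
      \<open>U\<close>.\<close>
    define S where "S = (\<lambda>i. {x \<in> topspace X. g i x \<noteq> 0}) ` {i \<in> I. r i = U}"
    have "locally_finite_in X S"
      unfolding locally_finite_in_def
    proof (intro conjI ballI)
      fix x assume "x \<in> topspace X"
      then obtain W where W: "openin X W" "x \<in> W" "finite {i \<in> I. \<exists>y\<in>W. g i y \<noteq> 0}" using lf by blast
      have "{T \<in> S. T \<inter> W \<noteq> {}} \<subseteq> (\<lambda>i. {x \<in> topspace X. g i x \<noteq> 0}) ` {i \<in> I. \<exists>y\<in>W. g i y \<noteq> 0}"
        unfolding S_def by auto
      then have "finite {T \<in> S. T \<inter> W \<noteq> {}}"
        using W(3) finite_subset by blast
      then show "\<exists>V. openin X V \<and> x \<in> V \<and> finite {U \<in> S. U \<inter> V \<noteq> {}}" using W by blast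
    qed (auto simp: S_def)
    then have "X closure_of (\<Union>S) = \<Union>((\<lambda>T. X closure_of T) ` S)"
      by (rule closure_of_locally_finite_Union)
    also have "\<dots> \<subseteq> U" using r by (auto simp: S_def)
    finally have "X closure_of (\<Union>S) \<subseteq> U" .
    moreover have "{x \<in> topspace X. N U x / G x \<noteq> 0} \<subseteq> \<Union>S"
      using N0 by (auto simp: S_def)
    ultimately show "X closure_of {x \<in> topspace X. N U x / G x \<noteq> 0} \<subseteq> U"
      using closure_of_mono by fastforce
  next
    fix x assume x: "x \<in> topspace X"
    obtain W where W: "openin X W" "x \<in> W" "finite {i \<in> I. \<exists>y\<in>W. g i y \<noteq> 0}" using lf[OF x] by blast
    have "{U \<in> \<U>. \<exists>y\<in>W. N U y / G y \<noteq> 0} \<subseteq> r ` {i \<in> I. \<exists>y\<in>W. g i y \<noteq> 0}"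
      using N0 openin_subset[OF W(1)] by fastforce
    then have "finite {U \<in> \<U>. \<exists>y\<in>W. N U y / G y \<noteq> 0}"
      using W(3) finite_subset by blast
    then show "\<exists>W. openin X W \<and> x \<in> W \<and> finite {U \<in> \<U>. \<exists>y\<in>W. N U y / G y \<noteq> 0}" using W by blast
    let ?J = "{i \<in> I. g i x \<noteq> 0}"
    have "{U. U \<in> \<U> \<and> N U x / G x \<noteq> 0} = r ` ?J"
      using N0[OF x] Gpos[OF x] r by auto
    then have "(\<Sum>U | U \<in> \<U> \<and> N U x / G x \<noteq> 0. N U x / G x) = (\<Sum>U\<in>r ` ?J. N U x) / G x"
      by (simp add: sum_divide_distrib)
    also have "(\<Sum>U\<in>r ` ?J. N U x) = (\<Sum>U\<in>r ` ?J. \<Sum>i | i \<in> ?J \<and> r i = U. g i x)"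
      unfolding N_def by (intro sum.cong) auto
    also have "\<dots> = G x"
      unfolding G_def using sum.image_gen[OF fin[OF x], of "\<lambda>i. g i x" r] by simp
    finally show "(\<Sum>U | U \<in> \<U> \<and> N U x / G x \<noteq> 0. N U x / G x) = 1"
      using Gpos[OF x] by simp
  qed
  then show ?thesis by (simp add: N_def G_def)
qed

text \<open>Urysohn functions equal to 1 on \<open>C V\<close> and 0 outside \<open>V\<close> are
  locally finite because the sets \<open>V\<close> are, and some function is nonzero at each point
  because the sets \<open>C V\<close> cover.\<close>

lemma paracompact_partition_of_unity:
  assumes X: "paracompact_space X" "Hausdorff_space X" and U: "open_cover X \<U>"
  obtains \<phi> where "partition_of_unity_on X \<U> \<phi>"
proof -
  obtain \<V> r C where \<V>: "open_cover X \<V>" "locally_finite_in X \<V>"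
    "\<And>V. V \<in> \<V> \<Longrightarrow> r V \<in> \<U> \<and> X closure_of V \<subseteq> r V"
    "\<And>V. V \<in> \<V> \<Longrightarrow> closedin X (C V) \<and> C V \<subseteq> V"
    "\<And>x. x \<in> topspace X \<Longrightarrow> \<exists>V\<in>\<V>. x \<in> C V"
    using paracompact_shrinking[OF assms] by blast
  define P where "P = (\<lambda>V f. continuous_map X (top_of_set {0..1::real}) f \<and>
    f ` (topspace X - V) \<subseteq> {0} \<and> f ` C V \<subseteq> {1})"
  have "\<exists>f. P V f" if V: "V \<in> \<V>" for V
  proof -
    have "closedin X (topspace X - V)" "disjnt (topspace X - V) (C V)"
      using open_coverD(1)[OF \<V>(1) V] \<V>(4)[OF V] by (auto simp: disjnt_def)
    then obtain f where "continuous_map X (top_of_set {0..1::real}) f"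
      "f ` (topspace X - V) \<subseteq> {0}" "f ` C V \<subseteq> {1}"
      using Urysohn_lemma[OF paracompact_Hausdorff_imp_normal[OF X]] \<V>(4)[OF V] zero_le_one by metis
    then show ?thesis unfolding P_def by blast
  qed
  then obtain g where "\<forall>V\<in>\<V>. P V (g V)" using bchoice[of \<V> P] by blast
  then have gc: "continuous_map X (top_of_set {0..1::real}) (g V)"
    and g0: "\<And>x. x \<in> topspace X \<Longrightarrow> g V x \<noteq> 0 \<Longrightarrow> x \<in> V"
    and g1: "\<And>x. x \<in> C V \<Longrightarrow> g V x = 1" if "V \<in> \<V>" for V
    using that unfolding P_def by blast+
  have "partition_of_unity_on X \<U>
    (\<lambda>U x. (\<Sum>V | V \<in> \<V> \<and> r V = U \<and> g V x \<noteq> 0. g V x) / (\<Sum>V | V \<in> \<V> \<and> g V x \<noteq> 0. g V x))"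
  proof (rule partition_of_unity_regroup)
    fix V assume V: "V \<in> \<V>"
    show "continuous_map X euclideanreal (g V)"
      using gc[OF V] by (simp add: continuous_map_in_subtopology)
    show "0 \<le> g V x" if "x \<in> topspace X" for x
      using gc[OF V] that by (auto simp: continuous_map_in_subtopology)
    have "{x \<in> topspace X. g V x \<noteq> 0} \<subseteq> V" using g0[OF V] by auto
    from closure_of_mono[OF this, of X]
    show "r V \<in> \<U> \<and> X closure_of {x \<in> topspace X. g V x \<noteq> 0} \<subseteq> r V"
      using \<V>(3)[OF V] by blast
  next
    fix x assume x: "x \<in> topspace X"
    show "\<exists>V\<in>\<V>. g V x \<noteq> 0" using \<V>(5)[OF x] g1 by force
    obtain N where N: "openin X N" "x \<in> N" "finite {V \<in> \<V>. V \<inter> N \<noteq> {}}"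
      using \<V>(2) x unfolding locally_finite_in_def by blast
    have "{V \<in> \<V>. \<exists>y\<in>N. g V y \<noteq> 0} \<subseteq> {V \<in> \<V>. V \<inter> N \<noteq> {}}"
      using g0 openin_subset[OF N(1)] by blast
    then show "\<exists>W. openin X W \<and> x \<in> W \<and> finite {V \<in> \<V>. \<exists>y\<in>W. g V y \<noteq> 0}"
      using N finite_subset by blast
  qed
  then show thesis by (rule that)
qed

lemma partition_of_unity_support:
  assumes "partition_of_unity_on X \<U> \<phi>" "U \<in> \<U>" "x \<in> topspace X" "\<phi> U x \<noteq> 0"
  shows "x \<in> U"
proof -
  have "X closure_of {x \<in> topspace X. \<phi> U x \<noteq> 0} \<subseteq> U"
    using assms unfolding partition_of_unity_on_def by blast
  moreover have "{x \<in> topspace X. \<phi> U x \<noteq> 0} \<subseteq> X closure_of {x \<in> topspace X. \<phi> U x \<noteq> 0}"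
    by (rule closure_of_subset) auto
  ultimately show ?thesis using assms by blast
qed

lemma partition_of_unity_finite:
  assumes "partition_of_unity_on X \<U> \<phi>" "x \<in> topspace X"
  shows "finite {U. U \<in> \<U> \<and> \<phi> U x \<noteq> 0}"
proof -
  obtain W where "x \<in> W" "finite {U \<in> \<U>. \<exists>y\<in>W. \<phi> U y \<noteq> 0}"
    using assms unfolding partition_of_unity_on_def by blast
  then show ?thesis by (auto elim!: rev_finite_subset)
qed

lemma partition_of_unity_concentrated:
  assumes \<phi>: "partition_of_unity_on X \<U> \<phi>" and x: "x \<in> topspace X"
    and U0: "U0 \<in> \<U>" "\<phi> U0 x = 1" and U: "U \<in> \<U>" "\<phi> U x \<noteq> 0"
  shows "U = U0"
proof (rule ccontr)
  assume "U \<noteq> U0"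
  have nn: "0 \<le> \<phi> V x" if "V \<in> \<U>" for V using \<phi> x that unfolding partition_of_unity_on_def by blast
  have "(\<Sum>V\<in>{U0, U}. \<phi> V x) \<le> (\<Sum>V | V \<in> \<U> \<and> \<phi> V x \<noteq> 0. \<phi> V x)"
    using partition_of_unity_finite[OF \<phi> x] nn U0 U by (intro sum_mono2) auto
  also have "\<dots> = 1" using \<phi> x unfolding partition_of_unity_on_def by blast
  finally show False using \<open>U \<noteq> U0\<close> U0 U nn[OF U(1)] by simp
qed

section \<open>Pointed covers and canonical maps\<close>

lemma shape_indexD:
  assumes "u \<in> shape_index X x0"
  shows "open_cover X (fst u)" "snd u \<in> fst u" "x0 \<in> snd u" "x0 \<in> topspace X"
  using assms unfolding shape_index_def open_cover_def by auto

lemma shape_index_refines: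
  assumes X: "paracompact_space X" "Hausdorff_space X" and U: "open_cover X \<U>" and x0: "x0 \<in> topspace X"
  obtains u where "u \<in> shape_index X x0" "cover_refines (fst u) \<U>"
proof -
  obtain U0 where U0: "U0 \<in> \<U>" "x0 \<in> U0" using open_coverD(2)[OF U x0] by blast
  \<comment> \<open>Removing \<open>x0\<close> from the other members leaves \<open>U0\<close> as
    the only member containing it, so any partition of unity subordinated to this cover takes the
    value 1 at \<open>x0\<close> on \<open>U0\<close>.\<close>
  define \<V> where "\<V> = insert U0 ((\<lambda>U. U - {x0}) ` \<U>)"
  have "closedin X {x0}" using X(2) x0 by (simp add: closedin_Hausdorff_sing_eq)
  then have "open_cover X \<V>"
    using U U0 unfolding open_cover_def \<V>_def by auto
  moreover obtain \<phi> where \<phi>: "partition_of_unity_on X \<V> \<phi>"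
    using paracompact_partition_of_unity[OF X calculation] by blast
  moreover have "\<phi> U0 x0 = 1"
  proof -
    have "U = U0" if "U \<in> \<V>" "\<phi> U x0 \<noteq> 0" for U
      using partition_of_unity_support[OF \<phi> that(1) x0 that(2)] that(1) by (auto simp: \<V>_def)
    then have "{U. U \<in> \<V> \<and> \<phi> U x0 \<noteq> 0} \<subseteq> {U0}" by blast
    then have "(\<Sum>U | U \<in> \<V> \<and> \<phi> U x0 \<noteq> 0. \<phi> U x0) = (\<Sum>U\<in>{U0}. \<phi> U x0)"
      by (intro sum.mono_neutral_left) (auto simp: \<V>_def)
    then show ?thesis using \<phi> x0 unfolding partition_of_unity_on_def by force
  qed
  ultimately have "(\<V>, U0) \<in> shape_index X x0"
    using U0 by (auto simp: shape_index_def \<V>_def)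
  moreover have "cover_refines (fst (\<V>, U0)) \<U>"
    using U0 by (auto simp: cover_refines_def \<V>_def)
  ultimately show thesis by (rule that)
qed

lemma canonical_map_exists:
  assumes u: "u \<in> shape_index X x0"
  shows "\<exists>p. canonical_map X x0 u p"
proof -
  obtain \<U> U0 \<phi> where ueq: "u = (\<U>, U0)" and \<phi>: "partition_of_unity_on X \<U> \<phi>" "\<phi> U0 x0 = 1"
    using u unfolding shape_index_def by blast
  note ix = shape_indexD[OF u, unfolded ueq fst_conv snd_conv]
  \<comment> \<open>The values of the partition of unity become barycentric coordinates. Points of
    the realization are functions on all sets, hence the value 0 off the cover.\<close>
  define p where "p = (\<lambda>x U. if U \<in> \<U> then \<phi> U x else 0)"
  have supp: "vertex_support (p x) = {U. U \<in> \<U> \<and> \<phi> U x \<noteq> 0}" for x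
    by (auto simp: p_def)
  have nn: "0 \<le> p x U" if "x \<in> topspace X" for x U
    using \<phi>(1) that unfolding partition_of_unity_on_def p_def by auto
  have "sum (p x) (vertex_support (p x)) = (\<Sum>U | U \<in> \<U> \<and> \<phi> U x \<noteq> 0. \<phi> U x)" for x
    unfolding supp by (intro sum.cong) (auto simp: p_def)
  then have sum1: "sum (p x) (vertex_support (p x)) = 1" if "x \<in> topspace X" for x
    using \<phi>(1) that unfolding partition_of_unity_on_def by auto
  have real: "p x \<in> realization_set (nerve \<U>)" if x: "x \<in> topspace X" for x
  proof -
    have "vertex_support (p x) \<noteq> {}" using sum1[OF x] by force
    moreover have "vertex_support (p x) \<subseteq> {U \<in> \<U>. x \<in> U}"
      using partition_of_unity_support[OF \<phi>(1) _ x] by (auto simp: supp)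
    ultimately have "vertex_support (p x) \<in> nerve \<U>"
      using partition_of_unity_finite[OF \<phi>(1) x] by (intro nerveI[of _ _ x]) (auto simp: supp)
    moreover have "p x \<in> closed_simplex (vertex_support (p x))"
      using nn[OF x] sum1[OF x] by (simp add: closed_simplex_def)
    ultimately show ?thesis by (auto simp: realization_set_def)
  qed
  have "continuous_map X (realization (nerve \<U>)) p"
  proof (rule continuous_map_into_realization[OF simplicial_complex_nerve _ real])
    show "continuous_map X euclideanreal (\<lambda>x. p x U)" for U
      using \<phi>(1) unfolding partition_of_unity_on_def p_def by (cases "U \<in> \<U>") auto
    fix x assume "x \<in> topspace X"
    then obtain W where "openin X W" "x \<in> W" "finite {U \<in> \<U>. \<exists>y\<in>W. \<phi> U y \<noteq> 0}"
      using \<phi>(1) unfolding partition_of_unity_on_def by blast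
    then show "\<exists>N. openin X N \<and> x \<in> N \<and> finite (\<Union>y\<in>N. vertex_support (p y))"
      unfolding supp by (intro exI[of _ W]) (auto elim!: rev_finite_subset)
  qed
  moreover have "p x0 = vertex_point U0"
  proof
    fix U
    show "p x0 U = vertex_point U0 U"
    proof (cases "U = U0")
      case True
      then show ?thesis using \<phi>(2) ix(2) by (simp add: p_def vertex_point_def)
    next
      case False
      then have "\<not> (U \<in> \<U> \<and> \<phi> U x0 \<noteq> 0)"
        using partition_of_unity_concentrated[OF \<phi>(1) ix(4) ix(2) \<phi>(2)] by blast
      then show ?thesis using False by (auto simp: p_def vertex_point_def)
    qed
  qed
  moreover have "{x \<in> topspace X. p x \<in> open_star (nerve \<U>) U} \<subseteq> U" if "U \<in> \<U>" for U
    using partition_of_unity_support[OF \<phi>(1) that] that by (auto simp: open_star_def p_def)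
  ultimately show ?thesis by (auto simp: canonical_map_def ueq)
qed

lemma realization_nerve_support:
  assumes "t \<in> realization_set (nerve \<U>)"
  shows "vertex_support t \<subseteq> \<U>" "finite (vertex_support t)" "\<exists>x. \<forall>U\<in>vertex_support t. x \<in> U"
  using realization_set_support[OF simplicial_complex_nerve assms] by (auto simp: nerve_def)

text \<open>The star condition in the form used below: \<open>p x\<close> lies in the closed simplex
  spanned by members that contain \<open>x\<close>.\<close>

lemma canonical_map_support:
  assumes p: "canonical_map X x0 u p" and x: "x \<in> topspace X" and U: "p x U \<noteq> 0"
  shows "x \<in> U"
proof -
  have px: "p x \<in> realization_set (nerve (fst u))"
    using p x continuous_map_image_subset_topspace[of X _ p] unfolding canonical_map_def by fastforce
  then have "p x \<in> open_star (nerve (fst u)) U" using U by (simp add: open_star_iff_support)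
  moreover have "U \<in> fst u" using realization_nerve_support(1)[OF px] U by blast
  ultimately show ?thesis using p x unfolding canonical_map_def by blast
qed

lemma pullback_cover_in_shape_index:
  assumes f: "continuous_map X Y f" "f x0 = y0" and x0: "x0 \<in> topspace X" and w: "w \<in> shape_index Y y0"
  shows "pullback_cover X f w \<in> shape_index X x0"
proof -
  obtain \<W> W0 \<phi> where weq: "w = (\<W>, W0)" and \<phi>: "partition_of_unity_on Y \<W> \<phi>" "\<phi> W0 y0 = 1"
    using w unfolding shape_index_def by blast
  note ix = shape_indexD[OF w, unfolded weq fst_conv snd_conv]
  have fY: "f x \<in> topspace Y" if "x \<in> topspace X" for x
    using f(1) that continuous_map_image_subset_topspace by fastforce
  define r where "r = (\<lambda>W. {x \<in> topspace X. f x \<in> W})"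
  \<comment> \<open>Indices are members of \<open>\<W>\<close>, not their preimages: distinct
    members may have the same preimage, and their functions must then be added. Members with empty
    preimage are dropped, as in \<open>pullback_cover\<close>.\<close>
  define I where "I = {W \<in> \<W>. r W \<noteq> {}}"
  define \<V> where "\<V> = r ` \<W> - {{}}"
  define \<psi> where "\<psi> = (\<lambda>U x. (\<Sum>W | W \<in> I \<and> r W = U \<and> \<phi> W (f x) \<noteq> 0. \<phi> W (f x)) /
      (\<Sum>W | W \<in> I \<and> \<phi> W (f x) \<noteq> 0. \<phi> W (f x)))"
  have "partition_of_unity_on X \<V> \<psi>"
    unfolding \<psi>_def
  proof (rule partition_of_unity_regroup)
    fix W assume W: "W \<in> I"
    then have W': "continuous_map Y euclideanreal (\<phi> W)" "\<And>y. y \<in> topspace Y \<Longrightarrow> 0 \<le> \<phi> W y"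
      "Y closure_of {y \<in> topspace Y. \<phi> W y \<noteq> 0} \<subseteq> W"
      using \<phi>(1) unfolding partition_of_unity_on_def I_def by auto
    show "continuous_map X euclideanreal (\<lambda>x. \<phi> W (f x))"
      using continuous_map_compose[OF f(1) W'(1)] by (simp add: o_def)
    show "0 \<le> \<phi> W (f x)" if "x \<in> topspace X" for x using W'(2) fY that by blast
    let ?C = "{x \<in> topspace X. f x \<in> Y closure_of {y \<in> topspace Y. \<phi> W y \<noteq> 0}}"
    have "closedin X ?C" by (rule closedin_continuous_map_preimage[OF f(1) closedin_closure_of])
    moreover have "{x \<in> topspace X. \<phi> W (f x) \<noteq> 0} \<subseteq> ?C"
      using fY closure_of_subset[of "{y \<in> topspace Y. \<phi> W y \<noteq> 0}" Y] by auto
    ultimately have "X closure_of {x \<in> topspace X. \<phi> W (f x) \<noteq> 0} \<subseteq> ?C" by (rule closure_of_minimal[rotated])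
    also have "?C \<subseteq> r W" using W'(3) by (auto simp: r_def)
    finally show "r W \<in> \<V> \<and> X closure_of {x \<in> topspace X. \<phi> W (f x) \<noteq> 0} \<subseteq> r W"
      using W by (auto simp: \<V>_def I_def)
  next
    fix x assume x: "x \<in> topspace X"
    have "(\<Sum>W | W \<in> \<W> \<and> \<phi> W (f x) \<noteq> 0. \<phi> W (f x)) = 1"
      using \<phi>(1) fY[OF x] unfolding partition_of_unity_on_def by blast
    then have "{W. W \<in> \<W> \<and> \<phi> W (f x) \<noteq> 0} \<noteq> {}" by force
    then obtain W where W: "W \<in> \<W>" "\<phi> W (f x) \<noteq> 0" by blast
    then show "\<exists>W\<in>I. \<phi> W (f x) \<noteq> 0"
      using partition_of_unity_support[OF \<phi>(1) W(1) fY[OF x] W(2)] x by (auto simp: I_def r_def)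
    obtain N where N: "openin Y N" "f x \<in> N" "finite {W \<in> \<W>. \<exists>y\<in>N. \<phi> W y \<noteq> 0}"
      using \<phi>(1) fY[OF x] unfolding partition_of_unity_on_def by blast
    have "{W \<in> I. \<exists>y\<in>{x \<in> topspace X. f x \<in> N}. \<phi> W (f y) \<noteq> 0} \<subseteq> {W \<in> \<W>. \<exists>y\<in>N. \<phi> W y \<noteq> 0}"
      by (auto simp: I_def)
    then have "finite {W \<in> I. \<exists>y\<in>{x \<in> topspace X. f x \<in> N}. \<phi> W (f y) \<noteq> 0}"
      using N(3) by (rule finite_subset)
    moreover have "openin X {x \<in> topspace X. f x \<in> N}"
      using f(1) N(1) by (rule openin_continuous_map_preimage)
    ultimately show "\<exists>M. openin X M \<and> x \<in> M \<and> finite {W \<in> I. \<exists>y\<in>M. \<phi> W (f y) \<noteq> 0}"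
      using N(2) x by (intro exI[of _ "{x \<in> topspace X. f x \<in> N}"]) simp
  qed
  moreover have "\<psi> (r W0) x0 = 1"
  proof -
    have W0: "W0 \<in> I" using ix f x0 by (auto simp: I_def r_def)
    have "W = W0" if "W \<in> I" "\<phi> W y0 \<noteq> 0" for W
      by (rule partition_of_unity_concentrated[OF \<phi>(1) ix(4) ix(2) \<phi>(2)])
        (use that in \<open>simp_all add: I_def\<close>)
    \<comment> \<open>At the basepoint numerator and denominator both reduce to the single term of
      \<open>W0\<close>, which is 1, even if other members share its preimage.\<close>
    then have "{W. W \<in> I \<and> \<phi> W y0 \<noteq> 0} = {W0}" "{W. W \<in> I \<and> r W = r W0 \<and> \<phi> W y0 \<noteq> 0} = {W0}"
      using W0 \<phi>(2) by fastforce+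
    then show ?thesis using \<phi>(2) f(2) by (simp add: \<psi>_def)
  qed
  moreover have "open_cover X \<V>"
    unfolding open_cover_def
  proof (intro conjI ballI)
    show "openin X V" if "V \<in> \<V>" for V
      using that openin_continuous_map_preimage[OF f(1)] open_coverD(1)[OF ix(1)]
      by (auto simp: \<V>_def r_def)
    show "\<Union>\<V> = topspace X"
    proof (intro equalityI subsetI)
      fix x assume x: "x \<in> topspace X"
      then obtain W where "W \<in> \<W>" "f x \<in> W" using open_coverD(2)[OF ix(1) fY[OF x]] by blast
      then have "r W \<in> \<V>" "x \<in> r W" using x by (auto simp: \<V>_def r_def)
      then show "x \<in> \<Union>\<V>" by blast
    qed (auto simp: \<V>_def r_def)
  qed
  moreover have "r W0 \<in> \<V>" "x0 \<in> r W0" using ix f x0 by (auto simp: \<V>_def r_def)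
  ultimately show ?thesis
    unfolding shape_index_def pullback_cover_def weq by (auto simp: r_def \<V>_def)
qed

section \<open>The first shape group\<close>

lemma nerve_simplex_over:
  assumes "t \<in> realization_set (nerve \<U>)" "t' \<in> realization_set (nerve \<U>)"
    and "\<And>U. t U \<noteq> 0 \<Longrightarrow> x \<in> U" "\<And>U. t' U \<noteq> 0 \<Longrightarrow> x \<in> U"
  shows "vertex_support t \<union> vertex_support t' \<in> nerve \<U>"
proof (rule nerveI)
  show "vertex_support t \<union> vertex_support t' \<noteq> {}"
    using realization_set_support[OF simplicial_complex_nerve assms(1)] by (auto simp: nerve_def)
  show "vertex_support t \<union> vertex_support t' \<subseteq> {U \<in> \<U>. x \<in> U}"
    using realization_nerve_support(1)[OF assms(1)] realization_nerve_support(1)[OF assms(2)] assms(3,4)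
    by blast
qed (use realization_nerve_support(2) assms(1,2) in blast)

lemma paths_over_homotopic:
  assumes q: "pathin (realization (nerve \<U>)) q" and q': "pathin (realization (nerve \<U>)) q'"
    and over: "\<And>t. t \<in> {0..1} \<Longrightarrow> \<exists>x. (\<forall>U. q t U \<noteq> 0 \<longrightarrow> x \<in> U) \<and> (\<forall>U. q' t U \<noteq> 0 \<longrightarrow> x \<in> U)"
    and ends: "q 0 = q' 0" "q 1 = q' 1"
  shows "homotopic_rel_ends (realization (nerve \<U>)) q q'"
proof (rule contiguous_paths_homotopic[OF simplicial_complex_nerve q q' _ ends])
  fix t :: real assume t: "t \<in> {0..1}"
  obtain x where x: "\<forall>U. q t U \<noteq> 0 \<longrightarrow> x \<in> U" "\<forall>U. q' t U \<noteq> 0 \<longrightarrow> x \<in> U" using over[OF t] by blast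
  show "vertex_support (q t) \<union> vertex_support (q' t) \<in> nerve \<U>"
    by (rule nerve_simplex_over[of _ _ _ x])
      (use x pathin_in_topspace[OF q t] pathin_in_topspace[OF q' t] in auto)
qed

text \<open>A vertex map covering \<open>f\<close>. This common form includes refinement
  assignments, with \<open>f = id\<close>, and pullback assignments; two vertex maps over the same
  \<open>f\<close> are contiguous.\<close>

definition nerve_map_over :: "('a \<Rightarrow> 'b) \<Rightarrow> 'a set set \<Rightarrow> 'b set set \<Rightarrow> ('a set \<Rightarrow> 'b set) \<Rightarrow> bool" where
  "nerve_map_over f \<V> \<U> r \<longleftrightarrow> (\<forall>V\<in>\<V>. r V \<in> \<U> \<and> f ` V \<subseteq> r V)"

lemma continuous_map_nerve_map:
  assumes "nerve_map_over f \<V> \<U> r"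
  shows "continuous_map (realization (nerve \<V>)) (realization (nerve \<U>)) (simplicial_realization r)"
proof (rule continuous_map_simplicial_realization[OF simplicial_complex_nerve simplicial_complex_nerve])
  fix \<sigma> assume \<sigma>: "\<sigma> \<in> nerve \<V>"
  then obtain x where x: "\<forall>V\<in>\<sigma>. x \<in> V" by (auto simp: nerve_def)
  show "r ` \<sigma> \<in> nerve \<U>"
    by (rule nerveI[of _ _ "f x"])
      (use \<sigma> x assms in \<open>auto simp: nerve_def nerve_map_over_def image_subset_iff\<close>)
qed

lemma simplicial_realization_over:
  assumes r: "nerve_map_over f \<V> \<U> r" and t: "\<And>V. t V \<noteq> 0 \<Longrightarrow> V \<in> \<V> \<and> x \<in> V"
    and U: "simplicial_realization r t U \<noteq> 0"
  shows "f x \<in> U"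
proof -
  obtain V where "t V \<noteq> 0" "U = r V"
    using vertex_support_simplicial_realization[of r t] U by auto
  then show ?thesis using r t unfolding nerve_map_over_def by blast
qed

text \<open>For maps between nerves no underlying path in the space is available. At each time the
  common point \<open>x\<close> of the members in the support of \<open>\<gamma> t\<close> takes its
  place, and both images lie over \<open>f x\<close>.\<close>

lemma nerve_maps_homotopic:
  assumes \<gamma>: "pathin (realization (nerve \<W>)) \<gamma>"
    and g: "continuous_map (realization (nerve \<W>)) (realization (nerve \<U>)) g"
    and g': "continuous_map (realization (nerve \<W>)) (realization (nerve \<U>)) g'"
    and over: "\<And>t x U. (\<And>W. t W \<noteq> 0 \<Longrightarrow> W \<in> \<W> \<and> x \<in> W) \<Longrightarrow> g t U \<noteq> 0 \<Longrightarrow> f x \<in> U"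
    and over': "\<And>t x U. (\<And>W. t W \<noteq> 0 \<Longrightarrow> W \<in> \<W> \<and> x \<in> W) \<Longrightarrow> g' t U \<noteq> 0 \<Longrightarrow> f x \<in> U"
    and ends: "g (\<gamma> 0) = g' (\<gamma> 0)" "g (\<gamma> 1) = g' (\<gamma> 1)"
  shows "homotopic_rel_ends (realization (nerve \<U>)) (g \<circ> \<gamma>) (g' \<circ> \<gamma>)"
proof (rule paths_over_homotopic)
  fix t :: real assume t: "t \<in> {0..1}"
  have \<gamma>t: "\<gamma> t \<in> realization_set (nerve \<W>)" using pathin_in_topspace[OF \<gamma> t] by simp
  obtain x where x: "\<forall>W\<in>vertex_support (\<gamma> t). x \<in> W" using realization_nerve_support(3)[OF \<gamma>t] by blast
  have W: "W \<in> \<W> \<and> x \<in> W" if "\<gamma> t W \<noteq> 0" for W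
    using that x realization_nerve_support(1)[OF \<gamma>t] by blast
  show "\<exists>x. (\<forall>U. (g \<circ> \<gamma>) t U \<noteq> 0 \<longrightarrow> x \<in> U) \<and> (\<forall>U. (g' \<circ> \<gamma>) t U \<noteq> 0 \<longrightarrow> x \<in> U)"
    using over[OF W] over'[OF W] by (intro exI[of _ "f x"]) auto
qed (use \<gamma> g g' ends in \<open>auto intro: pathin_compose\<close>)

lemma group_nerve_pi1:
  assumes "u \<in> shape_index X x0"
  shows "group (nerve_pi1 u)"
proof -
  have "{snd u} \<in> nerve (fst u)"
    using shape_indexD[OF assms] by (intro nerveI[of _ _ x0]) auto
  then show ?thesis
    unfolding nerve_pi1_def
    by (intro group_fundamental_group) (simp add: vertex_point_in_realization_set)
qed

lemma nerve_map_hom: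
  assumes "nerve_map_over f (fst v) (fst u) r" "r (snd v) = snd u"
  shows "pi1_map (realization (nerve (fst u))) (simplicial_realization r) \<in> hom (nerve_pi1 v) (nerve_pi1 u)"
  unfolding nerve_pi1_def
  using pi1_map_hom[OF continuous_map_nerve_map[OF assms(1)], of "vertex_point (snd v)"] assms(2) by simp

lemma refinement_assignment_exists:
  assumes "pointed_refines v u" "snd u \<in> fst u"
  shows "\<exists>r. refinement_assignment v u r"
proof -
  have "\<forall>V\<in>fst v. \<exists>U. U \<in> fst u \<and> V \<subseteq> U"
    using assms(1) unfolding pointed_refines_def cover_refines_def by blast
  then obtain r where r: "\<forall>V\<in>fst v. r V \<in> fst u \<and> V \<subseteq> r V"
    using bchoice[of "fst v" "\<lambda>V U. U \<in> fst u \<and> V \<subseteq> U"] by blast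
  have "refinement_assignment v u (r(snd v := snd u))"
    using r assms unfolding refinement_assignment_def pointed_refines_def by auto
  then show ?thesis by blast
qed

text \<open>Replaces the chosen refinement assignment by an arbitrary vertex map over the identity;
  nothing further about the choice is used.\<close>

lemma bonding_map_nerve_map:
  assumes "pointed_refines v u" "u \<in> shape_index X x0"
  obtains r where "nerve_map_over id (fst v) (fst u) r" "r (snd v) = snd u"
    "bonding_map u v = pi1_map (realization (nerve (fst u))) (simplicial_realization r)"
proof (rule that[of "SOME r. refinement_assignment v u r"])
  have "refinement_assignment v u (SOME r. refinement_assignment v u r)"
    using refinement_assignment_exists[OF assms(1)] shape_indexD(2)[OF assms(2)] by (simp add: someI_ex)
  then show "nerve_map_over id (fst v) (fst u) (SOME r. refinement_assignment v u r)"
    "(SOME r. refinement_assignment v u r) (snd v) = snd u"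
    by (auto simp: refinement_assignment_def nerve_map_over_def)
  show "bonding_map u v =
    pi1_map (realization (nerve (fst u))) (simplicial_realization (SOME r. refinement_assignment v u r))"
    by (simp add: bonding_map_def)
qed

lemma bonding_map_hom:
  assumes "pointed_refines v u" "u \<in> shape_index X x0"
  shows "bonding_map u v \<in> hom (nerve_pi1 v) (nerve_pi1 u)"
  by (rule bonding_map_nerve_map[OF assms]) (simp add: nerve_map_hom)

text \<open>The coherent families, named separately so that the shape group appears as the product
  group restricted to a subgroup.\<close>

definition shape_threads ::
    "'a topology \<Rightarrow> 'a \<Rightarrow> ('a pointed_cover \<Rightarrow> (real \<Rightarrow> 'a set \<Rightarrow> real) set) set" where
  "shape_threads X x0 = {s \<in> (\<Pi>\<^sub>E u\<in>shape_index X x0. carrier (nerve_pi1 u)).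
     \<forall>u\<in>shape_index X x0. \<forall>v\<in>shape_index X x0. pointed_refines v u \<longrightarrow> bonding_map u v (s v) = s u}"

lemma shape_group_eq:
  "shape_group X x0 = (product_group (shape_index X x0) nerve_pi1)\<lparr>carrier := shape_threads X x0\<rparr>"
  by (simp add: shape_group_def shape_threads_def)

lemma carrier_shape_group [simp]: "carrier (shape_group X x0) = shape_threads X x0"
  by (simp add: shape_group_eq)

lemma mult_shape_group:
  "s \<otimes>\<^bsub>shape_group X x0\<^esub> t = (\<lambda>u\<in>shape_index X x0. s u \<otimes>\<^bsub>nerve_pi1 u\<^esub> t u)"
  by (simp add: shape_group_eq)

lemma one_shape_group: "\<one>\<^bsub>shape_group X x0\<^esub> = (\<lambda>u\<in>shape_index X x0. \<one>\<^bsub>nerve_pi1 u\<^esub>)"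
  by (simp add: shape_group_eq)

lemma group_shape_group: "group (shape_group X x0)"
proof -
  let ?I = "shape_index X x0" and ?P = "product_group (shape_index X x0) nerve_pi1"
  have grp: "group (nerve_pi1 u)" if "u \<in> ?I" for u using that by (rule group_nerve_pi1)
  have bond: "group_hom (nerve_pi1 v) (nerve_pi1 u) (bonding_map u v)"
    if "u \<in> ?I" "v \<in> ?I" "pointed_refines v u" for u v
    using grp that bonding_map_hom[OF that(3,1)] by (simp add: group_hom_def group_hom_axioms_def)
  interpret P: group ?P by (rule product_group[OF grp])
  have "subgroup (shape_threads X x0) ?P"
  proof (rule P.subgroupI)
    show "shape_threads X x0 \<subseteq> carrier ?P" by (auto simp: shape_threads_def)
    have "\<one>\<^bsub>?P\<^esub> \<in> shape_threads X x0"
      using group_hom.hom_one[OF bond] grp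
      by (simp add: shape_threads_def group.is_monoid monoid.one_closed)
    then show "shape_threads X x0 \<noteq> {}" by blast
  next
    fix s assume s: "s \<in> shape_threads X x0"
    then have sP: "s \<in> (\<Pi>\<^sub>E u\<in>?I. carrier (nerve_pi1 u))" by (simp add: shape_threads_def)
    then have sc: "s u \<in> carrier (nerve_pi1 u)" if "u \<in> ?I" for u using that by auto
    have "bonding_map u v (inv\<^bsub>nerve_pi1 v\<^esub> s v) = inv\<^bsub>nerve_pi1 u\<^esub> s u"
      if uv: "u \<in> ?I" "v \<in> ?I" "pointed_refines v u" for u v
      using group_hom.hom_inv[OF bond[OF uv] sc[OF uv(2)]] s uv by (simp add: shape_threads_def)
    then show "inv\<^bsub>?P\<^esub> s \<in> shape_threads X x0"
      using sc grp by (simp add: inv_product_group[OF sP grp] shape_threads_def)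
    fix t assume t: "t \<in> shape_threads X x0"
    then have tc: "t u \<in> carrier (nerve_pi1 u)" if "u \<in> ?I" for u
      using that by (auto simp: shape_threads_def)
    have "bonding_map u v (s v \<otimes>\<^bsub>nerve_pi1 v\<^esub> t v) = s u \<otimes>\<^bsub>nerve_pi1 u\<^esub> t u"
      if uv: "u \<in> ?I" "v \<in> ?I" "pointed_refines v u" for u v
      using group_hom.hom_mult[OF bond[OF uv] sc[OF uv(2)] tc[OF uv(2)]] s t uv by (simp add: shape_threads_def)
    then show "s \<otimes>\<^bsub>?P\<^esub> t \<in> shape_threads X x0"
      using sc tc grp by (simp add: shape_threads_def group.is_monoid monoid.m_closed)
  qed
  then show ?thesis
    unfolding shape_group_eq by (rule P.subgroup_imp_group)
qed

lemma canonical_map_some: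
  "u \<in> shape_index X x0 \<Longrightarrow> canonical_map X x0 u (SOME p. canonical_map X x0 u p)"
  using someI_ex[OF canonical_map_exists] .

lemma canonical_mapD:
  assumes "canonical_map X x0 u p"
  shows "continuous_map X (realization (nerve (fst u))) p" "p x0 = vertex_point (snd u)"
  using assms by (auto simp: canonical_map_def)

lemma shape_hom_path_class:
  assumes "u \<in> shape_index X x0" "pathin X \<alpha>"
  shows "shape_hom X x0 (path_class X \<alpha>) u =
    path_class (realization (nerve (fst u))) ((SOME p. canonical_map X x0 u p) \<circ> \<alpha>)"
  using assms pi1_map_path_class[OF assms(2) canonical_mapD(1)[OF canonical_map_some[OF assms(1)]]]
  by (simp add: shape_hom_def)

text \<open>Both maps send \<open>x\<close> into the closed simplex of members of the cover of \<open>u\<close> containing \<open>f x\<close>.\<close>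

lemma canonical_nerve_map_homotopic:
  assumes p: "canonical_map X x0 v p" and q: "canonical_map Y y0 u q"
    and f: "continuous_map X Y f" "f x0 = y0"
    and r: "nerve_map_over f (fst v) (fst u) r" "r (snd v) = snd u"
    and \<alpha>: "pathin X \<alpha>" "\<alpha> 0 = x0" "\<alpha> 1 = x0"
  shows "homotopic_rel_ends (realization (nerve (fst u)))
    (simplicial_realization r \<circ> (p \<circ> \<alpha>)) (q \<circ> (f \<circ> \<alpha>))"
proof (rule paths_over_homotopic)
  note pc = canonical_mapD[OF p] and qc = canonical_mapD[OF q]
  show "pathin (realization (nerve (fst u))) (simplicial_realization r \<circ> (p \<circ> \<alpha>))"
    by (intro pathin_compose[OF _ continuous_map_nerve_map[OF r(1)]] pathin_compose[OF _ pc(1)] \<alpha>)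
  show "pathin (realization (nerve (fst u))) (q \<circ> (f \<circ> \<alpha>))"
    by (intro pathin_compose[OF _ qc(1)] pathin_compose[OF _ f(1)] \<alpha>)
  show "(simplicial_realization r \<circ> (p \<circ> \<alpha>)) 0 = (q \<circ> (f \<circ> \<alpha>)) 0"
    "(simplicial_realization r \<circ> (p \<circ> \<alpha>)) 1 = (q \<circ> (f \<circ> \<alpha>)) 1"
    using \<alpha> pc qc f r by auto
  fix t :: real assume t: "t \<in> {0..1}"
  have x: "\<alpha> t \<in> topspace X" by (rule pathin_in_topspace[OF \<alpha>(1) t])
  then have fx: "f (\<alpha> t) \<in> topspace Y" using f(1) continuous_map_image_subset_topspace by fastforce
  have "p (\<alpha> t) \<in> realization_set (nerve (fst v))"
    using pathin_in_topspace[OF pathin_compose[OF \<alpha>(1) pc(1)] t] by simp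
  then have V: "V \<in> fst v \<and> \<alpha> t \<in> V" if "p (\<alpha> t) V \<noteq> 0" for V
    using that canonical_map_support[OF p x] realization_nerve_support(1) by blast
  have "f (\<alpha> t) \<in> U" if "simplicial_realization r (p (\<alpha> t)) U \<noteq> 0" for U
    using simplicial_realization_over[OF r(1) _ that, of "\<alpha> t"] V by blast
  moreover have "f (\<alpha> t) \<in> U" if "q (f (\<alpha> t)) U \<noteq> 0" for U
    by (rule canonical_map_support[OF q fx that])
  ultimately show "\<exists>x. (\<forall>U. (simplicial_realization r \<circ> (p \<circ> \<alpha>)) t U \<noteq> 0 \<longrightarrow> x \<in> U) \<and>
      (\<forall>U. (q \<circ> (f \<circ> \<alpha>)) t U \<noteq> 0 \<longrightarrow> x \<in> U)"
    by (intro exI[of _ "f (\<alpha> t)"]) auto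
qed

text \<open>One statement for two purposes: with \<open>f = id\<close> and a refinement assignment
  it shows that \<open>shape_hom\<close> takes values in the inverse limit; with a pullback
  assignment it is the naturality square.\<close>

lemma shape_hom_compatible:
  assumes u: "u \<in> shape_index Y y0" and v: "v \<in> shape_index X x0"
    and f: "continuous_map X Y f" "f x0 = y0"
    and r: "nerve_map_over f (fst v) (fst u) r" "r (snd v) = snd u"
    and a: "a \<in> carrier (fundamental_group X x0)"
  shows "pi1_map (realization (nerve (fst u))) (simplicial_realization r) (shape_hom X x0 a v) =
    shape_hom Y y0 (pi1_map Y f a) u"
proof -
  obtain \<alpha> where \<alpha>: "pathin X \<alpha>" "\<alpha> 0 = x0" "\<alpha> 1 = x0" "a = path_class X \<alpha>"
    using a by (rule fundamental_group_carrierE)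
  let ?p = "SOME p. canonical_map X x0 v p"
  have p: "canonical_map X x0 v ?p" by (rule canonical_map_some[OF v])
  have "pi1_map (realization (nerve (fst u))) (simplicial_realization r) (shape_hom X x0 a v) =
    path_class (realization (nerve (fst u))) (simplicial_realization r \<circ> (?p \<circ> \<alpha>))"
    using \<alpha> v by (simp add: shape_hom_path_class
        pi1_map_path_class[OF pathin_compose[OF \<alpha>(1) canonical_mapD(1)[OF p]] continuous_map_nerve_map[OF r(1)]])
  also have "\<dots> = path_class (realization (nerve (fst u))) ((SOME q. canonical_map Y y0 u q) \<circ> (f \<circ> \<alpha>))"
    by (rule path_class_eqI, rule canonical_nerve_map_homotopic[OF p canonical_map_some[OF u] f r \<alpha>(1-3)])
  also have "\<dots> = shape_hom Y y0 (pi1_map Y f a) u"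
    using \<alpha> f u by (simp add: shape_hom_path_class pi1_map_path_class pathin_compose)
  finally show ?thesis .
qed

lemma shape_hom_group_hom:
  assumes "x0 \<in> topspace X"
  shows "group_hom (fundamental_group X x0) (shape_group X x0) (shape_hom X x0)"
proof -
  let ?I = "shape_index X x0"
  have hom: "(\<lambda>a. shape_hom X x0 a u) \<in> hom (fundamental_group X x0) (nerve_pi1 u)" if u: "u \<in> ?I" for u
    using pi1_map_hom[OF canonical_mapD(1)[OF canonical_map_some[OF u]], of x0]
      canonical_mapD(2)[OF canonical_map_some[OF u]] u
    by (simp add: shape_hom_def nerve_pi1_def)
  have "shape_hom X x0 a \<in> shape_threads X x0" if a: "a \<in> carrier (fundamental_group X x0)" for a
  proof -
    have id: "pi1_map X id a = a"
      using a pi1_map_path_class[of X _ X id] by (auto elim!: fundamental_group_carrierE)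
    have "bonding_map u v (shape_hom X x0 a v) = shape_hom X x0 a u"
      if uv: "u \<in> ?I" "v \<in> ?I" "pointed_refines v u" for u v
    proof -
      obtain r where r: "nerve_map_over id (fst v) (fst u) r" "r (snd v) = snd u"
        "bonding_map u v = pi1_map (realization (nerve (fst u))) (simplicial_realization r)"
        by (rule bonding_map_nerve_map[OF uv(3,1)])
      show ?thesis
        using shape_hom_compatible[OF uv(1,2) _ _ r(1,2) a] id by (simp add: r(3))
    qed
    moreover have "shape_hom X x0 a \<in> (\<Pi>\<^sub>E u\<in>?I. carrier (nerve_pi1 u))"
      using hom_in_carrier[OF hom a] by (auto simp: shape_hom_def)
    ultimately show ?thesis by (simp add: shape_threads_def)
  qed
  moreover have "shape_hom X x0 (a \<otimes>\<^bsub>fundamental_group X x0\<^esub> b) =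
      shape_hom X x0 a \<otimes>\<^bsub>shape_group X x0\<^esub> shape_hom X x0 b"
    if "a \<in> carrier (fundamental_group X x0)" "b \<in> carrier (fundamental_group X x0)" for a b
  proof
    fix u
    show "shape_hom X x0 (a \<otimes>\<^bsub>fundamental_group X x0\<^esub> b) u =
      (shape_hom X x0 a \<otimes>\<^bsub>shape_group X x0\<^esub> shape_hom X x0 b) u"
      using hom_mult[OF hom, of u a b] that
      by (cases "u \<in> ?I") (simp_all add: mult_shape_group, simp add: shape_hom_def)
  qed
  ultimately have "shape_hom X x0 \<in> hom (fundamental_group X x0) (shape_group X x0)"
    by (intro homI) auto
  then show ?thesis
    using group_fundamental_group[OF assms] group_shape_group
    by (simp add: group_hom_def group_hom_axioms_def)
qed

lemma pullback_nerve_map: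
  assumes f: "continuous_map X Y f" "f x0 = y0" and x0: "x0 \<in> topspace X" and w: "w \<in> shape_index Y y0"
  obtains r where "nerve_map_over f (fst (pullback_cover X f w)) (fst w) r" "r (snd (pullback_cover X f w)) = snd w"
    "\<forall>s. shape_map X Y y0 f s w =
      pi1_map (realization (nerve (fst w))) (simplicial_realization r) (s (pullback_cover X f w))"
proof (rule that[of "SOME r. pullback_assignment X f w r"])
  let ?P = "\<lambda>W. {x \<in> topspace X. f x \<in> W}" and ?v = "pullback_cover X f w"
  have "\<forall>V\<in>fst ?v. \<exists>W. W \<in> fst w \<and> ?P W = V" by (auto simp: pullback_cover_def)
  then obtain r where r: "\<forall>V\<in>fst ?v. r V \<in> fst w \<and> ?P (r V) = V"
    using bchoice[of "fst ?v" "\<lambda>V W. W \<in> fst w \<and> ?P W = V"] by blast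
  \<comment> \<open>The assignment may be altered at the distinguished vertex because
    \<open>snd w\<close> has that vertex as its preimage.\<close>
  have "pullback_assignment X f w (r(snd ?v := snd w))"
    using r shape_indexD(2)[OF w] unfolding pullback_assignment_def by (auto simp: pullback_cover_def)
  then have P: "pullback_assignment X f w (SOME r. pullback_assignment X f w r)"
    by (rule someI[of "pullback_assignment X f w"])
  then show "(SOME r. pullback_assignment X f w r) (snd ?v) = snd w"
    by (simp add: pullback_assignment_def)
  show "nerve_map_over f (fst ?v) (fst w) (SOME r. pullback_assignment X f w r)"
    using P unfolding pullback_assignment_def nerve_map_over_def by blast
  show "\<forall>s. shape_map X Y y0 f s w = pi1_map (realization (nerve (fst w)))
      (simplicial_realization (SOME r. pullback_assignment X f w r)) (s ?v)"
    using w by (simp add: shape_map_def)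
qed

lemma pullback_cover_refines:
  assumes "pointed_refines w' w"
  shows "pointed_refines (pullback_cover X f w') (pullback_cover X f w)"
  unfolding pointed_refines_def cover_refines_def
proof (intro conjI ballI)
  fix V assume "V \<in> fst (pullback_cover X f w')"
  then obtain W' where W': "W' \<in> fst w'" "V = {x \<in> topspace X. f x \<in> W'}" "V \<noteq> {}"
    by (auto simp: pullback_cover_def)
  then obtain W where W: "W \<in> fst w" "W' \<subseteq> W"
    using assms unfolding pointed_refines_def cover_refines_def by blast
  then show "\<exists>U\<in>fst (pullback_cover X f w). V \<subseteq> U"
    using W' by (intro bexI[of _ "{x \<in> topspace X. f x \<in> W}"]) (auto simp: pullback_cover_def)
next
  show "snd (pullback_cover X f w') \<subseteq> snd (pullback_cover X f w)"
    using assms by (auto simp: pullback_cover_def pointed_refines_def)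
qed

text \<open>Each component is a homomorphism by construction. Coherence asks for a square of
  pullback and bonding maps to commute; the chosen vertex maps themselves need not commute, but both
  composites lie over \<open>f\<close>.\<close>

lemma shape_map_hom:
  assumes f: "continuous_map X Y f" "f x0 = y0" and x0: "x0 \<in> topspace X"
  shows "shape_map X Y y0 f \<in> hom (shape_group X x0) (shape_group Y y0)"
proof (rule homI)
  let ?v = "pullback_cover X f"
  have ix: "?v w \<in> shape_index X x0" if "w \<in> shape_index Y y0" for w
    by (rule pullback_cover_in_shape_index[OF f x0 that])
  have hom: "\<exists>h\<in>hom (nerve_pi1 (?v w)) (nerve_pi1 w). \<forall>s. shape_map X Y y0 f s w = h (s (?v w))"
    if w: "w \<in> shape_index Y y0" for w
  proof -
    obtain r where r: "nerve_map_over f (fst (?v w)) (fst w) r" "r (snd (?v w)) = snd w"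
      "\<forall>s. shape_map X Y y0 f s w = pi1_map (realization (nerve (fst w))) (simplicial_realization r) (s (?v w))"
      by (rule pullback_nerve_map[OF f x0 w])
    show ?thesis using r(3) nerve_map_hom[OF r(1,2)] by blast
  qed
  fix s assume s: "s \<in> carrier (shape_group X x0)"
  then have sc: "s u \<in> carrier (nerve_pi1 u)" if "u \<in> shape_index X x0" for u
    using that by (auto simp: shape_threads_def)
  have "bonding_map w w' (shape_map X Y y0 f s w') = shape_map X Y y0 f s w"
    if w: "w \<in> shape_index Y y0" "w' \<in> shape_index Y y0" "pointed_refines w' w" for w w'
  proof -
    let ?N = "realization (nerve (fst w))"
    note ref = pullback_cover_refines[OF w(3), of X f]
    obtain r where r: "nerve_map_over f (fst (?v w)) (fst w) r" "r (snd (?v w)) = snd w"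
      "\<forall>s. shape_map X Y y0 f s w = pi1_map ?N (simplicial_realization r) (s (?v w))"
      by (rule pullback_nerve_map[OF f x0 w(1)])
    obtain r' where r': "nerve_map_over f (fst (?v w')) (fst w') r'" "r' (snd (?v w')) = snd w'"
      "\<forall>s. shape_map X Y y0 f s w' =
        pi1_map (realization (nerve (fst w'))) (simplicial_realization r') (s (?v w'))"
      by (rule pullback_nerve_map[OF f x0 w(2)])
    obtain b where b: "nerve_map_over id (fst w') (fst w) b" "b (snd w') = snd w"
      "bonding_map w w' = pi1_map ?N (simplicial_realization b)"
      by (rule bonding_map_nerve_map[OF w(3,1)])
    obtain b' where b': "nerve_map_over id (fst (?v w')) (fst (?v w)) b'" "b' (snd (?v w')) = snd (?v w)"
      "bonding_map (?v w) (?v w') = pi1_map (realization (nerve (fst (?v w)))) (simplicial_realization b')"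
      by (rule bonding_map_nerve_map[OF ref ix[OF w(1)]])
    obtain \<gamma> where \<gamma>: "pathin (realization (nerve (fst (?v w')))) \<gamma>"
      "\<gamma> 0 = vertex_point (snd (?v w'))" "\<gamma> 1 = vertex_point (snd (?v w'))"
      "s (?v w') = path_class (realization (nerve (fst (?v w')))) \<gamma>"
      using sc[OF ix[OF w(2)]] unfolding nerve_pi1_def by (rule fundamental_group_carrierE)
    note c = continuous_map_nerve_map[OF r(1)] continuous_map_nerve_map[OF r'(1)]
      continuous_map_nerve_map[OF b(1)] continuous_map_nerve_map[OF b'(1)]
    have over: "f x \<in> U" if t: "\<And>W. t W \<noteq> 0 \<Longrightarrow> W \<in> fst (?v w') \<and> x \<in> W"
      and U: "(simplicial_realization b \<circ> simplicial_realization r') t U \<noteq> 0" for t x U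
    proof -
      have "W \<in> fst w' \<and> f x \<in> W" if "simplicial_realization r' t W \<noteq> 0" for W
      proof
        show "f x \<in> W" by (rule simplicial_realization_over[OF r'(1) t that])
        show "W \<in> fst w'"
          using vertex_support_simplicial_realization[of r' t] that t r'(1)
          unfolding nerve_map_over_def by blast
      qed
      from simplicial_realization_over[OF b(1) this, where U=U] U show ?thesis by simp
    qed
    have over': "f x \<in> U" if t: "\<And>W. t W \<noteq> 0 \<Longrightarrow> W \<in> fst (?v w') \<and> x \<in> W"
      and U: "(simplicial_realization r \<circ> simplicial_realization b') t U \<noteq> 0" for t x U
    proof -
      have "W \<in> fst (?v w) \<and> x \<in> W" if "simplicial_realization b' t W \<noteq> 0" for W
      proof
        show "x \<in> W" using simplicial_realization_over[OF b'(1) t that] by simp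
        show "W \<in> fst (?v w)"
          using vertex_support_simplicial_realization[of b' t] that t b'(1)
          unfolding nerve_map_over_def by blast
      qed
      from simplicial_realization_over[OF r(1) this, where U=U] U show ?thesis by simp
    qed
    have "bonding_map w w' (shape_map X Y y0 f s w') =
        path_class ?N ((simplicial_realization b \<circ> simplicial_realization r') \<circ> \<gamma>)"
      using \<gamma>(1) c by (simp add: b(3) r'(3) \<gamma>(4) pi1_map_path_class pathin_compose comp_assoc)
    \<comment> \<open>The exchange of the two ways round the square. Both send the distinguished
      vertex to \<open>snd w\<close>, so the homotopy fixes the ends.\<close>
    also have "\<dots> = path_class ?N ((simplicial_realization r \<circ> simplicial_realization b') \<circ> \<gamma>)"
      by (rule path_class_eqI, rule nerve_maps_homotopic[OF \<gamma>(1) _ _ over over'])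
        (use c in \<open>auto simp: \<gamma> r(2) r'(2) b(2) b'(2) intro: continuous_map_compose\<close>)
    also have "\<dots> = pi1_map ?N (simplicial_realization r) (bonding_map (?v w) (?v w') (s (?v w')))"
      using \<gamma>(1) c by (simp add: b'(3) \<gamma>(4) pi1_map_path_class pathin_compose comp_assoc)
    also have "bonding_map (?v w) (?v w') (s (?v w')) = s (?v w)"
      using s ix w ref by (simp add: shape_threads_def)
    finally show ?thesis by (simp add: r(3))
  qed
  moreover have "shape_map X Y y0 f s w \<in> carrier (nerve_pi1 w)" if w: "w \<in> shape_index Y y0" for w
    using hom[OF w] sc[OF ix[OF w]] by (auto dest: hom_in_carrier)
  then have "shape_map X Y y0 f s \<in> (\<Pi>\<^sub>E w\<in>shape_index Y y0. carrier (nerve_pi1 w))"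
    by (auto simp: shape_map_def)
  ultimately show "shape_map X Y y0 f s \<in> carrier (shape_group Y y0)"
    by (simp add: shape_threads_def)
  fix t assume t: "t \<in> carrier (shape_group X x0)"
  then have tc: "t u \<in> carrier (nerve_pi1 u)" if "u \<in> shape_index X x0" for u
    using that by (auto simp: shape_threads_def)
  show "shape_map X Y y0 f (s \<otimes>\<^bsub>shape_group X x0\<^esub> t) =
      shape_map X Y y0 f s \<otimes>\<^bsub>shape_group Y y0\<^esub> shape_map X Y y0 f t"
  proof
    fix w
    show "shape_map X Y y0 f (s \<otimes>\<^bsub>shape_group X x0\<^esub> t) w =
      (shape_map X Y y0 f s \<otimes>\<^bsub>shape_group Y y0\<^esub> shape_map X Y y0 f t) w"
    proof (cases "w \<in> shape_index Y y0")
      case True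
      obtain h where h: "h \<in> hom (nerve_pi1 (?v w)) (nerve_pi1 w)"
        "\<forall>s. shape_map X Y y0 f s w = h (s (?v w))" using hom[OF True] by blast
      show ?thesis
        using hom_mult[OF h(1) sc[OF ix[OF True]] tc[OF ix[OF True]]] True ix[OF True]
        by (simp add: h(2) mult_shape_group)
    qed (simp add: shape_map_def mult_shape_group)
  qed
qed

lemma shape_map_shape_hom:
  assumes f: "continuous_map X Y f" "f x0 = y0" and x0: "x0 \<in> topspace X"
    and a: "a \<in> carrier (fundamental_group X x0)"
  shows "shape_map X Y y0 f (shape_hom X x0 a) = shape_hom Y y0 (pi1_map Y f a)"
proof
  fix w
  show "shape_map X Y y0 f (shape_hom X x0 a) w = shape_hom Y y0 (pi1_map Y f a) w"
  proof (cases "w \<in> shape_index Y y0")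
    case True
    obtain r where r: "nerve_map_over f (fst (pullback_cover X f w)) (fst w) r"
      "r (snd (pullback_cover X f w)) = snd w"
      "\<forall>s. shape_map X Y y0 f s w = pi1_map (realization (nerve (fst w)))
        (simplicial_realization r) (s (pullback_cover X f w))"
      by (rule pullback_nerve_map[OF f x0 True])
    show ?thesis
      unfolding r(3)[rule_format]
      by (rule shape_hom_compatible[OF True pullback_cover_in_shape_index[OF f x0 True] f r(1,2) a])
  qed (simp add: shape_map_def shape_hom_def)
qed

section \<open>Spanier groups\<close>

lemma path_reverse_concat:
  assumes "p 1 = q 0"
  shows "path_reverse (path_concat p q) = path_concat (path_reverse q) (path_reverse p)"
proof
  fix t :: real
  consider "t < 1/2" | "t = 1/2" | "1/2 < t" by linarith
  then show "path_reverse (path_concat p q) t = path_concat (path_reverse q) (path_reverse p) t"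
  proof cases
    case 1
    moreover have "2 * (1 - t) - 1 = 1 - 2 * t" by simp
    ultimately show ?thesis by (simp add: path_reverse_def path_concat_def)
  next
    case 2
    \<comment> \<open>At time 1/2 both concatenations evaluate their first path, \<open>q\<close>
      reversed on one side and \<open>p\<close> on the other, so the matching ends are
      needed.\<close>
    show ?thesis unfolding 2 using assms by (simp add: path_reverse_def path_concat_def)
  next
    case 3
    moreover have "2 * (1 - t) = 1 - (2 * t - 1)" by simp
    ultimately show ?thesis by (simp add: path_reverse_def path_concat_def)
  qed
qed

lemma spanier_generators_subset_carrier:
  "spanier_generators X x0 \<U> \<subseteq> carrier (fundamental_group X x0)"
  unfolding spanier_generators_def
  by (auto simp: loops_at_def intro!: path_class_in_carrier pathin_concat pathin_reverse)

text \<open>Conjugating a generator with path \<alpha> by a loop \<beta> yields the generator with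
  path \<open>path_concat \<beta> \<alpha>\<close> and the same small loop, so the generating set is
  closed under conjugation.\<close>

lemma spanier_cover_group_normal:
  assumes x0: "x0 \<in> topspace X"
  shows "spanier_cover_group X x0 \<U> \<lhd> fundamental_group X x0"
  unfolding spanier_cover_group_def
proof (rule group.normal_generateI[OF group_fundamental_group[OF x0] spanier_generators_subset_carrier])
  fix h g assume h: "h \<in> spanier_generators X x0 \<U>" and g: "g \<in> carrier (fundamental_group X x0)"
  obtain \<alpha> \<gamma> where \<alpha>: "pathin X \<alpha>" "\<alpha> 0 = x0" and \<gamma>: "pathin X \<gamma>" "\<gamma> 0 = \<alpha> 1" "\<gamma> 1 = \<alpha> 1"
    "\<exists>U\<in>\<U>. \<gamma> ` {0..1} \<subseteq> U"
    and heq: "h = path_class X (path_concat (path_concat \<alpha> \<gamma>) (path_reverse \<alpha>))"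
    using h unfolding spanier_generators_def loops_at_def by blast
  obtain \<beta> where \<beta>: "pathin X \<beta>" "\<beta> 0 = x0" "\<beta> 1 = x0" "g = path_class X \<beta>"
    using g by (rule fundamental_group_carrierE)
  let ?\<delta> = "path_concat \<alpha> \<gamma>" and ?\<alpha>' = "path_reverse \<alpha>" and ?\<beta>' = "path_reverse \<beta>"
  note paths = \<alpha>(1) \<beta>(1) \<gamma>(1) pathin_reverse[OF \<alpha>(1)] pathin_reverse[OF \<beta>(1)]
  have \<delta>: "pathin X ?\<delta>" using \<alpha> \<gamma> by (simp add: pathin_concat)
  have "homotopic_rel_ends X (path_concat (path_concat \<beta> (path_concat ?\<delta> ?\<alpha>')) ?\<beta>')
      (path_concat (path_concat (path_concat \<beta> ?\<delta>) ?\<alpha>') ?\<beta>')"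
    by (intro homotopic_rel_ends_concat homotopic_rel_ends_sym[OF homotopic_rel_ends_assoc]
        homotopic_rel_ends_refl) (use paths \<delta> \<alpha> \<beta> \<gamma> in auto)
  also have "homotopic_rel_ends X \<dots> (path_concat (path_concat \<beta> ?\<delta>) (path_concat ?\<alpha>' ?\<beta>'))"
    by (rule homotopic_rel_ends_assoc) (use paths \<delta> \<alpha> \<beta> \<gamma> in \<open>auto simp: pathin_concat\<close>)
  also have "path_concat ?\<alpha>' ?\<beta>' = path_reverse (path_concat \<beta> \<alpha>)"
    using \<alpha> \<beta> by (simp add: path_reverse_concat)
  also have "homotopic_rel_ends X (path_concat (path_concat \<beta> ?\<delta>) (path_reverse (path_concat \<beta> \<alpha>)))
      (path_concat (path_concat (path_concat \<beta> \<alpha>) \<gamma>) (path_reverse (path_concat \<beta> \<alpha>)))"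
    by (intro homotopic_rel_ends_concat homotopic_rel_ends_sym[OF homotopic_rel_ends_assoc]
        homotopic_rel_ends_refl) (use paths \<alpha> \<beta> \<gamma> in \<open>auto simp: pathin_concat pathin_reverse\<close>)
  finally have "g \<otimes>\<^bsub>fundamental_group X x0\<^esub> h \<otimes>\<^bsub>fundamental_group X x0\<^esub> inv\<^bsub>fundamental_group X x0\<^esub> g =
      path_class X (path_concat (path_concat (path_concat \<beta> \<alpha>) \<gamma>) (path_reverse (path_concat \<beta> \<alpha>)))"
    using paths \<delta> \<alpha> \<beta> \<gamma>
    by (simp add: heq inv_path_class fundamental_group_mult pathin_concat path_class_eqI)
  moreover have "pathin X (path_concat \<beta> \<alpha>)" "path_concat \<beta> \<alpha> 0 = x0"
    "\<gamma> \<in> loops_at X (path_concat \<beta> \<alpha> 1)"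
    using \<alpha> \<beta> \<gamma> by (auto simp: pathin_concat loops_at_def)
  ultimately show "g \<otimes>\<^bsub>fundamental_group X x0\<^esub> h \<otimes>\<^bsub>fundamental_group X x0\<^esub> inv\<^bsub>fundamental_group X x0\<^esub> g
      \<in> spanier_generators X x0 \<U>"
    using \<gamma>(4) unfolding spanier_generators_def by blast
qed

text \<open>Turns an arbitrary path into a loop at the basepoint by the connecting paths
  \<open>c\<close>. It is the usual multiplicative map from the fundamental groupoid to the
  fundamental group.\<close>

definition based_class :: "'a topology \<Rightarrow> ('a \<Rightarrow> real \<Rightarrow> 'a) \<Rightarrow> (real \<Rightarrow> 'a) \<Rightarrow> (real \<Rightarrow> 'a) set" where
  "based_class X c p = path_class X (path_concat (c (p 0)) (path_concat p (path_reverse (c (p 1)))))"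

text \<open>The connecting path to \<open>x0\<close> is constant so that a loop at \<open>x0\<close>
  is sent to its own class.\<close>

definition base_paths :: "'a topology \<Rightarrow> 'a \<Rightarrow> ('a \<Rightarrow> real \<Rightarrow> 'a) \<Rightarrow> bool" where
  "base_paths X x0 c \<longleftrightarrow> (\<forall>x\<in>topspace X. pathin X (c x) \<and> c x 0 = x0 \<and> c x 1 = x) \<and> c x0 = (\<lambda>_. x0)"

lemma base_paths_exist:
  assumes "path_connected_space X" "x0 \<in> topspace X"
  obtains c where "base_paths X x0 c"
proof -
  have "\<forall>x\<in>topspace X. \<exists>p. pathin X p \<and> p 0 = x0 \<and> p 1 = x"
    using assms unfolding path_connected_space_def by blast
  then obtain c where "\<forall>x\<in>topspace X. pathin X (c x) \<and> c x 0 = x0 \<and> c x 1 = x"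
    using bchoice[of "topspace X" "\<lambda>x p. pathin X p \<and> p 0 = x0 \<and> p 1 = x"] by blast
  then have "base_paths X x0 (c(x0 := (\<lambda>_. x0)))"
    using assms(2) by (auto simp: base_paths_def)
  then show thesis by (rule that)
qed

lemma base_pathsD:
  assumes "base_paths X x0 c" "pathin X p" "t \<in> {0..1}"
  shows "pathin X (c (p t))" "c (p t) 0 = x0" "c (p t) 1 = p t"
    "pathin X (path_reverse (c (p t)))"
  using assms pathin_in_topspace[OF assms(2,3)] by (auto simp: base_paths_def intro: pathin_reverse)

lemma based_class_carrier:
  assumes c: "base_paths X x0 c" and p: "pathin X p"
  shows "based_class X c p \<in> carrier (fundamental_group X x0)"
  using base_pathsD[OF c p, of 0] base_pathsD[OF c p, of 1] p
  unfolding based_class_def by (intro path_class_in_carrier) (auto intro!: pathin_concat)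

lemma based_class_homotopic:
  assumes c: "base_paths X x0 c" and pq: "homotopic_rel_ends X p q"
  shows "based_class X c p = based_class X c q"
proof -
  note e = homotopic_rel_endsD[OF pq]
  show ?thesis
    unfolding based_class_def e(3,4)
    using base_pathsD[OF c e(1), of 0] base_pathsD[OF c e(1), of 1]
    by (intro path_class_eqI homotopic_rel_ends_concat homotopic_rel_ends_refl pq) auto
qed

text \<open>The return along \<open>c (p 1)\<close> cancels against the departure along
  \<open>c (q 0)\<close>, which is the same path.\<close>

lemma based_class_concat:
  assumes c: "base_paths X x0 c" and p: "pathin X p" and q: "pathin X q" and pq: "p 1 = q 0"
  shows "based_class X c (path_concat p q) =
    based_class X c p \<otimes>\<^bsub>fundamental_group X x0\<^esub> based_class X c q"
proof -
  let ?P = "c (p 0)" and ?Q = "c (q 0)" and ?R = "path_reverse (c (q 1))"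
  let ?Q' = "path_reverse ?Q"
  note P = base_pathsD[OF c p, of 0, simplified] and Q = base_pathsD[OF c q, of 0, simplified]
    and R = base_pathsD[OF c q, of 1, simplified]
  let ?s = "path_concat q ?R"
  have s: "pathin X ?s" "?s 0 = q 0" "?s 1 = x0" using q R by (auto simp: pathin_concat)
  have "homotopic_rel_ends X (path_concat ?Q' (path_concat ?Q ?s)) (path_concat (path_concat ?Q' ?Q) ?s)"
    by (rule homotopic_rel_ends_sym[OF homotopic_rel_ends_assoc]) (use Q s in auto)
  also have "homotopic_rel_ends X \<dots> (path_concat (\<lambda>_. q 0) ?s)"
    by (intro homotopic_rel_ends_concat homotopic_rel_ends_refl)
      (use Q s homotopic_rel_ends_inverse_left[OF Q(1)] in auto)
  also have "homotopic_rel_ends X \<dots> ?s"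
    using homotopic_rel_ends_const_left[OF s(1)] s by simp
  finally have cancel: "homotopic_rel_ends X (path_concat ?Q' (path_concat ?Q ?s)) ?s" .
  have "homotopic_rel_ends X (path_concat (path_concat ?P (path_concat p ?Q')) (path_concat ?Q ?s))
      (path_concat ?P (path_concat (path_concat p ?Q') (path_concat ?Q ?s)))"
    by (rule homotopic_rel_ends_assoc) (use P Q s p pq in \<open>auto simp: pathin_concat\<close>)
  also have "homotopic_rel_ends X \<dots> (path_concat ?P (path_concat p (path_concat ?Q' (path_concat ?Q ?s))))"
    by (intro homotopic_rel_ends_concat homotopic_rel_ends_refl homotopic_rel_ends_assoc)
      (use P Q s p pq in \<open>auto simp: pathin_concat\<close>)
  also have "homotopic_rel_ends X \<dots> (path_concat ?P (path_concat p ?s))"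
    by (intro homotopic_rel_ends_concat homotopic_rel_ends_refl cancel)
      (use P Q s p pq in \<open>auto simp: pathin_concat\<close>)
  also have "homotopic_rel_ends X \<dots> (path_concat ?P (path_concat (path_concat p q) ?R))"
    by (intro homotopic_rel_ends_concat homotopic_rel_ends_refl homotopic_rel_ends_sym[OF homotopic_rel_ends_assoc])
      (use P Q R s p q pq in \<open>auto simp: pathin_concat\<close>)
  finally have "path_class X (path_concat ?P (path_concat (path_concat p q) ?R)) =
      path_class X (path_concat (path_concat ?P (path_concat p ?Q')) (path_concat ?Q ?s))"
    by (rule path_class_eqI[symmetric])
  then show ?thesis
    unfolding based_class_def using P Q R s p q pq
    by (simp add: fundamental_group_mult pathin_concat)
qed

lemma based_class_const:
  assumes c: "base_paths X x0 c" and x: "x \<in> topspace X"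
  shows "based_class X c (\<lambda>_. x) = \<one>\<^bsub>fundamental_group X x0\<^esub>"
proof -
  have P: "pathin X (c x)" "c x 0 = x0" "c x 1 = x" using c x by (auto simp: base_paths_def)
  have "homotopic_rel_ends X (path_concat (c x) (path_concat (\<lambda>_. x) (path_reverse (c x))))
      (path_concat (c x) (path_reverse (c x)))"
    by (intro homotopic_rel_ends_concat homotopic_rel_ends_refl)
      (use P homotopic_rel_ends_const_left[OF pathin_reverse[OF P(1)]] in auto)
  also have "homotopic_rel_ends X \<dots> (\<lambda>_. x0)"
    using homotopic_rel_ends_inverse_right[OF P(1)] P by simp
  finally show ?thesis
    by (simp add: based_class_def fundamental_group_one path_class_eqI)
qed

lemma based_class_loop:
  assumes c: "base_paths X x0 c" and p: "pathin X p" "p 0 = x0" "p 1 = x0"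
  shows "based_class X c p = path_class X p"
proof -
  have x0: "x0 \<in> topspace X" using pathin_in_topspace[OF p(1), of 0] p by simp
  have cx: "c x0 = (\<lambda>_. x0)" "path_reverse (\<lambda>_. x0) = (\<lambda>_. x0)"
    using c by (auto simp: base_paths_def path_reverse_def)
  have "homotopic_rel_ends X (path_concat (\<lambda>_. x0) (path_concat p (\<lambda>_. x0))) (path_concat p (\<lambda>_. x0))"
    using homotopic_rel_ends_const_left[OF pathin_concat[OF p(1), of "\<lambda>_. x0"]] p x0 by simp
  also have "homotopic_rel_ends X \<dots> p"
    using homotopic_rel_ends_const_right[OF p(1)] p by simp
  finally show ?thesis using p cx by (simp add: based_class_def path_class_eqI)
qed

text \<open>The loop that follows \<open>p\<close> and returns along \<open>q\<close> stays in
  \<open>U\<close>, so its based class is a generator of the Spanier group of the cover. The classes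
  of \<open>p\<close> and \<open>q\<close> differ by this factor on the left, which the coset
  absorbs.\<close>

lemma based_class_small:
  assumes c: "base_paths X x0 c" and p: "pathin X p" and q: "pathin X q"
    and ends: "p 0 = q 0" "p 1 = q 1" and U: "U \<in> \<U>" "p ` {0..1} \<subseteq> U" "q ` {0..1} \<subseteq> U"
  shows "spanier_cover_group X x0 \<U> #>\<^bsub>fundamental_group X x0\<^esub> based_class X c p =
    spanier_cover_group X x0 \<U> #>\<^bsub>fundamental_group X x0\<^esub> based_class X c q"
proof -
  let ?G = "fundamental_group X x0" and ?H = "spanier_cover_group X x0 \<U>"
  have x0: "x0 \<in> topspace X" using c pathin_in_topspace[OF p, of 0]
    unfolding base_paths_def by (metis atLeastAtMost_iff order_refl pathin_in_topspace zero_le_one)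
  interpret G: group ?G by (rule group_fundamental_group[OF x0])
  interpret H: normal ?H ?G by (rule spanier_cover_group_normal[OF x0])
  let ?\<gamma> = "path_concat p (path_reverse q)"
  have q': "pathin X (path_reverse q)" by (rule pathin_reverse[OF q])
  have \<gamma>: "pathin X ?\<gamma>" using p q' ends by (simp add: pathin_concat)
  note P = base_pathsD[OF c p, of 0, simplified]
  note car = based_class_carrier[OF c]
  have "homotopic_rel_ends X (path_concat (path_concat (c (p 0)) ?\<gamma>) (path_reverse (c (p 0))))
      (path_concat (c (p 0)) (path_concat ?\<gamma> (path_reverse (c (p 0)))))"
    by (rule homotopic_rel_ends_assoc) (use P \<gamma> ends in auto)
  then have "based_class X c ?\<gamma> = path_class X (path_concat (path_concat (c (p 0)) ?\<gamma>) (path_reverse (c (p 0))))"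
    using ends by (simp add: based_class_def path_class_eqI)
  moreover have "?\<gamma> ` {0..1} \<subseteq> U"
    using path_concat_image[of p "path_reverse q"] path_reverse_image[of q] U by blast
  moreover have "?\<gamma> \<in> loops_at X (c (p 0) 1)"
    using P \<gamma> ends by (simp add: loops_at_def)
  ultimately have "based_class X c ?\<gamma> \<in> spanier_generators X x0 \<U>"
    using P(1,2) U(1) unfolding spanier_generators_def by blast
  then have "based_class X c ?\<gamma> \<in> ?H"
    unfolding spanier_cover_group_def by (rule generate.incl)
  moreover have "based_class X c ?\<gamma> \<otimes>\<^bsub>?G\<^esub> based_class X c q = based_class X c p"
  proof -
    have "based_class X c (path_reverse q) \<otimes>\<^bsub>?G\<^esub> based_class X c q = based_class X c (path_concat (path_reverse q) q)"
      using based_class_concat[OF c q' q] by simp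
    also have "\<dots> = based_class X c (\<lambda>_. q 1)"
      by (rule based_class_homotopic[OF c homotopic_rel_ends_inverse_left[OF q]])
    also have "\<dots> = \<one>\<^bsub>?G\<^esub>"
      using pathin_in_topspace[OF q, of 1] by (intro based_class_const[OF c]) simp
    finally have "based_class X c (path_reverse q) \<otimes>\<^bsub>?G\<^esub> based_class X c q = \<one>\<^bsub>?G\<^esub>" .
    moreover have "based_class X c ?\<gamma> = based_class X c p \<otimes>\<^bsub>?G\<^esub> based_class X c (path_reverse q)"
      using based_class_concat[OF c p q'] ends by simp
    ultimately show ?thesis
      using car p q q' by (simp add: G.m_assoc)
  qed
  then have "?H #>\<^bsub>?G\<^esub> based_class X c p = ?H #>\<^bsub>?G\<^esub> based_class X c ?\<gamma> #>\<^bsub>?G\<^esub> based_class X c q"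
    using car p q \<gamma> by (simp add: G.coset_mult_assoc H.subset)
  ultimately show ?thesis
    using G.coset_join2[OF car[OF \<gamma>] H.is_subgroup] by simp
qed

section \<open>Subdividing paths and squares\<close>

primrec ordered_prod :: "('a, 'b) monoid_scheme \<Rightarrow> (nat \<Rightarrow> 'a) \<Rightarrow> nat \<Rightarrow> 'a" where
  "ordered_prod G f 0 = \<one>\<^bsub>G\<^esub>"
| "ordered_prod G f (Suc k) = ordered_prod G f k \<otimes>\<^bsub>G\<^esub> f k"

lemma (in group) ordered_prod_closed:
  "(\<And>i. i < k \<Longrightarrow> f i \<in> carrier G) \<Longrightarrow> ordered_prod G f k \<in> carrier G"
  by (induction k) auto

lemma (in group) ordered_prod_one:
  "(\<And>i. i < k \<Longrightarrow> f i = \<one>) \<Longrightarrow> ordered_prod G f k = \<one>"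
  by (induction k) auto

lemma (in group_hom) hom_ordered_prod:
  "(\<And>i. i < k \<Longrightarrow> f i \<in> carrier G) \<Longrightarrow> h (ordered_prod G f k) = ordered_prod H (\<lambda>i. h (f i)) k"
  by (induction k) (auto simp: G.ordered_prod_closed)

text \<open>The algebraic form of a null homotopy: commuting cells move the product of row 0 row by
  row up to row \<open>n\<close>, where all edges are trivial.\<close>

lemma (in group) commuting_grid:
  fixes E V :: "nat \<Rightarrow> nat \<Rightarrow> 'a"
  assumes E: "\<And>i j. i < n \<Longrightarrow> j \<le> n \<Longrightarrow> E i j \<in> carrier G"
    and V: "\<And>i j. i \<le> n \<Longrightarrow> j < n \<Longrightarrow> V i j \<in> carrier G"
    and cell: "\<And>i j. i < n \<Longrightarrow> j < n \<Longrightarrow> E i j \<otimes> V (Suc i) j = V i j \<otimes> E i (Suc j)"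
    and V0: "\<And>j. j < n \<Longrightarrow> V 0 j = \<one>" and Vn: "\<And>j. j < n \<Longrightarrow> V n j = \<one>"
    and En: "\<And>i. i < n \<Longrightarrow> E i n = \<one>"
  shows "ordered_prod G (\<lambda>i. E i 0) n = \<one>"
proof -
  \<comment> \<open>The invariant along a row: going right \<open>k\<close> steps and then up equals
    going up first, which costs nothing on the left side, and then right. One cell is used per
    step.\<close>
  have row: "ordered_prod G (\<lambda>i. E i j) k \<otimes> V k j = ordered_prod G (\<lambda>i. E i (Suc j)) k"
    if "j < n" "k \<le> n" for j k
    using that(2)
  proof (induction k)
    case (Suc k)
    have c: "ordered_prod G (\<lambda>i. E i j) k \<in> carrier G"
      using E Suc.prems \<open>j < n\<close> by (intro ordered_prod_closed) auto
    have "ordered_prod G (\<lambda>i. E i j) k \<otimes> E k j \<otimes> V (Suc k) j =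
        ordered_prod G (\<lambda>i. E i j) k \<otimes> (V k j \<otimes> E k (Suc j))"
      using c E V cell[of k j] Suc.prems \<open>j < n\<close> by (simp add: m_assoc)
    also have "\<dots> = ordered_prod G (\<lambda>i. E i j) k \<otimes> V k j \<otimes> E k (Suc j)"
      using c E V Suc.prems \<open>j < n\<close> by (simp add: m_assoc)
    finally show ?case using Suc by simp
  qed (use V0 that in auto)
  have "ordered_prod G (\<lambda>i. E i 0) n = ordered_prod G (\<lambda>i. E i j) n" if "j \<le> n" for j
    using that
  proof (induction j)
    case (Suc j)
    then have "ordered_prod G (\<lambda>i. E i j) n \<in> carrier G"
      using E by (intro ordered_prod_closed) auto
    then show ?case using Suc row[of j n] Vn[of j] by simp
  qed simp
  from this[of n] show ?thesis using ordered_prod_one[of n "\<lambda>i. E i n"] En by simp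
qed

section \<open>Segments of a path and grids on the square\<close>

definition path_segment :: "(real \<Rightarrow> 'a) \<Rightarrow> real \<Rightarrow> real \<Rightarrow> real \<Rightarrow> 'a" where
  "path_segment p a b = (\<lambda>t. p (a + (b - a) * t))"

lemma path_segment_ends [simp]: "path_segment p a b 0 = p a" "path_segment p a b 1 = p b"
  by (auto simp: path_segment_def)

lemma segment_param:
  fixes a b t :: real
  assumes "0 \<le> a" "a \<le> b" "b \<le> 1" "t \<in> {0..1}"
  shows "a + (b - a) * t \<in> {a..b}" 
proof -
  have "(b - a) * t \<le> (b - a) * 1" using assms by (intro mult_left_mono) auto
  then show ?thesis using assms by auto
qed

lemma path_segment_image:
  assumes "0 \<le> a" "a \<le> b" "b \<le> 1" "t \<in> {0..1}"
  shows "path_segment p a b t \<in> p ` {a..b}"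
  unfolding path_segment_def using segment_param[OF assms] by blast

lemma pathin_segment:
  assumes "pathin X p" "0 \<le> a" "a \<le> b" "b \<le> 1"
  shows "pathin X (path_segment p a b)"
  unfolding path_segment_def
proof (rule pathin_reparam[OF assms(1)])
  show "(\<lambda>t. a + (b - a) * t) ` {0..1} \<subseteq> {0..1}"
    using segment_param[OF assms(2-4)] assms(2-4) by fastforce
qed (auto intro!: continuous_intros)

text \<open>Both sides are reparametrizations of \<open>p\<close> itself.\<close>

lemma path_segment_concat:
  assumes p: "pathin X p" and ab: "0 \<le> a" "a \<le> b" "b \<le> c" "c \<le> 1"
  shows "homotopic_rel_ends X (path_concat (path_segment p a b) (path_segment p b c)) (path_segment p a c)"
proof -
  let ?g = "\<lambda>t. if t \<le> 1/2 then a + (b - a) * (2 * t) else b + (c - b) * (2 * t - 1)"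
  have "homotopic_rel_ends X (\<lambda>t. p (?g t)) (\<lambda>t. p (a + (c - a) * t))"
  proof (rule homotopic_rel_ends_reparam[OF p])
    show "continuous_on {0..1} ?g"
      by (rule continuous_on_if_half) (auto intro!: continuous_intros)
    show "?g ` {0..1} \<subseteq> {0..1}"
    proof (intro image_subsetI)
      fix t :: real assume t: "t \<in> {0..1}"
      show "?g t \<in> {0..1}"
      proof (cases "t \<le> 1/2")
        case True
        then show ?thesis using segment_param[of a b "2 * t"] ab t by auto
      next
        case False
        then show ?thesis using segment_param[of b c "2 * t - 1"] ab t by auto
      qed
    qed
    show "(\<lambda>t. a + (c - a) * t) ` {0..1} \<subseteq> {0..1}"
      using segment_param[of a c] ab by fastforce
  qed (auto intro!: continuous_intros)
  moreover have "path_concat (path_segment p a b) (path_segment p b c) = (\<lambda>t. p (?g t))"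
    by (auto simp: path_concat_def path_segment_def)
  ultimately show ?thesis by (simp add: path_segment_def)
qed

lemma based_class_subdivide:
  assumes c: "base_paths X x0 c" and p: "pathin X p" and n: "0 < n" and k: "k \<le> n"
  shows "based_class X c (path_segment p 0 (real k / real n)) =
    ordered_prod (fundamental_group X x0)
      (\<lambda>i. based_class X c (path_segment p (real i / real n) (real (Suc i) / real n))) k"
  using k
proof (induction k)
  case 0
  have "path_segment p 0 0 = (\<lambda>_. p 0)" by (simp add: path_segment_def)
  then show ?case using based_class_const[OF c pathin_in_topspace[OF p, of 0]] by simp
next
  case (Suc k)
  let ?a = "real k / real n" and ?b = "real (Suc k) / real n"
  have ab: "0 \<le> ?a" "?a \<le> ?b" "?b \<le> 1" using Suc.prems n by (auto simp: divide_right_mono)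
  have "based_class X c (path_segment p 0 ?b) =
      based_class X c (path_concat (path_segment p 0 ?a) (path_segment p ?a ?b))"
    by (rule based_class_homotopic[OF c homotopic_rel_ends_sym[OF path_segment_concat[OF p]]]) (use ab in auto)
  also have "\<dots> = based_class X c (path_segment p 0 ?a) \<otimes>\<^bsub>fundamental_group X x0\<^esub>
      based_class X c (path_segment p ?a ?b)"
    by (rule based_class_concat[OF c]) (use ab in \<open>auto intro!: pathin_segment[OF p]\<close>)
  finally show ?case using Suc by simp
qed

text \<open>The index \<open>i\<close> counts subintervals of path time and \<open>j\<close> those
  of the deformation parameter, hence \<open>j\<close> belongs to the first coordinate
  \<open>s\<close>.\<close>

lemma Lebesgue_grid:
  assumes h: "continuous_map (top_of_set ({0..1} \<times> {0..1})) Z h"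
    and C: "\<And>C. C \<in> \<C> \<Longrightarrow> openin Z C"
    and cov: "\<And>z. z \<in> {0..1::real} \<times> {0..1::real} \<Longrightarrow> \<exists>C\<in>\<C>. h z \<in> C"
  obtains n :: nat where "0 < n"
    "\<And>i j. i < n \<Longrightarrow> j < n \<Longrightarrow> \<exists>C\<in>\<C>. \<forall>s\<in>{real j / real n..real (Suc j) / real n}.
      \<forall>t\<in>{real i / real n..real (Suc i) / real n}. h (s, t) \<in> C"
proof -
  let ?Q = "{0..1::real} \<times> {0..1::real}"
  \<comment> \<open>Preimages are open only relative to the square; they are extended to open sets
    of the plane, as the Lebesgue number lemma requires.\<close>
  define \<O> where "\<O> = {B. open B \<and> (\<exists>C\<in>\<C>. \<forall>z\<in>?Q \<inter> B. h z \<in> C)}"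
  have "\<exists>B\<in>\<O>. z \<in> B" if z: "z \<in> ?Q" for z
  proof -
    obtain C' where C': "C' \<in> \<C>" "h z \<in> C'" using cov[OF z] by blast
    have "openin (top_of_set ?Q) {z \<in> ?Q. h z \<in> C'}"
      using openin_continuous_map_preimage[OF h C[OF C'(1)]] by simp
    then obtain B where B: "open B" "{z \<in> ?Q. h z \<in> C'} = ?Q \<inter> B"
      unfolding openin_open by blast
    have "B \<in> \<O>" unfolding \<O>_def using B C'(1) by blast
    then show ?thesis using z C'(2) B(2) by blast
  qed
  then have "?Q \<subseteq> \<Union>\<O>" by blast
  moreover have "\<O> \<noteq> {}"
    using \<open>?Q \<subseteq> \<Union>\<O>\<close> by force
  moreover have "compact ?Q" by (intro compact_Times compact_Icc)
  moreover have "open B" if "B \<in> \<O>" for B using that unfolding \<O>_def by blast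
  ultimately obtain \<delta> where \<delta>: "0 < \<delta>" "\<And>T. T \<subseteq> ?Q \<Longrightarrow> diameter T < \<delta> \<Longrightarrow> \<exists>B\<in>\<O>. T \<subseteq> B"
    using Lebesgue_number_lemma[of ?Q \<O>] by metis
  \<comment> \<open>A cell has sides of length \<open>1 / n\<close>, and the norm is at most the sum
    of the absolute coordinates, so its diameter is at most \<open>2 / n\<close>.\<close>
  obtain n :: nat where n: "0 < n" "2 / real n < \<delta>"
  proof -
    obtain n where "0 < n" "inverse (real n) < \<delta> / 2"
      using real_arch_inverse[of "\<delta> / 2"] \<delta>(1) by auto
    then show thesis using that[of n] by (simp add: field_simps)
  qed
  show thesis
  proof (rule that[OF n(1)])
    fix i j assume ij: "i < n" "j < n"
    let ?T = "{real j / real n..real (Suc j) / real n} \<times> {real i / real n..real (Suc i) / real n}"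
    have step: "real (Suc k) / real n = real k / real n + 1 / real n" for k by (simp add: add_divide_distrib)
    have le: "real (Suc k) / real n \<le> 1" if "k < n" for k using that by simp
    have sub: "{real k / real n..real (Suc k) / real n} \<subseteq> {0..1}" if "k < n" for k
      using le[OF that] by (subst atLeastatMost_subset_iff) simp
    have T: "?T \<subseteq> ?Q" using sub[OF ij(1)] sub[OF ij(2)] by (rule Sigma_mono[rotated])
    have "norm (x - y) \<le> 2 / real n" if "x \<in> ?T" "y \<in> ?T" for x y
    proof -
      have "\<bar>fst x - fst y\<bar> \<le> 1 / real n" "\<bar>snd x - snd y\<bar> \<le> 1 / real n"
        using that unfolding step by (auto simp: mem_Times_iff)
      moreover have "norm (x - y) \<le> \<bar>fst x - fst y\<bar> + \<bar>snd x - snd y\<bar>"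
        using norm_Pair_le[of "fst x - fst y" "snd x - snd y"] by (simp add: minus_prod_def)
      ultimately show ?thesis by simp
    qed
    then have "diameter ?T \<le> 2 / real n" by (intro diameter_le) auto
    then obtain B where "B \<in> \<O>" "?T \<subseteq> B" using \<delta>(2)[OF T] n(2) by auto
    then obtain C where C: "C \<in> \<C>" "\<forall>z\<in>?Q \<inter> B. h z \<in> C" unfolding \<O>_def by blast
    have "h (s, t) \<in> C" if "(s, t) \<in> ?T" for s t using that C(2) T \<open>?T \<subseteq> B\<close> by blast
    then show "\<exists>C\<in>\<C>. \<forall>s\<in>{real j / real n..real (Suc j) / real n}.
        \<forall>t\<in>{real i / real n..real (Suc i) / real n}. h (s, t) \<in> C"
      using C(1) by blast
  qed
qed

section \<open>The kernel of the canonical homomorphism\<close>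

lemma group_hom_based_quotient:
  assumes "x0 \<in> topspace X"
  shows "group_hom (fundamental_group X x0)
    (fundamental_group X x0 Mod spanier_cover_group X x0 \<U>)
    (\<lambda>a. spanier_cover_group X x0 \<U> #>\<^bsub>fundamental_group X x0\<^esub> a)"
proof -
  interpret normal "spanier_cover_group X x0 \<U>" "fundamental_group X x0"
    by (rule spanier_cover_group_normal[OF assms])
  show ?thesis
    using r_coset_hom_Mod factorgroup_is_group group_fundamental_group[OF assms]
    by (simp add: group_hom_def group_hom_axioms_def)
qed

lemma choice_on_pairs:
  assumes "\<forall>i j. Q i j \<longrightarrow> (\<exists>v. P i j v)"
  shows "\<exists>f. \<forall>i j. Q i j \<longrightarrow> P i j (f i j)"
  using assms by (intro exI[of _ "\<lambda>i j. SOME v. P i j v"]) (blast intro: someI_ex)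

text \<open>A null homotopy of \<open>p \<circ> \<alpha>\<close> is cut into a grid of cells each mapped into one open star
  \<open>St(V i j)\<close>. The vertices and edges of the grid are lifted to \<open>X\<close>, the bottom row to \<open>\<alpha>\<close> itself;
  the boundary of a lifted cell lies in a member of \<open>\<U>\<close>, hence is trivial modulo the Spanier group.\<close>

lemma null_homotopic_in_nerve_imp_spanier:
  assumes pc: "path_connected_space X"
    and S: "\<And>S. S \<in> \<S> \<Longrightarrow> path_connectedin X S"
    and star: "\<And>S. S \<in> \<S> \<Longrightarrow> \<exists>U\<in>\<U>. \<forall>T\<in>\<S>. S \<inter> T \<noteq> {} \<longrightarrow> T \<subseteq> U"
    and v: "v \<in> shape_index X x0" and ref: "cover_refines (fst v) \<S>"
    and p: "canonical_map X x0 v p"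
    and \<alpha>: "pathin X \<alpha>" "\<alpha> 0 = x0" "\<alpha> 1 = x0"
    and null: "homotopic_rel_ends (realization (nerve (fst v))) (p \<circ> \<alpha>) (\<lambda>_. vertex_point (snd v))"
  shows "path_class X \<alpha> \<in> spanier_cover_group X x0 \<U>"
proof -
  note vD = shape_indexD[OF v] and pD = canonical_mapD[OF p]
  let ?N = "realization (nerve (fst v))" and ?G = "fundamental_group X x0"
    and ?H = "spanier_cover_group X x0 \<U>" and ?v0 = "vertex_point (snd v)"
  have "\<forall>V\<in>fst v. \<exists>S. S \<in> \<S> \<and> V \<subseteq> S" using ref unfolding cover_refines_def by blast
  \<comment> \<open>Two covers cooperate: members \<open>V\<close> control the homotopy in the
    nerve, while the larger sets \<open>W V\<close> are path connected and have stars inside members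
    of \<open>\<U>\<close>.\<close>
  from bchoice[OF this] obtain W where W: "\<And>V. V \<in> fst v \<Longrightarrow> W V \<in> \<S> \<and> V \<subseteq> W V" by blast
  obtain h where h: "continuous_map (top_of_set ({0..1} \<times> {0..1})) ?N h"
    and h0: "\<And>t. t \<in> {0..1} \<Longrightarrow> h (0, t) = p (\<alpha> t)"
    and h1: "\<And>t. t \<in> {0..1} \<Longrightarrow> h (1, t) = ?v0 \<and> h (t, 0) = ?v0 \<and> h (t, 1) = ?v0"
    using null \<alpha> pD(2) unfolding homotopic_rel_ends_iff by auto
  have hN: "h z \<in> realization_set (nerve (fst v))" if "z \<in> {0..1} \<times> {0..1}" for z
    using continuous_map_image_subset_topspace[OF h] that by auto
  obtain n where n: "0 < n" and grid: "\<And>i j. i < n \<Longrightarrow> j < n \<Longrightarrow>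
      \<exists>C\<in>open_star (nerve (fst v)) ` fst v. \<forall>s\<in>{real j / real n..real (Suc j) / real n}.
        \<forall>t\<in>{real i / real n..real (Suc i) / real n}. h (s, t) \<in> C"
  proof (rule Lebesgue_grid[OF h, of "open_star (nerve (fst v)) ` fst v"])
    show "openin ?N C" if "C \<in> open_star (nerve (fst v)) ` fst v" for C
      using that openin_open_star by auto
    fix z :: "real \<times> real" assume "z \<in> {0..1} \<times> {0..1}"
    then have z: "h z \<in> realization_set (nerve (fst v))" by (rule hN)
    then obtain V where "V \<in> vertex_support (h z)"
      using realization_set_support[OF simplicial_complex_nerve] by (fastforce simp: nerve_def)
    then show "\<exists>C\<in>open_star (nerve (fst v)) ` fst v. h z \<in> C"
      using open_star_iff_support[OF z] realization_nerve_support(1)[OF z] by blast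
  qed blast
  define g where "g = (\<lambda>i j. h (real j / real n, real i / real n))"
  \<comment> \<open>For most cells only the corners matter, since the edges will be chosen freely.
    In the bottom row the whole lower edge is controlled, because there the lift is prescribed to be
    \<alpha>.\<close>
  have "\<forall>i j. i < n \<and> j < n \<longrightarrow> (\<exists>V. V \<in> fst v \<and>
      (\<forall>i'\<in>{i, Suc i}. \<forall>j'\<in>{j, Suc j}. g i' j' V \<noteq> 0) \<and>
      (j = 0 \<longrightarrow> (\<forall>t\<in>{real i / real n..real (Suc i) / real n}. p (\<alpha> t) V \<noteq> 0)))"
  proof (intro allI impI)
    fix i j assume "i < n \<and> j < n"
    then have ij: "i < n" "j < n" by auto
    obtain V where V: "V \<in> fst v" "\<forall>s\<in>{real j / real n..real (Suc j) / real n}.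
        \<forall>t\<in>{real i / real n..real (Suc i) / real n}. h (s, t) V > 0"
      using grid[OF ij] unfolding open_star_def by blast
    have le: "real k / real n \<le> real (Suc k) / real n" for k by (simp add: divide_right_mono)
    have "p (\<alpha> t) V > 0" if "j = 0" "t \<in> {real i / real n..real (Suc i) / real n}" for t
    proof -
      have "real (Suc i) / real n \<le> 1" "0 \<le> real i / real n" using ij by simp_all
      with that(2) have "t \<in> {0..1}" unfolding atLeastAtMost_iff by linarith
      then show ?thesis using V(2) that le[of 0] h0[of t] by force
    qed
    moreover have "g i' j' V > 0" if "i' \<in> {i, Suc i}" "j' \<in> {j, Suc j}" for i' j'
      using V(2) that le[of i] le[of j] by (auto simp: g_def)
    ultimately show "\<exists>V. V \<in> fst v \<and> (\<forall>i'\<in>{i, Suc i}. \<forall>j'\<in>{j, Suc j}. g i' j' V \<noteq> 0) \<and>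
      (j = 0 \<longrightarrow> (\<forall>t\<in>{real i / real n..real (Suc i) / real n}. p (\<alpha> t) V \<noteq> 0))"
      using V(1) by (intro exI[of _ V]) (auto simp: less_imp_neq[symmetric])
  qed
  from choice_on_pairs[OF this]
  obtain V where PV: "\<And>i j. i < n \<and> j < n \<Longrightarrow> V i j \<in> fst v \<and>
      (\<forall>i'\<in>{i, Suc i}. \<forall>j'\<in>{j, Suc j}. g i' j' (V i j) \<noteq> 0) \<and>
      (j = 0 \<longrightarrow> (\<forall>t\<in>{real i / real n..real (Suc i) / real n}. p (\<alpha> t) (V i j) \<noteq> 0))"
    by blast
  have V: "\<And>i j. i < n \<Longrightarrow> j < n \<Longrightarrow> V i j \<in> fst v"
    and gV: "\<And>i j i' j'. i < n \<Longrightarrow> j < n \<Longrightarrow> i' \<in> {i, Suc i} \<Longrightarrow> j' \<in> {j, Suc j} \<Longrightarrow> g i' j' (V i j) \<noteq> 0"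
    and pV: "\<And>i t. i < n \<Longrightarrow> t \<in> {real i / real n..real (Suc i) / real n} \<Longrightarrow> p (\<alpha> t) (V i 0) \<noteq> 0"
    using PV n by blast+
  \<comment> \<open>Lifted grid points: on the bottom row points of \<alpha>, on the other three
    sides the basepoint, inside any common point of the members in the support. The cases agree at
    the lower corners because \<alpha> is a loop at \<open>x0\<close>.\<close>
  define x where "x = (\<lambda>i j. if j = 0 then \<alpha> (real i / real n) else if i = 0 \<or> i = n \<or> j = n then x0
    else SOME x. \<forall>U\<in>vertex_support (g i j). x \<in> U)"
  have frac: "real k / real n \<in> {0..1}" if "k \<le> n" for k using that n by simp
  have gN: "g i j \<in> realization_set (nerve (fst v))" if "i \<le> n" "j \<le> n" for i j
    unfolding g_def by (rule hN) (use frac that in auto)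
  \<comment> \<open>The only property of the lifted points that is used: \<open>x i j\<close> lies
    in every member with nonzero coordinate at \<open>g i j\<close>, hence in the vertex chosen for
    each adjacent cell.\<close>
  have xU: "x i j \<in> U" if ij: "i \<le> n" "j \<le> n" and U: "g i j U \<noteq> 0" for i j U
  proof -
    consider "j = 0" | "0 < j" "i = 0 \<or> i = n \<or> j = n" | "0 < j" "\<not> (i = 0 \<or> i = n \<or> j = n)" by blast
    then show ?thesis
    proof cases
      case 1
      have "p (\<alpha> (real i / real n)) U \<noteq> 0" using U 1 h0[OF frac[OF ij(1)]] by (simp add: g_def)
      then show ?thesis
        using canonical_map_support[OF p pathin_in_topspace[OF \<alpha>(1) frac[OF ij(1)]]] 1 by (simp add: x_def)
    next
      case 2
      have "g i j = ?v0"
        using 2(2) h1[OF frac[OF ij(1)]] h1[OF frac[OF ij(2)]] n by (auto simp: g_def)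
      then have "U = snd v" using U by (auto simp: vertex_point_def split: if_splits)
      then show ?thesis using 2 vD(3) by (simp add: x_def)
    next
      case 3
      have "\<forall>U\<in>vertex_support (g i j). (SOME x. \<forall>U\<in>vertex_support (g i j). x \<in> U) \<in> U"
        by (rule someI_ex) (rule realization_nerve_support(3)[OF gN[OF ij]])
      then show ?thesis using 3 U by (simp add: x_def)
    qed
  qed
  have xV: "x i' j' \<in> V i j" if "i < n" "j < n" "i' \<in> {i, Suc i}" "j' \<in> {j, Suc j}" for i j i' j'
    using that by (intro xU gV) auto
  have bd: "x 0 j = x0" "x n j = x0" "x i n = x0" for i j
    using \<alpha> n by (auto simp: x_def)
  have WX: "W (V i j) \<subseteq> topspace X" if "i < n" "j < n" for i j
    using S W[OF V[OF that]] path_connectedin_subset_topspace by blast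
  have edge: "\<exists>e. pathin X e \<and> e 0 = a \<and> e 1 = b \<and> e ` {0..1} \<subseteq> W (V i j)"
    if "i < n" "j < n" "a \<in> V i j" "b \<in> V i j" for i j a b
  proof -
    have "path_connectedin X (W (V i j))" "a \<in> W (V i j)" "b \<in> W (V i j)"
      using W[OF V[OF that(1,2)]] S that by blast+
    then show ?thesis unfolding path_connectedin by blast
  qed
  \<comment> \<open>Each horizontal edge is placed in the set of the cell above it. The top row
    \<open>j = n\<close> has no such cell, and its edges are constant.\<close>
  have hor: "\<exists>e. pathin X e \<and> e 0 = x i j \<and> e 1 = x (Suc i) j \<and> (j < n \<longrightarrow> e ` {0..1} \<subseteq> W (V i j)) \<and>
      (j = 0 \<longrightarrow> e = path_segment \<alpha> (real i / real n) (real (Suc i) / real n)) \<and>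
      (j = n \<longrightarrow> e = (\<lambda>_. x0))" if "i < n \<and> j \<le> n" for i j
  proof -
    from that have ij: "i < n" "j \<le> n" by auto
    consider "j = 0" | "j = n" | "0 < j" "j < n" using ij by linarith
    then show ?thesis
    proof cases
      case 1
      let ?e = "path_segment \<alpha> (real i / real n) (real (Suc i) / real n)"
      have r: "0 \<le> real i / real n" "real i / real n \<le> real (Suc i) / real n" "real (Suc i) / real n \<le> 1"
        using ij n by (auto simp: divide_right_mono)
      have "?e t \<in> W (V i j)" if t: "t \<in> {0..1}" for t
      proof -
        obtain s where s: "s \<in> {real i / real n..real (Suc i) / real n}" "?e t = \<alpha> s"
          using path_segment_image[OF r t, of \<alpha>] by blast
        have "s \<in> {0..1}" using s(1) r unfolding atLeastAtMost_iff by linarith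
        then have "\<alpha> s \<in> topspace X" by (rule pathin_in_topspace[OF \<alpha>(1)])
        then have "\<alpha> s \<in> V i 0" using canonical_map_support[OF p _ pV[OF ij(1) s(1)]] by blast
        then show ?thesis using W[OF V[OF ij(1), of 0]] n 1 s(2) by auto
      qed
      then show ?thesis
        using 1 n r by (intro exI[of _ ?e]) (auto simp: x_def intro!: pathin_segment[OF \<alpha>(1)])
    next
      case 2
      then show ?thesis using n vD(4) bd by (intro exI[of _ "\<lambda>_. x0"]) auto
    next
      case 3
      have "x i j \<in> V i j" "x (Suc i) j \<in> V i j" using xV[OF ij(1) 3(2)] by simp_all
      from edge[OF ij(1) 3(2) this] show ?thesis using 3 by auto
    qed
  qed
  have "\<forall>i j. i < n \<and> j \<le> n \<longrightarrow> (\<exists>e. pathin X e \<and> e 0 = x i j \<and>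
      e 1 = x (Suc i) j \<and> (j < n \<longrightarrow> e ` {0..1} \<subseteq> W (V i j)) \<and>
      (j = 0 \<longrightarrow> e = path_segment \<alpha> (real i / real n) (real (Suc i) / real n)) \<and>
      (j = n \<longrightarrow> e = (\<lambda>_. x0)))"
    using hor by blast
  from choice_on_pairs[OF this]
  obtain E where PE: "\<And>i j. i < n \<and> j \<le> n \<Longrightarrow> pathin X (E i j) \<and> E i j 0 = x i j \<and>
      E i j 1 = x (Suc i) j \<and> (j < n \<longrightarrow> E i j ` {0..1} \<subseteq> W (V i j)) \<and>
      (j = 0 \<longrightarrow> E i j = path_segment \<alpha> (real i / real n) (real (Suc i) / real n)) \<and>
      (j = n \<longrightarrow> E i j = (\<lambda>_. x0))"
    by blast
  have E: "\<And>i j. i < n \<Longrightarrow> j \<le> n \<Longrightarrow>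
      pathin X (E i j) \<and> E i j 0 = x i j \<and> E i j 1 = x (Suc i) j"
    and EW: "\<And>i j. i < n \<Longrightarrow> j < n \<Longrightarrow> E i j ` {0..1} \<subseteq> W (V i j)"
    and E0: "\<And>i. i < n \<Longrightarrow> E i 0 = path_segment \<alpha> (real i / real n) (real (Suc i) / real n)"
    and En: "\<And>i. i < n \<Longrightarrow> E i n = (\<lambda>_. x0)"
    using PE PE[of _ 0] PE[of _ n] by simp_all
  \<comment> \<open>Each vertical edge is placed in the set of the cell to its right. Both outer
    columns are constant at \<open>x0\<close>; the column \<open>i = n\<close> has no cell to its
    right.\<close>
  have ver: "\<exists>e. pathin X e \<and> e 0 = x i j \<and> e 1 = x i (Suc j) \<and> (i < n \<longrightarrow> e ` {0..1} \<subseteq> W (V i j)) \<and>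
      (i = 0 \<or> i = n \<longrightarrow> e = (\<lambda>_. x0))" if ij: "i \<le> n \<and> j < n" for i j
  proof (cases "i = 0 \<or> i = n")
    case True
    have "x0 \<in> W (V 0 j)" using xV[of 0 j 0 j] W[OF V[of 0 j]] ij n bd by auto
    then show ?thesis using True vD(4) bd by (intro exI[of _ "\<lambda>_. x0"]) auto
  next
    case False
    then have i: "i < n" "j < n" using ij by auto
    have "x i j \<in> V i j" "x i (Suc j) \<in> V i j" using xV[OF i] by simp_all
    from edge[OF i this] show ?thesis using False by auto
  qed
  have "\<forall>i j. i \<le> n \<and> j < n \<longrightarrow> (\<exists>e. pathin X e \<and> e 0 = x i j \<and>
      e 1 = x i (Suc j) \<and> (i < n \<longrightarrow> e ` {0..1} \<subseteq> W (V i j)) \<and>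
      (i = 0 \<or> i = n \<longrightarrow> e = (\<lambda>_. x0)))"
    using ver by blast
  from choice_on_pairs[OF this]
  obtain F where PF: "\<And>i j. i \<le> n \<and> j < n \<Longrightarrow> pathin X (F i j) \<and> F i j 0 = x i j \<and>
      F i j 1 = x i (Suc j) \<and> (i < n \<longrightarrow> F i j ` {0..1} \<subseteq> W (V i j)) \<and>
      (i = 0 \<or> i = n \<longrightarrow> F i j = (\<lambda>_. x0))"
    by blast
  have F: "\<And>i j. i \<le> n \<Longrightarrow> j < n \<Longrightarrow>
      pathin X (F i j) \<and> F i j 0 = x i j \<and> F i j 1 = x i (Suc j)"
    and FW: "\<And>i j. i < n \<Longrightarrow> j < n \<Longrightarrow> F i j ` {0..1} \<subseteq> W (V i j)"
    and F0: "\<And>j. j < n \<Longrightarrow> F 0 j = (\<lambda>_. x0)" and Fn: "\<And>j. j < n \<Longrightarrow> F n j = (\<lambda>_. x0)"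
    using PF PF[of 0] PF[of n] by simp_all
  obtain c where c: "base_paths X x0 c" using base_paths_exist[OF pc vD(4)] by blast
  let ?\<psi> = "\<lambda>e. ?H #>\<^bsub>?G\<^esub> based_class X c e"
  interpret Q: group_hom ?G "?G Mod ?H" "\<lambda>a. ?H #>\<^bsub>?G\<^esub> a"
    by (rule group_hom_based_quotient[OF vD(4)])
  note car = based_class_carrier[OF c]
  have one: "?\<psi> (\<lambda>_. x0) = \<one>\<^bsub>?G Mod ?H\<^esub>"
    using based_class_const[OF c vD(4)] Q.hom_one by simp
  have mult: "?\<psi> (path_concat a b) = ?\<psi> a \<otimes>\<^bsub>?G Mod ?H\<^esub> ?\<psi> b"
    if "pathin X a" "pathin X b" "a 1 = b 0" for a b
    using based_class_concat[OF c that] Q.hom_mult[OF car car, OF that(1,2)] by simp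
  have "?\<psi> (E i j) \<otimes>\<^bsub>?G Mod ?H\<^esub> ?\<psi> (F (Suc i) j) = ?\<psi> (F i j) \<otimes>\<^bsub>?G Mod ?H\<^esub> ?\<psi> (E i (Suc j))"
    if ij: "i < n" "j < n" for i j
  proof -
    have WS: "W (V i j) \<in> \<S>" using W[OF V[OF ij]] by simp
    \<comment> \<open>The lower and left edges lie in \<open>W (V i j)\<close>. The right and upper
      edges lie in the sets of neighbouring cells, which meet \<open>W (V i j)\<close> in a corner,
      or are constant; so the member \<open>U\<close> containing the star holds the whole
      boundary.\<close>
    from star[OF this] obtain U where U: "U \<in> \<U>" "\<forall>T\<in>\<S>. W (V i j) \<inter> T \<noteq> {} \<longrightarrow> T \<subseteq> U" by blast
    have TU: "T \<subseteq> U" if "T \<in> \<S>" "y \<in> W (V i j)" "y \<in> T" for T y using U(2) that by blast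
    have xW: "x i' j' \<in> W (V i j)" if "i' \<in> {i, Suc i}" "j' \<in> {j, Suc j}" for i' j'
      using subsetD[OF conjunct2[OF W[OF V[OF ij]]] xV[OF ij that]] .
    have xW1: "x (Suc i) j \<in> W (V i j)" "x i (Suc j) \<in> W (V i j)" using xW by simp_all
    have WU: "W (V i j) \<subseteq> U" by (rule TU[OF WS xW1(1) xW1(1)])
    have FU: "F (Suc i) j ` {0..1} \<subseteq> U"
    proof (cases "Suc i < n")
      case True
      note W' = W[OF V[OF True ij(2)]]
      have "x (Suc i) j \<in> V (Suc i) j" using xV[OF True ij(2)] by simp
      then have "W (V (Suc i) j) \<subseteq> U" using TU[OF conjunct1[OF W'] xW1(1)] W' by blast
      then show ?thesis using FW[OF True ij(2)] by (rule subset_trans[rotated])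
    next
      case False
      then have "Suc i = n" using ij by simp
      then show ?thesis using Fn[OF ij(2)] subsetD[OF WU xW1(1)] bd(2)[of j] by auto
    qed
    have EU: "E i (Suc j) ` {0..1} \<subseteq> U"
    proof (cases "Suc j < n")
      case True
      note W' = W[OF V[OF ij(1) True]]
      have "x i (Suc j) \<in> V i (Suc j)" using xV[OF ij(1) True] by simp
      then have "W (V i (Suc j)) \<subseteq> U" using TU[OF conjunct1[OF W'] xW1(2)] W' by blast
      then show ?thesis using EW[OF ij(1) True] by (rule subset_trans[rotated])
    next
      case False
      then have "Suc j = n" using ij by simp
      then show ?thesis using En[OF ij(1)] subsetD[OF WU xW1(2)] bd(3)[of i] by auto
    qed
    note EU' = subset_trans[OF EW[OF ij] WU] and FU' = subset_trans[OF FW[OF ij] WU]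
    note img = subset_trans[OF path_concat_image Un_least[OF EU' FU]]
      subset_trans[OF path_concat_image Un_least[OF FU' EU]]
    have e: "pathin X (E i j) \<and> E i j 0 = x i j \<and> E i j 1 = x (Suc i) j"
      "pathin X (F (Suc i) j) \<and> F (Suc i) j 0 = x (Suc i) j \<and> F (Suc i) j 1 = x (Suc i) (Suc j)"
      "pathin X (F i j) \<and> F i j 0 = x i j \<and> F i j 1 = x i (Suc j)"
      "pathin X (E i (Suc j)) \<and> E i (Suc j) 0 = x i (Suc j) \<and> E i (Suc j) 1 = x (Suc i) (Suc j)"
      using E F ij by simp_all
    have "?\<psi> (path_concat (E i j) (F (Suc i) j)) = ?\<psi> (path_concat (F i j) (E i (Suc j)))"
      by (rule based_class_small[OF c _ _ _ _ U(1) img]) (use e in \<open>simp_all add: pathin_concat\<close>)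
    then show ?thesis using e by (simp add: mult)
  qed
  note cell = this
  \<comment> \<open>In the quotient the outer columns and the top row are trivial, so the bottom
    row, which is \<alpha> cut into segments, has trivial product.\<close>
  have "ordered_prod (?G Mod ?H) (\<lambda>i. ?\<psi> (E i 0)) n = \<one>\<^bsub>?G Mod ?H\<^esub>"
  proof (rule Q.H.commuting_grid[where E="\<lambda>i j. ?\<psi> (E i j)" and V="\<lambda>i j. ?\<psi> (F i j)", OF _ _ cell])
    show "?\<psi> (E i j) \<in> carrier (?G Mod ?H)" if "i < n" "j \<le> n" for i j
      using E[OF that] by (intro Q.hom_closed car) simp
    show "?\<psi> (F i j) \<in> carrier (?G Mod ?H)" if "i \<le> n" "j < n" for i j
      using F[OF that] by (intro Q.hom_closed car) simp
  qed (simp_all only: F0 Fn En one)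
  moreover have "ordered_prod (?G Mod ?H) (\<lambda>i. ?\<psi> (E i 0)) n =
      ?H #>\<^bsub>?G\<^esub> ordered_prod ?G (\<lambda>i. based_class X c (E i 0)) n"
    using E car by (intro Q.hom_ordered_prod[symmetric]) simp
  moreover have "ordered_prod ?G (\<lambda>i. based_class X c (E i 0)) n = based_class X c (path_segment \<alpha> 0 1)"
  proof -
    have "ordered_prod ?G (\<lambda>i. based_class X c (E i 0)) k = ordered_prod ?G
        (\<lambda>i. based_class X c (path_segment \<alpha> (real i / real n) (real (Suc i) / real n))) k"
      if "k \<le> n" for k using that by (induction k) (auto simp: E0)
    then show ?thesis using based_class_subdivide[OF c \<alpha>(1) n, of n] n by simp
  qed
  moreover have "path_segment \<alpha> 0 1 = \<alpha>" by (simp add: path_segment_def)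
  ultimately have "?H #>\<^bsub>?G\<^esub> path_class X \<alpha> = ?H"
    using based_class_loop[OF c \<alpha>] by (simp add: FactGroup_def)
  then show ?thesis
    by (rule group.coset_join1[OF group_fundamental_group[OF vD(4)] _ path_class_in_carrier[OF \<alpha>]
        normal_imp_subgroup[OF spanier_cover_group_normal[OF vD(4)]]])
qed

text \<open>The straight-line contraction of the star to \<open>v\<close> moves the basepoint. The
  segment \<open>c\<close> from \<open>q 0\<close> to \<open>v\<close> is therefore inserted: the
  loop becomes \<open>c\<close> followed by its reverse, and that cancels.\<close>

lemma loop_in_open_star_trivial:
  assumes K: "simplicial_complex K" and q: "pathin (realization K) q" and loop: "q 1 = q 0"
    and star: "\<And>t. t \<in> {0..1} \<Longrightarrow> q t \<in> open_star K v"
  shows "homotopic_rel_ends (realization K) q (\<lambda>_. q 0)"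
proof -
  let ?N = "realization K" and ?b = "q 0" and ?v = "vertex_point v"
  define c where "c = (\<lambda>t w. (1 - t) * ?b w + t * ?v w)"
  have r: "q t \<in> realization_set K" if "t \<in> {0..1}" for t using pathin_in_topspace[OF q that] by simp
  have v: "v \<in> vertex_support (q t)" if "t \<in> {0..1}" for t
    using star[OF that] open_star_iff_support[OF r[OF that]] by blast
  have b: "vertex_support ?b \<in> K" "?b \<in> realization_set K" "v \<in> vertex_support ?b"
    using realization_set_support[OF K r] r v by auto
  have fin: "finite (vertex_support ?b)" using b(1) K unfolding simplicial_complex_def by blast
  have cs: "vertex_support (c t) \<subseteq> vertex_support ?b" for t
    using b(3) by (auto simp: c_def vertex_point_def)
  have vs: "{v} \<in> K" by (rule simplicial_complex_face[OF K b(1), of _ v]) (use b(3) in simp_all)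
  have "pathin ?N c"
    unfolding pathin_def
  proof (rule continuous_map_into_finite_subcomplex[OF K _ _ fin cs])
    fix t assume "t \<in> topspace (top_of_set {0..1::real})"
    then have t: "0 \<le> t" "t \<le> 1" by auto
    have sums: "sum ?b (vertex_support ?b) = 1" "sum ?v (vertex_support ?b) = 1"
      using realization_set_sum[OF K b(2) fin] fin b(3) by (auto simp: closed_simplex_def vertex_point_def)
    have "sum (c t) (vertex_support ?b) = 1"
      unfolding c_def sum.distrib by (simp only: sums flip: sum_distrib_left) simp
    moreover have "0 \<le> c t w" for w
      using t realization_set_nonneg[OF b(2), of w] by (auto simp: c_def vertex_point_def)
    ultimately have "c t \<in> closed_simplex (vertex_support ?b)"
      using cs by (simp add: closed_simplex_def)
    then show "c t \<in> realization_set K" using b(1) by (auto simp: realization_set_def)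
  qed (auto simp: c_def intro!: continuous_intros)
  then have c: "pathin ?N c" "pathin ?N (path_reverse c)" by (auto intro: pathin_reverse)
  have c01 [simp]: "c 0 = ?b" "c 1 = ?v" by (auto simp: c_def)
  have top: "?b \<in> topspace ?N" "?v \<in> topspace ?N"
    using b(2) vertex_point_in_realization_set[OF vs] by auto
  \<comment> \<open>Padding with constants aligns the two paths: while \<open>?q2\<close> runs along
    \<open>c\<close> or back, \<open>?q1\<close> waits at \<open>q 0\<close>; while
    \<open>?q1\<close> runs through \<open>q\<close>, \<open>?q2\<close> waits at \<open>v\<close>.
    At every time both points lie in a common simplex.\<close>
  let ?q1 = "path_concat (\<lambda>_. ?b) (path_concat q (\<lambda>_. ?b))"
  let ?q2 = "path_concat c (path_concat (\<lambda>_. ?v) (path_reverse c))"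
  have "homotopic_rel_ends ?N (path_concat q (\<lambda>_. ?b)) q"
    using homotopic_rel_ends_const_right[OF q] loop by simp
  moreover have "homotopic_rel_ends ?N ?q1 (path_concat q (\<lambda>_. ?b))"
    using homotopic_rel_ends_const_left[OF homotopic_rel_endsD(1)[OF calculation]] by simp
  ultimately have "homotopic_rel_ends ?N q ?q1"
    by (blast intro: homotopic_rel_ends_sym homotopic_rel_ends_trans)
  also have "homotopic_rel_ends ?N ?q1 ?q2"
  proof (rule contiguous_paths_homotopic[OF K])
    fix t :: real assume t: "t \<in> {0..1}"
    have bK: "vertex_support ?b \<union> vertex_support (c s) \<in> K" for s
      using b(1) by (simp only: Un_absorb2[OF cs])
    consider "t \<le> 1/2" | "1/2 < t" "t \<le> 3/4" | "3/4 < t" by linarith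
    then show "vertex_support (?q1 t) \<union> vertex_support (?q2 t) \<in> K"
    proof cases
      case 1
      then have e: "?q1 t = ?b" "?q2 t = c (2 * t)" by (auto simp: path_concat_def)
      show ?thesis unfolding e by (rule bK)
    next
      case 2
      then have s: "?q1 t = q (2 * (2 * t - 1))" "?q2 t = ?v" "2 * (2 * t - 1) \<in> {0..1}"
        by (auto simp: path_concat_def)
      have "vertex_support (q (2 * (2 * t - 1))) \<in> K" "v \<in> vertex_support (q (2 * (2 * t - 1)))"
        using realization_set_support[OF K r[OF s(3)]] v[OF s(3)] by simp_all
      then show ?thesis
        unfolding s(1,2) vertex_support_vertex_point by (simp only: Un_insert_right Un_empty_right insert_absorb)
    next
      case 3
      then have e: "?q1 t = ?b" "?q2 t = c (1 - (2 * (2 * t - 1) - 1))"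
        by (auto simp: path_concat_def path_reverse_def)
      show ?thesis unfolding e by (rule bK)
    qed
  qed (use c q top loop in \<open>auto intro!: pathin_concat\<close>)
  also have "homotopic_rel_ends ?N ?q2 (path_concat c (path_reverse c))"
    using homotopic_rel_ends_const_left[OF c(2)]
    by (intro homotopic_rel_ends_concat homotopic_rel_ends_refl c) auto
  also have "homotopic_rel_ends ?N \<dots> (\<lambda>_. ?b)"
    using homotopic_rel_ends_inverse_right[OF c(1)] by simp
  finally show ?thesis .
qed

section \<open>Functoriality of Spanier groups and the two inclusions\<close>

lemma open_cover_vimage:
  assumes f: "continuous_map X Y f" and V: "open_cover Y \<V>"
  shows "open_cover X ((\<lambda>V. {x \<in> topspace X. f x \<in> V}) ` \<V>)"
  unfolding open_cover_def
proof (intro conjI ballI equalityI subsetI)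
  show "openin X U" if "U \<in> (\<lambda>V. {x \<in> topspace X. f x \<in> V}) ` \<V>" for U
    using that openin_continuous_map_preimage[OF f] open_coverD(1)[OF V] by blast
  fix x assume x: "x \<in> topspace X"
  then have "f x \<in> topspace Y" using f continuous_map_image_subset_topspace by fastforce
  then obtain V where "V \<in> \<V>" "f x \<in> V" using open_coverD(2)[OF V] by blast
  then show "x \<in> \<Union>((\<lambda>V. {x \<in> topspace X. f x \<in> V}) ` \<V>)" using x by blast
qed auto

lemma spanier_generators_pi1_map:
  assumes f: "continuous_map X Y f"
    and h: "h \<in> spanier_generators X x0 ((\<lambda>V. {x \<in> topspace X. f x \<in> V}) ` \<V>)"
  shows "pi1_map Y f h \<in> spanier_generators Y (f x0) \<V>"
proof -
  obtain \<alpha> \<gamma> V where \<alpha>: "pathin X \<alpha>" "\<alpha> 0 = x0" and \<gamma>: "pathin X \<gamma>" "\<gamma> 0 = \<alpha> 1" "\<gamma> 1 = \<alpha> 1"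
    and V: "V \<in> \<V>" "\<gamma> ` {0..1} \<subseteq> {x \<in> topspace X. f x \<in> V}"
    and heq: "h = path_class X (path_concat (path_concat \<alpha> \<gamma>) (path_reverse \<alpha>))"
    using h unfolding spanier_generators_def loops_at_def by blast
  have "pi1_map Y f h =
      path_class Y (path_concat (path_concat (f \<circ> \<alpha>) (f \<circ> \<gamma>)) (path_reverse (f \<circ> \<alpha>)))"
    using \<alpha> \<gamma> f
    by (simp add: heq pi1_map_path_class pathin_concat pathin_reverse compose_path_concat compose_path_reverse)
  moreover have "f \<circ> \<gamma> \<in> loops_at Y ((f \<circ> \<alpha>) 1)" "pathin Y (f \<circ> \<alpha>)" "(f \<circ> \<alpha>) 0 = f x0"
    using \<alpha> \<gamma> f by (auto simp: loops_at_def pathin_compose)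
  moreover have "(f \<circ> \<gamma>) ` {0..1} \<subseteq> V" using V(2) by auto
  ultimately show ?thesis using V(1) unfolding spanier_generators_def by blast
qed

text \<open>An open cover of \<open>Y\<close> pulls back to one of \<open>X\<close>, and generators
  for the pulled-back cover are sent to generators. Besides naturality, this is applied to canonical
  maps, with a nerve as target.\<close>

lemma spanier_group_pi1_map:
  assumes f: "continuous_map X Y f" and x0: "x0 \<in> topspace X" and a: "a \<in> spanier_group X x0"
  shows "pi1_map Y f a \<in> spanier_group Y (f x0)"
  unfolding spanier_group_def
proof (intro INT_I)
  fix \<V> assume "\<V> \<in> {\<V>. open_cover Y \<V>}"
  then have V: "open_cover Y \<V>" by simp
  let ?U = "(\<lambda>V. {x \<in> topspace X. f x \<in> V}) ` \<V>"
  have fx0: "f x0 \<in> topspace Y" using f x0 continuous_map_image_subset_topspace by fastforce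
  interpret f: group_hom "fundamental_group X x0" "fundamental_group Y (f x0)" "pi1_map Y f"
    using group_fundamental_group[OF x0] group_fundamental_group[OF fx0] pi1_map_hom[OF f]
    by (simp add: group_hom_def group_hom_axioms_def)
  have "a \<in> generate (fundamental_group X x0) (spanier_generators X x0 ?U)"
    using a open_cover_vimage[OF f V] by (auto simp: spanier_group_def spanier_cover_group_def)
  then have "pi1_map Y f a \<in> generate (fundamental_group Y (f x0)) (pi1_map Y f ` spanier_generators X x0 ?U)"
    using f.generate_img[OF spanier_generators_subset_carrier] by blast
  also have "\<dots> \<subseteq> generate (fundamental_group Y (f x0)) (spanier_generators Y (f x0) \<V>)"
    using spanier_generators_pi1_map[OF f] by (intro f.H.mono_generate) blast
  finally show "pi1_map Y f a \<in> spanier_cover_group Y (f x0) \<V>" by (simp add: spanier_cover_group_def)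
qed

lemma subgroup_spanier_group:
  assumes x0: "x0 \<in> topspace X"
  shows "subgroup (spanier_group X x0) (fundamental_group X x0)"
  unfolding spanier_group_def
proof (rule group.subgroups_Inter[OF group_fundamental_group[OF x0]])
  have "open_cover X {topspace X}" by (simp add: open_cover_def)
  then show "spanier_cover_group X x0 ` {\<U>. open_cover X \<U>} \<noteq> {}" by blast
  show "subgroup H (fundamental_group X x0)" if "H \<in> spanier_cover_group X x0 ` {\<U>. open_cover X \<U>}" for H
    using that spanier_cover_group_normal[OF x0] normal_imp_subgroup by blast
qed

lemma spanier_generators_star_trivial:
  assumes y0: "y0 \<in> realization_set (nerve \<U>)"
    and h: "h \<in> spanier_generators (realization (nerve \<U>)) y0 (open_star (nerve \<U>) ` \<U>)"
  shows "h = \<one>\<^bsub>fundamental_group (realization (nerve \<U>)) y0\<^esub>"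
proof -
  let ?N = "realization (nerve \<U>)"
  obtain \<alpha> \<gamma> V where \<alpha>: "pathin ?N \<alpha>" "\<alpha> 0 = y0" and \<gamma>: "pathin ?N \<gamma>" "\<gamma> 0 = \<alpha> 1" "\<gamma> 1 = \<alpha> 1"
    and V: "\<gamma> ` {0..1} \<subseteq> open_star (nerve \<U>) V"
    and heq: "h = path_class ?N (path_concat (path_concat \<alpha> \<gamma>) (path_reverse \<alpha>))"
    using h unfolding spanier_generators_def loops_at_def by blast
  have "homotopic_rel_ends ?N \<gamma> (\<lambda>_. \<gamma> 0)"
    by (rule loop_in_open_star_trivial[OF simplicial_complex_nerve \<gamma>(1)]) (use \<gamma> V in auto)
  then have "homotopic_rel_ends ?N (path_concat \<alpha> \<gamma>) (path_concat \<alpha> (\<lambda>_. \<alpha> 1))"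
    using \<alpha> \<gamma> by (intro homotopic_rel_ends_concat homotopic_rel_ends_refl) auto
  also have "homotopic_rel_ends ?N \<dots> \<alpha>" by (rule homotopic_rel_ends_const_right[OF \<alpha>(1)])
  finally have "homotopic_rel_ends ?N (path_concat (path_concat \<alpha> \<gamma>) (path_reverse \<alpha>))
      (path_concat \<alpha> (path_reverse \<alpha>))"
    using \<alpha> \<gamma> by (intro homotopic_rel_ends_concat homotopic_rel_ends_refl pathin_reverse) auto
  also have "homotopic_rel_ends ?N \<dots> (\<lambda>_. \<alpha> 0)" by (rule homotopic_rel_ends_inverse_right[OF \<alpha>(1)])
  finally show ?thesis using \<alpha> by (simp add: heq fundamental_group_one path_class_eqI)
qed

lemma open_cover_stars: "open_cover (realization (nerve \<U>)) (open_star (nerve \<U>) ` \<U>)"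
  unfolding open_cover_def
proof (intro conjI ballI equalityI subsetI)
  show "openin (realization (nerve \<U>)) S" if "S \<in> open_star (nerve \<U>) ` \<U>" for S
    using that by (elim imageE) (simp add: openin_open_star)
  fix t assume "t \<in> topspace (realization (nerve \<U>))"
  then have t: "t \<in> realization_set (nerve \<U>)" by simp
  then obtain U where "U \<in> vertex_support t"
    using realization_set_support[OF simplicial_complex_nerve t] by (fastforce simp: nerve_def)
  then show "t \<in> \<Union>(open_star (nerve \<U>) ` \<U>)"
    using open_star_iff_support[OF t] realization_nerve_support(1)[OF t] by blast
qed (auto simp: open_star_def)

text \<open>The cover by open stars already suffices: its generators are conjugates of loops that
  contract within the realization.\<close>

lemma spanier_group_realization_trivial:
  assumes y0: "y0 \<in> realization_set (nerve \<U>)"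
    and a: "a \<in> spanier_group (realization (nerve \<U>)) y0"
  shows "a = \<one>\<^bsub>fundamental_group (realization (nerve \<U>)) y0\<^esub>"
proof -
  let ?G = "fundamental_group (realization (nerve \<U>)) y0"
  interpret group ?G using y0 by (intro group_fundamental_group) simp
  have "a \<in> generate ?G (spanier_generators (realization (nerve \<U>)) y0 (open_star (nerve \<U>) ` \<U>))"
    using a open_cover_stars[of \<U>] by (auto simp: spanier_group_def spanier_cover_group_def)
  then show ?thesis
    using generate_subgroup_incl[OF _ triv_subgroup, of "spanier_generators _ y0 (open_star (nerve \<U>) ` \<U>)"]
      spanier_generators_star_trivial[OF y0] by blast
qed

lemma kernel_shape_hom:
  assumes X: "path_connected_space X" "locally_path_connected_space X" "paracompact_space X" "Hausdorff_space X"
    and x0: "x0 \<in> topspace X"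
  shows "kernel (fundamental_group X x0) (shape_group X x0) (shape_hom X x0) = spanier_group X x0"
proof (intro equalityI subsetI)
  fix a assume a: "a \<in> kernel (fundamental_group X x0) (shape_group X x0) (shape_hom X x0)"
  then obtain \<alpha> where \<alpha>: "pathin X \<alpha>" "\<alpha> 0 = x0" "\<alpha> 1 = x0" "a = path_class X \<alpha>"
    unfolding kernel_def by (blast elim: fundamental_group_carrierE)
  show "a \<in> spanier_group X x0"
    unfolding spanier_group_def
  proof (intro INT_I)
    fix \<U> assume "\<U> \<in> {\<U>. open_cover X \<U>}"
    then obtain \<S> where S: "open_cover X \<S>" "\<And>S. S \<in> \<S> \<Longrightarrow> path_connectedin X S"
      "\<And>S. S \<in> \<S> \<Longrightarrow> \<exists>U\<in>\<U>. \<forall>T\<in>\<S>. S \<inter> T \<noteq> {} \<longrightarrow> T \<subseteq> U"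
      using path_connected_star_refinement[OF X(3,4,2)] by blast
    obtain v where v: "v \<in> shape_index X x0" "cover_refines (fst v) \<S>"
      using shape_index_refines[OF X(3,4) S(1) x0] by blast
    let ?p = "SOME p. canonical_map X x0 v p"
    note p = canonical_map_some[OF v(1)]
    have "shape_hom X x0 a v = \<one>\<^bsub>nerve_pi1 v\<^esub>"
      using a v(1) unfolding kernel_def by (simp add: one_shape_group)
    then have "path_class (realization (nerve (fst v))) (?p \<circ> \<alpha>) =
        path_class (realization (nerve (fst v))) (\<lambda>_. vertex_point (snd v))"
      using shape_hom_path_class[OF v(1) \<alpha>(1)] \<alpha>(4) by (simp add: nerve_pi1_def fundamental_group_one)
    then have null: "homotopic_rel_ends (realization (nerve (fst v))) (?p \<circ> \<alpha>) (\<lambda>_. vertex_point (snd v))"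
      using path_class_eq_iff[OF pathin_compose[OF \<alpha>(1) canonical_mapD(1)[OF p]]] by simp
    show "a \<in> spanier_cover_group X x0 \<U>"
      unfolding \<alpha>(4)
      by (rule null_homotopic_in_nerve_imp_spanier[OF X(1) _ _ v p \<alpha>(1-3) null]) (fact S(2), fact S(3))
  qed
next
  fix a assume a: "a \<in> spanier_group X x0"
  have "a \<in> carrier (fundamental_group X x0)"
    using a subgroup.subset[OF subgroup_spanier_group[OF x0]] by blast
  moreover have "shape_hom X x0 a = \<one>\<^bsub>shape_group X x0\<^esub>"
  proof
    fix u
    show "shape_hom X x0 a u = \<one>\<^bsub>shape_group X x0\<^esub> u"
    proof (cases "u \<in> shape_index X x0")
      case True
      let ?p = "SOME p. canonical_map X x0 u p"
      note p = canonical_mapD[OF canonical_map_some[OF True]]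
      have "?p x0 \<in> realization_set (nerve (fst u))"
        using p(1) x0 continuous_map_image_subset_topspace[OF p(1)] by auto
      \<comment> \<open>The canonical map sends the Spanier group of \<open>X\<close> into that of
        the nerve, which is trivial; this settles the component at \<open>u\<close>.\<close>
      then have "pi1_map (realization (nerve (fst u))) ?p a =
          \<one>\<^bsub>fundamental_group (realization (nerve (fst u))) (?p x0)\<^esub>"
        using spanier_group_pi1_map[OF p(1) x0 a] by (rule spanier_group_realization_trivial)
      then show ?thesis using True p(2) by (simp add: shape_hom_def one_shape_group nerve_pi1_def)
    qed (simp add: shape_hom_def one_shape_group)
  qed
  ultimately show "a \<in> kernel (fundamental_group X x0) (shape_group X x0) (shape_hom X x0)"
    by (simp add: kernel_def)
qed

theorem theorem35:
  fixes X :: "'a topology" and x0 :: 'a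
  assumes "path_connected_space X" and "locally_path_connected_space X"
    and "paracompact_space X" and "Hausdorff_space X" and "x0 \<in> topspace X"
  shows "group_hom (fundamental_group X x0) (shape_group X x0) (shape_hom X x0) \<and>
    subgroup (spanier_group X x0) (fundamental_group X x0) \<and>
    kernel (fundamental_group X x0) (shape_group X x0) (shape_hom X x0) = spanier_group X x0 \<and>
    (\<forall>(Y :: 'b topology) y0 f.
       path_connected_space Y \<and> locally_path_connected_space Y \<and>
       paracompact_space Y \<and> Hausdorff_space Y \<and> y0 \<in> topspace Y \<and>
       continuous_map X Y f \<and> f x0 = y0 \<longrightarrow>
         pi1_map Y f \<in> hom (fundamental_group X x0) (fundamental_group Y y0) \<and>
         shape_map X Y y0 f \<in> hom (shape_group X x0) (shape_group Y y0) \<and>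
         pi1_map Y f ` spanier_group X x0 \<subseteq> spanier_group Y y0 \<and>
         (\<forall>a\<in>carrier (fundamental_group X x0).
            shape_map X Y y0 f (shape_hom X x0 a) = shape_hom Y y0 (pi1_map Y f a)))"
proof (intro conjI allI impI)
  show "group_hom (fundamental_group X x0) (shape_group X x0) (shape_hom X x0)"
    by (rule shape_hom_group_hom[OF assms(5)])
  show "subgroup (spanier_group X x0) (fundamental_group X x0)"
    by (rule subgroup_spanier_group[OF assms(5)])
  show "kernel (fundamental_group X x0) (shape_group X x0) (shape_hom X x0) = spanier_group X x0"
    by (rule kernel_shape_hom[OF assms])
  fix Y :: "'b topology" and y0 f
  assume "path_connected_space Y \<and> locally_path_connected_space Y \<and>
    paracompact_space Y \<and> Hausdorff_space Y \<and> y0 \<in> topspace Y \<and> continuous_map X Y f \<and> f x0 = y0"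
  then have f: "continuous_map X Y f" "f x0 = y0" by auto
  show "pi1_map Y f \<in> hom (fundamental_group X x0) (fundamental_group Y y0)"
    using pi1_map_hom[OF f(1), of x0] f(2) by simp
  show "shape_map X Y y0 f \<in> hom (shape_group X x0) (shape_group Y y0)"
    by (rule shape_map_hom[OF f assms(5)])
  show "pi1_map Y f ` spanier_group X x0 \<subseteq> spanier_group Y y0"
    using spanier_group_pi1_map[OF f(1) assms(5)] f(2) by blast
  show "\<forall>a\<in>carrier (fundamental_group X x0).
      shape_map X Y y0 f (shape_hom X x0 a) = shape_hom Y y0 (pi1_map Y f a)"
    using shape_map_shape_hom[OF f assms(5)] by blast
qed

end
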